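(* Let $\tau_0:=\inf\{t\ge 0: Q(t)=0\}$. For each $\gamma>0$, $$\mathbb{E}\exp\left[-\gamma\int_0^{\tau_0}Q(t)\,\mathrm{d}t\right]=\frac{2c}{\mathrm{Ai}\left((2\gamma)^{-2/3}c^2\right)}\int_0^\infty e^{-cx}\,\mathrm{Ai}\left((2\gamma)^{-2/3}c^2+(2\gamma)^{1/3}x\right)\mathrm{d}x.$$
   Context: $\{B(t):t\in\mathbb{R}\}$ is a two-sided standard Brownian motion ($B(0)=0$, $\mathbb{E}B(t)=0$, $\mathrm{Var}\,B(t)=|t|$), and $c>0$ is a fixed constant. The stationary workload (Brownian storage) process is $Q(t)=\sup_{s\le t}\left(B(t)-B(s)-c(t-s)\right)$, $t\in\mathbb{R}$. The Airy function is $\mathrm{Ai}(x)=\frac{1}{\pi}\int_0^\infty\cos\left(\frac13t^3+xt\right)\mathrm{d}t$ (improper integral). *)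

theory Defs
  imports "HOL-Probability.Probability"
begin

text \<open>
  The path condition and the normalisation at time 0 are only required almost surely; no
  completeness of the underlying probability space is assumed.
\<close>

locale two_sided_brownian_motion = prob_space M
  for M :: "'a measure" and B :: "real \<Rightarrow> 'a \<Rightarrow> real" +
  assumes measurable_B: "\<And>t. B t \<in> borel_measurable M"
    and B_0: "AE \<omega> in M. B 0 \<omega> = 0"
    and indep_increments:
      "\<And>(t :: nat \<Rightarrow> real) n. strict_mono_on {..n} t \<Longrightarrow>
         indep_vars (\<lambda>_. borel) (\<lambda>i \<omega>. B (t (Suc i)) \<omega> - B (t i) \<omega>) {..<n}"
    and normal_increments:
      "\<And>s t. s < t \<Longrightarrow>
         distributed M lborel (\<lambda>\<omega>. B t \<omega> - B s \<omega>) (normal_density 0 (sqrt (t - s)))"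
    and continuous_paths: "AE \<omega> in M. continuous_on UNIV (\<lambda>t. B t \<omega>)"

text \<open>
  Both definitions below are pathwise, for a path \<open>b\<close> of the driving process. For \<open>c > 0\<close>, almost
  every Brownian path makes the supremum finite and the set of zeros nonempty, so the real-valued
  \<open>Sup\<close> and \<open>Inf\<close> take unspecified values only on a null set.
\<close>

definition workload :: "real \<Rightarrow> (real \<Rightarrow> real) \<Rightarrow> real \<Rightarrow> real" where
  "workload c b t = (SUP s\<in>{..t}. b t - b s - c * (t - s))"

definition first_zero_time :: "(real \<Rightarrow> real) \<Rightarrow> real" where
  "first_zero_time q = Inf {t. 0 \<le> t \<and> q t = 0}"

text \<open>
  The Airy integral converges only conditionally (its Lebesgue integral over the half-line does
  not exist), hence the explicit limit.
\<close>

definition Airy_Ai :: "real \<Rightarrow> real" where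
  "Airy_Ai x = 1 / pi * Lim at_top (\<lambda>T. integral {0..T} (\<lambda>t. cos (t ^ 3 / 3 + x * t)))"

end

theory Submission
  imports Defs
    "HOL-Complex_Analysis.Cauchy_Integral_Theorem"
    "HOL-Real_Asymp.Real_Asymp"
begin

text \<open>
  Up to the first zero, \<open>Q t = Q 0 + B t - c t\<close>, where \<open>Q 0\<close> is exponential with rate \<open>2 c\<close> and depends
  only on the past of the Brownian motion. Shifting the contour of the Airy integral by \<open>i c / a\<close> with
  \<open>a ^ 3 = 2 \<gamma>\<close> shows that \<open>exp (c x) Ai (c\<^sup>2 / a\<^sup>2 + a x)\<close> is a constant multiple of
  \<open>u x = \<integral> exp (- c w\<^sup>2 / (2 \<gamma>)) cos (w ^ 3 / (6 \<gamma>) + x w) dw\<close>, a bounded function for which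
  \<open>exp (- \<gamma> \<integral> Q) u Q\<close> is a martingale up to the first zero; optional stopping gives the theorem.

  No stochastic calculus is needed, because the discrete analogue is exact. For a random walk with
  \<open>N (- c h, h)\<close> steps, discounted by \<open>exp (- \<gamma> h x)\<close> per step, a superposition of plane waves
  \<open>exp (i w x)\<close> with the exponential of a cubic polynomial as weight is harmonic as soon as that
  polynomial solves a first order difference equation with step \<open>i \<gamma> h\<close>; this is again a contour shift.
  Optional stopping for the walk on a dyadic grid is then elementary, and path continuity suffices for
  the passage to the limit. The law of \<open>Q 0\<close> comes from the same discrete argument applied to truncations
  of \<open>exp (2 c y)\<close>.
\<close>

section \<open>Cubic exponentials and the Airy function\<close>

text \<open>Each sufficiently fine mesh has its own exact harmonic function, with damping and
  argument slightly displaced from their continuous-time values, and Lipschitz bounds in these two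
  parameters carry the limit. Three obstacles shape the rest. The Airy integral is not absolutely
  convergent, so everything is proved for its shifted, Gaussian-damped form. The workload and its
  first zero are pathwise limits only almost surely, so measurability holds up to null sets and the
  expectation lives on the completion. Finally, optional stopping yields the expectation multiplied
  by the value of the harmonic function at 0, and division requires that value to be nonzero; the
  elementary estimate below gives a positive \<open>Airy_Ai\<close> only from 1 on, whereas the
  argument in the denominator may be any positive number. Hence the identity carries an extra weight
  in the initial workload: if the value at 0 vanished, a weight supported where positivity is known
  would give a contradiction.\<close>

definition cubic_exp :: "real \<Rightarrow> real \<Rightarrow> real \<Rightarrow> complex \<Rightarrow> complex" where
  "cubic_exp \<kappa> \<alpha> y z = exp (\<i> * of_real \<kappa> * z ^ 3 - of_real \<alpha> * z\<^sup>2 + \<i> * of_real y * z)"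

text \<open>The cross term \<open>- 3 * t\<^sup>2 * s\<close> turns an upward shift of the contour
  into Gaussian decay in \<open>t\<close>. Both the convergence of shifted integrals and the
  vanishing of the vertical sides of rectangles come from it.\<close>

lemma norm_cubic_exp:
  "norm (cubic_exp \<kappa> \<alpha> y (of_real t + \<i> * of_real s)) =
     exp (\<kappa> * (s ^ 3 - 3 * t\<^sup>2 * s) - \<alpha> * (t\<^sup>2 - s\<^sup>2) - y * s)"
  unfolding cubic_exp_def norm_exp_eq_Re
  by (simp add: power3_eq_cube power2_eq_square algebra_simps)

lemma Re_cubic_exp_of_real:
  "Re (cubic_exp \<kappa> \<alpha> y (of_real t)) = exp (- \<alpha> * t\<^sup>2) * cos (\<kappa> * t ^ 3 + y * t)"
  unfolding cubic_exp_def Re_exp by (simp add: power3_eq_cube power2_eq_square)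

lemma continuous_on_cubic_exp [continuous_intros]:
  "continuous_on S f \<Longrightarrow> continuous_on S (\<lambda>x. cubic_exp \<kappa> \<alpha> y (f x))"
  unfolding cubic_exp_def by (intro continuous_intros)

text \<open>With a global primitive, the integral along each side of a rectangle is a difference of
  corner values, so Cauchy's theorem reduces to telescoping.\<close>

lemma cubic_exp_primitive:
  obtains F where "\<And>z. (F has_field_derivative cubic_exp \<kappa> \<alpha> y z) (at z)"
proof -
  have "cubic_exp \<kappa> \<alpha> y holomorphic_on UNIV"
    unfolding cubic_exp_def by (intro holomorphic_intros)
  from holomorphic_convex_primitive'[OF convex_UNIV open_UNIV this] that show thesis by auto
qed

text \<open>On the vertical side at abscissa \<open>T\<close> the integrand is bounded by a constant
  times \<open>exp (- 3 * \<kappa> * T\<^sup>2 * r)\<close> at height \<open>r\<close>, whose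
  integral over \<open>r\<close> is of order \<open>1 / T\<^sup>2\<close>. The cubic term alone
  gives this, so \<alpha> may be 0, as the undamped Airy integral requires.\<close>

lemma cubic_exp_vertical_bound:
  fixes F :: "complex \<Rightarrow> complex"
  assumes F: "\<And>z. (F has_field_derivative cubic_exp \<kappa> \<alpha> y z) (at z)"
    and "\<kappa> > 0" "\<alpha> \<ge> 0" "s \<ge> 0" "T \<noteq> 0"
  shows "norm (F (of_real T + \<i> * of_real s) - F (of_real T)) \<le>
    exp (\<kappa> * s ^ 3 + \<alpha> * s\<^sup>2 + \<bar>y\<bar> * s) / (3 * \<kappa> * T\<^sup>2)"
proof -
  let ?C = "exp (\<kappa> * s ^ 3 + \<alpha> * s\<^sup>2 + \<bar>y\<bar> * s)" and ?a = "3 * \<kappa> * T\<^sup>2"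
  have a: "?a > 0" using assms by simp
  let ?f = "\<lambda>r. \<i> * cubic_exp \<kappa> \<alpha> y (of_real T + \<i> * of_real r)"
  have f: "(?f has_integral F (of_real T + \<i> * of_real s) - F (of_real T + \<i> * of_real 0)) {0..s}"
  proof (rule fundamental_theorem_of_calculus)
    fix r assume "r \<in> {0..s}"
    have "((\<lambda>r. of_real T + \<i> * of_real r) has_vector_derivative \<i>) (at r within {0..s})"
      by (auto intro!: derivative_eq_intros)
    from field_vector_diff_chain_within[OF this has_field_derivative_at_within[OF F]]
    show "((\<lambda>r. F (of_real T + \<i> * of_real r)) has_vector_derivative ?f r) (at r within {0..s})"
      by (simp add: o_def)
  qed fact
  have g: "((\<lambda>r. ?C * exp (- ?a * r)) has_integral
      (- ?C / ?a * exp (- ?a * s)) - (- ?C / ?a * exp (- ?a * 0))) {0..s}"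
    using assms by (intro fundamental_theorem_of_calculus)
      (auto intro!: derivative_eq_intros simp flip: has_real_derivative_iff_has_vector_derivative)
  have "norm (integral {0..s} ?f) \<le> integral {0..s} (\<lambda>r. ?C * exp (- ?a * r))"
  proof (rule integral_norm_bound_integral)
    fix r assume r: "r \<in> {0..s}"
    have "- y * r \<le> \<bar>y\<bar> * r"
      using r by (intro mult_right_mono) auto
    moreover have "\<kappa> * r ^ 3 \<le> \<kappa> * s ^ 3" "\<alpha> * r\<^sup>2 \<le> \<alpha> * s\<^sup>2" "0 \<le> \<alpha> * T\<^sup>2"
      "\<bar>y\<bar> * r \<le> \<bar>y\<bar> * s"
      using r assms by (auto intro!: mult_left_mono power_mono)
    ultimately have "\<kappa> * (r ^ 3 - 3 * T\<^sup>2 * r) - \<alpha> * (T\<^sup>2 - r\<^sup>2) - y * r \<le> \<kappa> * s ^ 3 + \<alpha> * s\<^sup>2 + \<bar>y\<bar> * s + (- ?a * r)"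
      by (simp add: algebra_simps)
    then show "norm (?f r) \<le> ?C * exp (- ?a * r)"
      by (simp add: norm_mult norm_cubic_exp flip: exp_add)
  qed (use f g in blast)+
  also have "\<dots> = ?C / ?a - ?C / ?a * exp (- ?a * s)"
    using g[THEN integral_unique] by simp
  also have "\<dots> \<le> ?C / ?a" using a by simp
  finally show ?thesis using f[THEN integral_unique] by simp
qed

text \<open>Only the difference is claimed to converge: for \<open>\<alpha> = 0\<close> the integral
  along the real line is not absolutely convergent, and its convergence will be deduced from that of
  the shifted one.\<close>

lemma cubic_exp_shift_segment:
  assumes "\<kappa> > 0" "\<alpha> \<ge> 0" "s \<ge> 0"
  shows "((\<lambda>T. integral {-T..T} (\<lambda>t. cubic_exp \<kappa> \<alpha> y (of_real t + \<i> * of_real s)) -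
      integral {-T..T} (\<lambda>t. cubic_exp \<kappa> \<alpha> y (of_real t))) \<longlongrightarrow> 0) at_top"
proof -
  obtain F where F: "\<And>z. (F has_field_derivative cubic_exp \<kappa> \<alpha> y z) (at z)"
    using cubic_exp_primitive[of \<kappa> \<alpha> y] by blast
  let ?C = "exp (\<kappa> * s ^ 3 + \<alpha> * s\<^sup>2 + \<bar>y\<bar> * s)"
  have horiz: "integral {-T..T} (\<lambda>t. cubic_exp \<kappa> \<alpha> y (of_real t + \<i> * of_real r)) =
      F (of_real T + \<i> * of_real r) - F (of_real (- T) + \<i> * of_real r)" if "T > 0" for T r
  proof (intro integral_unique fundamental_theorem_of_calculus)
    fix t assume "t \<in> {-T..T}"
    have "((\<lambda>t. of_real t + \<i> * of_real r) has_vector_derivative 1) (at t within {-T..T})"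
      by (auto intro!: derivative_eq_intros)
    from field_vector_diff_chain_within[OF this has_field_derivative_at_within[OF F]]
    show "((\<lambda>t. F (of_real t + \<i> * of_real r)) has_vector_derivative
        cubic_exp \<kappa> \<alpha> y (of_real t + \<i> * of_real r)) (at t within {-T..T})"
      by (simp add: o_def)
  qed (use that in auto)
  show ?thesis
  proof (rule Lim_null_comparison)
    show "((\<lambda>T. 2 * (?C / (3 * \<kappa> * T\<^sup>2))) \<longlongrightarrow> 0) at_top"
      using assms by real_asymp
    show "\<forall>\<^sub>F T in at_top. norm (integral {-T..T} (\<lambda>t. cubic_exp \<kappa> \<alpha> y (of_real t + \<i> * of_real s)) -
      integral {-T..T} (\<lambda>t. cubic_exp \<kappa> \<alpha> y (of_real t))) \<le> 2 * (?C / (3 * \<kappa> * T\<^sup>2))"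
      using eventually_gt_at_top[of 0]
    proof eventually_elim
      fix T :: real assume T: "T > 0"
      have 1: "norm (F (of_real T + \<i> * of_real s) - F (of_real T)) \<le> ?C / (3 * \<kappa> * T\<^sup>2)"
        using cubic_exp_vertical_bound[OF F, of s T] assms T by auto
      have 2: "norm (F (of_real (-T) + \<i> * of_real s) - F (of_real (-T))) \<le> ?C / (3 * \<kappa> * T\<^sup>2)"
        using cubic_exp_vertical_bound[OF F, of s "-T"] assms T by auto
      have eq: "integral {-T..T} (\<lambda>t. cubic_exp \<kappa> \<alpha> y (of_real t + \<i> * of_real s)) -
          integral {-T..T} (\<lambda>t. cubic_exp \<kappa> \<alpha> y (of_real t)) =
        (F (of_real T + \<i> * of_real s) - F (of_real T)) - (F (of_real (-T) + \<i> * of_real s) - F (of_real (-T)))"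
        using horiz[OF T, of s] horiz[OF T, of 0] by simp
      show "norm (integral {-T..T} (\<lambda>t. cubic_exp \<kappa> \<alpha> y (of_real t + \<i> * of_real s)) -
          integral {-T..T} (\<lambda>t. cubic_exp \<kappa> \<alpha> y (of_real t))) \<le> 2 * (?C / (3 * \<kappa> * T\<^sup>2))"
        unfolding eq using norm_triangle_ineq4[of "F (of_real T + \<i> * of_real s) - F (of_real T)"
            "F (of_real (-T) + \<i> * of_real s) - F (of_real (-T))"] 1 2 by linarith
    qed
  qed
qed

section \<open>Contour shift for absolutely convergent integrals\<close>

lemma tendsto_integral_symmetric_interval:
  fixes f :: "real \<Rightarrow> complex"
  assumes f: "integrable lborel f"
  shows "((\<lambda>T. integral {-T..T} f) \<longlongrightarrow> integral\<^sup>L lborel f) at_top"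
proof -
  have [measurable]: "f \<in> borel_measurable borel" using f by auto
  have "integral {-T..T} f = (\<integral>x. indicator {-T..T} x *\<^sub>R f x \<partial>lborel)" for T
  proof -
    have "set_integrable lborel {-T..T} f"
      unfolding set_integrable_def using f by (rule integrable_mult_indicator[rotated]) simp
    from set_borel_integral_eq_integral(2)[OF this] show ?thesis
      by (simp add: set_lebesgue_integral_def)
  qed
  moreover have "((\<lambda>T. \<integral>x. indicator {-T..T} x *\<^sub>R f x \<partial>lborel) \<longlongrightarrow> integral\<^sup>L lborel f) at_top"
  proof (rule integral_dominated_convergence_at_top[where w="\<lambda>x. norm (f x)"])
    show "AE x in lborel. ((\<lambda>T. indicator {-T..T} x *\<^sub>R f x) \<longlongrightarrow> f x) at_top"
    proof (rule AE_I2)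
      fix x :: real
      have "\<forall>\<^sub>F T in at_top. f x = indicator {-T..T} x *\<^sub>R f x"
        using eventually_ge_at_top[of "\<bar>x\<bar>"] by eventually_elim (auto simp: indicator_def)
      then show "((\<lambda>T. indicator {-T..T} x *\<^sub>R f x) \<longlongrightarrow> f x) at_top"
        by (rule Lim_transform_eventually[OF tendsto_const])
    qed
    show "\<forall>\<^sub>F T in at_top. AE x in lborel. norm (indicator {-T..T} x *\<^sub>R f x) \<le> norm (f x)"
      by (auto simp: indicator_def)
  qed (use f in auto)
  ultimately show ?thesis by simp
qed

lemma integrable_gaussian_moment:
  fixes \<alpha> :: real
  assumes "\<alpha> > 0"
  shows "integrable lborel (\<lambda>t. exp (- \<alpha> * t\<^sup>2) * \<bar>t\<bar> ^ k)"
proof -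
  let ?s = "sqrt (1 / (2 * \<alpha>))"
  have "integrable lborel (\<lambda>t. sqrt (2 * pi * ?s\<^sup>2) * (normal_density 0 ?s t * \<bar>t - 0\<bar> ^ k))"
    using assms by (intro integrable_mult_right integrable_normal_moment_abs) auto
  then show ?thesis
    using assms by (simp add: normal_density_def field_simps)
qed

lemma integrable_gaussian: "\<alpha> > 0 \<Longrightarrow> integrable lborel (\<lambda>t::real. exp (- \<alpha> * t\<^sup>2))"
  using integrable_gaussian_moment[of \<alpha> 0] by simp

lemma borel_measurable_cubic_exp [measurable]:
  "f \<in> borel_measurable M \<Longrightarrow> (\<lambda>x. cubic_exp \<kappa> \<alpha> y (f x)) \<in> borel_measurable M"
  by (rule borel_measurable_continuous_on) (auto intro!: continuous_intros)

lemma integrable_cubic_exp: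
  assumes "\<kappa> \<ge> 0" "s \<ge> 0" "\<alpha> + 3 * \<kappa> * s > 0"
  shows "integrable lborel (\<lambda>t. cubic_exp \<kappa> \<alpha> y (of_real t + \<i> * of_real s))"
proof (rule Bochner_Integration.integrable_bound)
  show "integrable lborel (\<lambda>t. exp (\<kappa> * s ^ 3 + \<alpha> * s\<^sup>2 - y * s) * exp (- (\<alpha> + 3 * \<kappa> * s) * t\<^sup>2))"
    by (intro integrable_mult_right integrable_gaussian assms)
  have "norm (cubic_exp \<kappa> \<alpha> y (of_real t + \<i> * of_real s)) =
      exp (\<kappa> * s ^ 3 + \<alpha> * s\<^sup>2 - y * s) * exp (- (\<alpha> + 3 * \<kappa> * s) * t\<^sup>2)" for t
    unfolding norm_cubic_exp by (simp add: algebra_simps flip: exp_add)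
  then show "AE x in lborel. norm (cubic_exp \<kappa> \<alpha> y (complex_of_real x + \<i> * complex_of_real s))
         \<le> norm (exp (\<kappa> * s ^ 3 + \<alpha> * s\<^sup>2 - y * s) * exp (- (\<alpha> + 3 * \<kappa> * s) * x\<^sup>2))"
    by simp
qed measurable

lemma integrable_cubic_exp_of_real:
  assumes "\<kappa> \<ge> 0" "\<alpha> > 0"
  shows "integrable lborel (\<lambda>t. cubic_exp \<kappa> \<alpha> y (of_real t))"
  using integrable_cubic_exp[of \<kappa> 0 \<alpha> y] assms by simp

lemma integral_cubic_exp_shift:
  assumes "\<kappa> > 0" "\<alpha> > 0" "s \<ge> 0"
  shows "(\<integral>t. cubic_exp \<kappa> \<alpha> y (of_real t + \<i> * of_real s) \<partial>lborel) =
    (\<integral>t. cubic_exp \<kappa> \<alpha> y (of_real t) \<partial>lborel)"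
proof -
  let ?f = "\<lambda>s t. cubic_exp \<kappa> \<alpha> y (of_real t + \<i> * of_real s)"
  let ?g = "\<lambda>t. cubic_exp \<kappa> \<alpha> y (of_real t)"
  have pos: "\<alpha> + 3 * \<kappa> * s > 0" using assms by (simp add: add_pos_nonneg)
  have "((\<lambda>T. integral {-T..T} (?f s) - integral {-T..T} ?g) \<longlongrightarrow>
      integral\<^sup>L lborel (?f s) - integral\<^sup>L lborel ?g) at_top"
    using assms pos
    by (intro tendsto_diff tendsto_integral_symmetric_interval integrable_cubic_exp integrable_cubic_exp_of_real) auto
  moreover have "((\<lambda>T. integral {-T..T} (?f s) - integral {-T..T} ?g) \<longlongrightarrow> 0) at_top"
    using cubic_exp_shift_segment[of \<kappa> \<alpha> s y] assms by auto
  ultimately show ?thesis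
    using tendsto_unique[OF trivial_limit_at_top_linorder] by fastforce
qed

section \<open>The damped representation of the Airy function\<close>

text \<open>On the horizontal line through \<open>i \<eta>\<close>, the Airy integrand acquires the factor \<open>exp (- \<eta> t\<^sup>2)\<close>.\<close>

definition damped_airy :: "real \<Rightarrow> real \<Rightarrow> real \<Rightarrow> real" where
  "damped_airy \<kappa> \<alpha> y = (\<integral>t. exp (- \<alpha> * t\<^sup>2) * cos (\<kappa> * t ^ 3 + y * t) \<partial>lborel)"

lemma damped_airy_eq_Re:
  assumes "\<kappa> \<ge> 0" "\<alpha> > 0"
  shows "damped_airy \<kappa> \<alpha> y = Re (\<integral>t. cubic_exp \<kappa> \<alpha> y (of_real t) \<partial>lborel)"
  unfolding damped_airy_def
  by (subst integral_Re[OF integrable_cubic_exp_of_real[OF assms], symmetric])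
     (simp only: Re_cubic_exp_of_real)

lemma integrable_damped_cos:
  fixes \<alpha> :: real
  assumes "\<alpha> > 0"
  shows "integrable lborel (\<lambda>t. exp (- \<alpha> * t\<^sup>2) * cos (\<kappa> * t ^ 3 + y * t))"
  by (rule Bochner_Integration.integrable_bound[OF integrable_gaussian[OF assms]])
     (auto simp: abs_mult mult_left_le)

text \<open>Expanding the cube, height \<eta> contributes the damping
  \<open>- \<eta> * t\<^sup>2\<close> and moves the linear coefficient from \<open>x\<close> to
  \<open>x - \<eta>\<^sup>2\<close>.\<close>

lemma cubic_exp_shift_undamped:
  "cubic_exp (1/3) 0 x (of_real t + \<i> * of_real \<eta>) =
     of_real (exp (\<eta> ^ 3 / 3 - x * \<eta>)) * cubic_exp (1/3) \<eta> (x - \<eta>\<^sup>2) (of_real t)"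
  unfolding cubic_exp_def exp_of_real[symmetric] exp_add[symmetric]
  by (rule arg_cong[where f=exp]) (simp add: complex_eq_iff power3_eq_cube power2_eq_square algebra_simps)

text \<open>The cosine integrand is even, so the half-line integral is half the real part of a
  symmetric complex one, and shifting that to height \<eta> makes it absolutely convergent. This
  also proves that the limit in \<open>Airy_Ai\<close> exists, without which \<open>Lim\<close>
  would carry no information. The height \<eta> stays free and is later adapted to the
  argument.\<close>

lemma Airy_Ai_eq_damped_airy:
  assumes "\<eta> > 0"
  shows "Airy_Ai x = exp (\<eta> ^ 3 / 3 - x * \<eta>) / (2 * pi) * damped_airy (1/3) \<eta> (x - \<eta>\<^sup>2)"
proof -
  let ?J = "\<integral>t. cubic_exp (1/3) 0 x (of_real t + \<i> * of_real \<eta>) \<partial>lborel"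
  have J: "integrable lborel (\<lambda>t. cubic_exp (1/3) 0 x (of_real t + \<i> * of_real \<eta>))"
    using assms by (intro integrable_cubic_exp) auto
  have ReJ: "Re ?J = exp (\<eta> ^ 3 / 3 - x * \<eta>) * damped_airy (1/3) \<eta> (x - \<eta>\<^sup>2)"
    unfolding cubic_exp_shift_undamped using assms by (simp add: damped_airy_eq_Re)
  have half: "integral {0..T} (\<lambda>t. cos (t ^ 3 / 3 + x * t)) =
      Re (integral {-T..T} (\<lambda>t. cubic_exp (1/3) 0 x (of_real t))) / 2" if "T \<ge> 0" for T
  proof -
    let ?g = "\<lambda>t. cos (t ^ 3 / 3 + x * t)"
    have int: "?g integrable_on {a..b}" for a b
      by (auto intro!: integrable_continuous_interval continuous_intros)
    have "?g (-t) = ?g t" for t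
      using cos_minus[of "t ^ 3 / 3 + x * t"] by simp
    then have "integral {-T..-0} ?g = integral {0..T} ?g"
      using Henstock_Kurzweil_Integration.integral_reflect_real[of T 0 ?g] by simp
    then have "integral {-T..T} ?g = 2 * integral {0..T} ?g"
      using Henstock_Kurzweil_Integration.integral_combine[of "-T" 0 T ?g] int that by simp
    moreover have "Re (integral {-T..T} (\<lambda>t. cubic_exp (1/3) 0 x (of_real t))) = integral {-T..T} ?g"
      by (subst integral_linear[OF _ bounded_linear_Re, symmetric])
         (auto intro!: integrable_continuous_interval continuous_intros simp: Re_cubic_exp_of_real o_def)
    ultimately show ?thesis by simp
  qed
  \<comment> \<open>Convergent shifted integral minus vanishing difference: what remains is the
    undamped integral.\<close>
  have "((\<lambda>T. integral {-T..T} (\<lambda>t. cubic_exp (1/3) 0 x (of_real t + \<i> * of_real \<eta>)) -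
      (integral {-T..T} (\<lambda>t. cubic_exp (1/3) 0 x (of_real t + \<i> * of_real \<eta>)) -
      integral {-T..T} (\<lambda>t. cubic_exp (1/3) 0 x (of_real t)))) \<longlongrightarrow> ?J - 0) at_top"
    using assms by (intro tendsto_diff tendsto_integral_symmetric_interval J cubic_exp_shift_segment) auto
  then have "((\<lambda>T. Re (integral {-T..T} (\<lambda>t. cubic_exp (1/3) 0 x (of_real t))) / 2) \<longlongrightarrow> Re ?J / 2) at_top"
    by (auto intro!: tendsto_intros)
  moreover have "\<forall>\<^sub>F T in at_top. Re (integral {-T..T} (\<lambda>t. cubic_exp (1/3) 0 x (of_real t))) / 2 =
      integral {0..T} (\<lambda>t. cos (t ^ 3 / 3 + x * t))"
    using eventually_ge_at_top[of 0] by eventually_elim (simp add: half)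
  ultimately have "((\<lambda>T. integral {0..T} (\<lambda>t. cos (t ^ 3 / 3 + x * t))) \<longlongrightarrow> Re ?J / 2) at_top"
    by (rule Lim_transform_eventually)
  then have "Lim at_top (\<lambda>T. integral {0..T} (\<lambda>t. cos (t ^ 3 / 3 + x * t))) = Re ?J / 2"
    by (intro tendsto_Lim) auto
  then show ?thesis unfolding Airy_Ai_def by (simp only: ReJ) simp
qed

lemma damped_airy_scale:
  assumes "a > 0"
  shows "damped_airy \<kappa> \<alpha> (a * y) = damped_airy (\<kappa> / a ^ 3) (\<alpha> / a\<^sup>2) y / a"
  unfolding damped_airy_def
  by (subst lborel_integral_real_affine[where c="1/a" and t=0])
     (use assms in \<open>auto simp: power_divide\<close>)

text \<open>The height \<eta> is tied to the constant part of the argument, so that the linear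
  coefficient reduces to \<open>a * y\<close> and the prefactor splits off exactly
  \<open>exp (- (a * \<eta>) * y)\<close>. With \<open>a * \<eta> = c\<close> this is the
  exponential tilt of the theorem.\<close>

lemma Airy_Ai_affine:
  assumes "a > 0" "\<eta> > 0"
  shows "Airy_Ai (\<eta>\<^sup>2 + a * y) =
    exp (- (2/3) * \<eta> ^ 3) / (2 * pi * a) * exp (- (a * \<eta>) * y) * damped_airy (1 / (3 * a ^ 3)) (\<eta> / a\<^sup>2) y"
proof -
  have "\<eta> ^ 3 / 3 - (\<eta>\<^sup>2 + a * y) * \<eta> = - (2/3) * \<eta> ^ 3 + - (a * \<eta>) * y"
    by (simp add: power3_eq_cube power2_eq_square algebra_simps)
  then have "exp (\<eta> ^ 3 / 3 - (\<eta>\<^sup>2 + a * y) * \<eta>) = exp (- (2/3) * \<eta> ^ 3) * exp (- (a * \<eta>) * y)"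
    by (simp only: exp_add)
  then show ?thesis
    using Airy_Ai_eq_damped_airy[OF assms(2), of "\<eta>\<^sup>2 + a * y"] damped_airy_scale[OF assms(1), of "1/3" \<eta> y]
    by simp
qed

section \<open>Positivity of the Airy function from 1 on\<close>

lemma cos_ge_1_minus_half_square: "1 - x\<^sup>2 / 2 \<le> cos (x::real)"
proof -
  have "(sin (x/2))\<^sup>2 \<le> (x/2)\<^sup>2"
    using abs_sin_x_le_abs_x[of "x/2"] by (simp only: abs_le_square_iff)
  then show ?thesis
    using cos_double[of "x/2"] sin_cos_squared_add[of "x/2"] by (simp add: power2_eq_square)
qed

text \<open>At height \<open>sqrt x\<close> the linear term of the phase disappears. Bounding
  \<open>cos (t ^ 3 / 3)\<close> below by \<open>1 - t ^ 6 / 18\<close> leaves Gaussian moments,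
  whose combination is proportional to \<open>1 - 5 / (48 * \<eta> ^ 3)\<close>, positive for
  \<open>\<eta> \<ge> 1\<close>.\<close>

lemma Airy_Ai_pos:
  assumes "x \<ge> 1"
  shows "Airy_Ai x > 0"
proof -
  define \<eta> where "\<eta> = sqrt x"
  have \<eta>: "\<eta> \<ge> 1" "\<eta>\<^sup>2 = x" using assms by (auto simp: \<eta>_def)
  \<comment> \<open>Standard deviation of the normal law with density proportional to
    \<open>exp (- \<eta> * t\<^sup>2)\<close>; its moments of order 0 and 6 are needed.\<close>
  let ?s = "sqrt (1 / (2 * \<eta>))"
  have s: "?s > 0" using \<eta> by simp
  have dens: "exp (- \<eta> * t\<^sup>2) = sqrt (2 * pi * ?s\<^sup>2) * normal_density 0 ?s t" for t
    using \<eta> by (simp add: normal_density_def)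
  have "has_bochner_integral lborel (\<lambda>t. sqrt (2 * pi * ?s\<^sup>2) * (normal_density 0 ?s t * (t - 0) ^ (2 * 0)
      - (normal_density 0 ?s t * (t - 0) ^ (2 * 3)) / 18))
      (sqrt (2 * pi * ?s\<^sup>2) * (fact (2 * 0) / ((2 / ?s\<^sup>2) ^ 0 * fact 0) - fact (2 * 3) / ((2 / ?s\<^sup>2) ^ 3 * fact 3) / 18))"
    by (intro has_bochner_integral_mult_right has_bochner_integral_diff has_bochner_integral_divide_zero normal_moment_even s)
  also have "(\<lambda>t. sqrt (2 * pi * ?s\<^sup>2) * (normal_density 0 ?s t * (t - 0) ^ (2 * 0)
      - (normal_density 0 ?s t * (t - 0) ^ (2 * 3)) / 18)) = (\<lambda>t. exp (- \<eta> * t\<^sup>2) * (1 - t ^ 6 / 18))"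
    unfolding dens by (simp add: algebra_simps)
  finally have int: "integrable lborel (\<lambda>t. exp (- \<eta> * t\<^sup>2) * (1 - t ^ 6 / 18))"
    and val: "(\<integral>t. exp (- \<eta> * t\<^sup>2) * (1 - t ^ 6 / 18) \<partial>lborel) =
      sqrt (2 * pi * ?s\<^sup>2) * (fact (2 * 0) / ((2 / ?s\<^sup>2) ^ 0 * fact 0) - fact (2 * 3) / ((2 / ?s\<^sup>2) ^ 3 * fact 3) / 18)"
    by (auto simp: has_bochner_integral_iff)
  have "2 / ?s\<^sup>2 = 4 * \<eta>" using \<eta> by simp
  moreover have "fact (2 * 3) = (720::real)" "fact 3 = (6::real)" by (simp_all add: fact_numeral)
  moreover have "5 < 48 * \<eta> ^ 3" using one_le_power[OF \<eta>(1), of 3] by linarith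
  moreover from this have "5 / (\<eta> ^ 3 * 48) < 1" using \<eta>(1) by (simp add: divide_less_eq mult.commute)
  ultimately have "fact (2 * 0) / ((2 / ?s\<^sup>2) ^ 0 * fact 0) - fact (2 * 3) / ((2 / ?s\<^sup>2) ^ 3 * fact 3) / 18 > 0"
    by (simp add: power_mult_distrib field_simps)
  then have "0 < (\<integral>t. exp (- \<eta> * t\<^sup>2) * (1 - t ^ 6 / 18) \<partial>lborel)"
    unfolding val using s by simp
  also have "\<dots> \<le> damped_airy (1/3) \<eta> 0"
    unfolding damped_airy_def
  proof (intro integral_mono int integrable_damped_cos mult_left_mono)
    show "1 - t ^ 6 / 18 \<le> cos (1/3 * t ^ 3 + 0 * t)" for t :: real
      using cos_ge_1_minus_half_square[of "t ^ 3 / 3"] by (simp add: power_divide flip: power_mult)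
  qed (use \<eta> in auto)
  finally show ?thesis
    using Airy_Ai_eq_damped_airy[of \<eta> x] \<eta> by simp
qed

section \<open>Regularity of the damped integral in its parameters\<close>

lemma abs_exp_diff_le:
  fixes u v m :: real
  assumes "u \<ge> m" "v \<ge> m"
  shows "\<bar>exp (- u) - exp (- v)\<bar> \<le> exp (- m) * \<bar>u - v\<bar>"
proof -
  have *: "exp (- p) - exp (- q) \<le> exp (- m) * (q - p)" if "m \<le> p" "p \<le> q" for p q :: real
  proof -
    have "exp (- p) - exp (- q) = exp (- p) * (1 - exp (- (q - p)))"
      by (simp add: algebra_simps flip: exp_add)
    also have "\<dots> \<le> exp (- m) * (q - p)"
    proof (intro mult_mono)
      show "1 - exp (- (q - p)) \<le> q - p"
        using exp_ge_add_one_self[of "- (q - p)"] by linarith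
    qed (use that in auto)
    finally show ?thesis .
  qed
  show ?thesis
    using *[of u v] *[of v u] assms by (cases u v rule: linorder_cases) auto
qed

lemma abs_cos_diff_le: "\<bar>cos u - cos v\<bar> \<le> \<bar>u - v\<bar>" for u v :: real
proof -
  have "\<bar>cos u - cos v\<bar> = 2 * (\<bar>sin ((u + v) / 2)\<bar> * \<bar>sin ((v - u) / 2)\<bar>)"
    by (simp add: cos_diff_cos abs_mult)
  also have "\<dots> \<le> 2 * (1 * \<bar>(v - u) / 2\<bar>)"
    by (intro mult_left_mono mult_mono abs_sin_x_le_abs_x) auto
  finally show ?thesis by simp
qed

text \<open>Both parameters vary because the mesh displaces damping and argument at once. The bound
  is uniform in the position, and a common lower bound \<open>m\<close> on the dampings makes its
  constants independent of the mesh.\<close>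

lemma damped_airy_lipschitz:
  assumes "m > 0" "\<alpha> \<ge> m" "\<alpha>' \<ge> m"
  shows "\<bar>damped_airy \<kappa> \<alpha> y - damped_airy \<kappa> \<alpha>' y'\<bar> \<le>
    \<bar>\<alpha> - \<alpha>'\<bar> * (\<integral>t. exp (- m * t\<^sup>2) * \<bar>t\<bar> ^ 2 \<partial>lborel) + \<bar>y - y'\<bar> * (\<integral>t. exp (- m * t\<^sup>2) * \<bar>t\<bar> ^ 1 \<partial>lborel)"
proof -
  let ?f = "\<lambda>\<alpha> y t. exp (- \<alpha> * t\<^sup>2) * cos (\<kappa> * t ^ 3 + y * t)"
  let ?b = "\<lambda>t. \<bar>\<alpha> - \<alpha>'\<bar> * (exp (- m * t\<^sup>2) * \<bar>t\<bar> ^ 2) + \<bar>y - y'\<bar> * (exp (- m * t\<^sup>2) * \<bar>t\<bar> ^ 1)"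
  have pw: "\<bar>?f \<alpha> y t - ?f \<alpha>' y' t\<bar> \<le> ?b t" for t
  proof -
    have "?f \<alpha> y t - ?f \<alpha>' y' t = (exp (- (\<alpha> * t\<^sup>2)) - exp (- (\<alpha>' * t\<^sup>2))) * cos (\<kappa> * t ^ 3 + y * t)
        + exp (- (\<alpha>' * t\<^sup>2)) * (cos (\<kappa> * t ^ 3 + y * t) - cos (\<kappa> * t ^ 3 + y' * t))"
      by (simp add: algebra_simps)
    also have "\<bar>\<dots>\<bar> \<le> \<bar>exp (- (\<alpha> * t\<^sup>2)) - exp (- (\<alpha>' * t\<^sup>2))\<bar> * \<bar>cos (\<kappa> * t ^ 3 + y * t)\<bar>
        + exp (- (\<alpha>' * t\<^sup>2)) * \<bar>cos (\<kappa> * t ^ 3 + y * t) - cos (\<kappa> * t ^ 3 + y' * t)\<bar>"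
      by (rule order_trans[OF abs_triangle_ineq]) (simp add: abs_mult)
    also have "\<dots> \<le> (exp (- (m * t\<^sup>2)) * \<bar>\<alpha> * t\<^sup>2 - \<alpha>' * t\<^sup>2\<bar>) * 1
        + exp (- (m * t\<^sup>2)) * \<bar>(\<kappa> * t ^ 3 + y * t) - (\<kappa> * t ^ 3 + y' * t)\<bar>"
      using assms
      by (intro add_mono mult_mono abs_exp_diff_le abs_cos_diff_le) (auto intro!: mult_right_mono)
    also have "\<dots> = ?b t"
      by (simp add: abs_mult flip: left_diff_distrib)
    finally show ?thesis .
  qed
  have f: "integrable lborel (?f \<alpha> y)" "integrable lborel (?f \<alpha>' y')"
    using assms by (intro integrable_damped_cos; simp)+
  have b: "integrable lborel (\<lambda>t. exp (- m * t\<^sup>2) * \<bar>t\<bar> ^ 2)" "integrable lborel (\<lambda>t. exp (- m * t\<^sup>2) * \<bar>t\<bar> ^ 1)"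
    using assms(1) by (rule integrable_gaussian_moment)+
  have "\<bar>damped_airy \<kappa> \<alpha> y - damped_airy \<kappa> \<alpha>' y'\<bar> = \<bar>\<integral>t. ?f \<alpha> y t - ?f \<alpha>' y' t \<partial>lborel\<bar>"
    unfolding damped_airy_def using f by simp
  also have "\<dots> \<le> (\<integral>t. \<bar>?f \<alpha> y t - ?f \<alpha>' y' t\<bar> \<partial>lborel)"
    by (rule integral_abs_bound)
  also have "\<dots> \<le> integral\<^sup>L lborel ?b"
    using f b by (intro integral_mono pw) auto
  also have "\<dots> = \<bar>\<alpha> - \<alpha>'\<bar> * (\<integral>t. exp (- m * t\<^sup>2) * \<bar>t\<bar> ^ 2 \<partial>lborel) + \<bar>y - y'\<bar> * (\<integral>t. exp (- m * t\<^sup>2) * \<bar>t\<bar> ^ 1 \<partial>lborel)"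
    using b by simp
  finally show ?thesis .
qed

lemma damped_airy_bounded:
  assumes "m > 0" "\<alpha> \<ge> m"
  shows "\<bar>damped_airy \<kappa> \<alpha> y\<bar> \<le> (\<integral>t. exp (- m * t\<^sup>2) \<partial>lborel)"
proof -
  have "\<bar>damped_airy \<kappa> \<alpha> y\<bar> \<le> (\<integral>t. \<bar>exp (- \<alpha> * t\<^sup>2) * cos (\<kappa> * t ^ 3 + y * t)\<bar> \<partial>lborel)"
    unfolding damped_airy_def by (rule integral_abs_bound)
  also have "\<dots> \<le> (\<integral>t. exp (- m * t\<^sup>2) \<partial>lborel)"
  proof (rule integral_mono)
    show "\<bar>exp (- \<alpha> * t\<^sup>2) * cos (\<kappa> * t ^ 3 + y * t)\<bar> \<le> exp (- m * t\<^sup>2)" for t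
    proof -
      have "exp (- \<alpha> * t\<^sup>2) * \<bar>cos (\<kappa> * t ^ 3 + y * t)\<bar> \<le> exp (- m * t\<^sup>2) * 1"
        using assms by (intro mult_mono) (auto intro!: mult_right_mono)
      then show ?thesis by (simp add: abs_mult)
    qed
  qed (use assms in \<open>(intro integrable_abs integrable_damped_cos integrable_gaussian; simp)+\<close>)
  finally show ?thesis .
qed

lemma continuous_on_damped_airy [continuous_intros]:
  assumes "\<alpha> > 0" "continuous_on S f"
  shows "continuous_on S (\<lambda>x. damped_airy \<kappa> \<alpha> (f x))"
proof -
  let ?L = "\<integral>t. exp (- \<alpha> * t\<^sup>2) * \<bar>t\<bar> ^ 1 \<partial>lborel"
  have "?L-lipschitz_on UNIV (damped_airy \<kappa> \<alpha>)"
  proof (rule lipschitz_onI)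
    show "dist (damped_airy \<kappa> \<alpha> x) (damped_airy \<kappa> \<alpha> y) \<le> ?L * dist x y" for x y
      using damped_airy_lipschitz[of \<alpha> \<alpha> \<alpha> \<kappa> x y] assms by (simp add: dist_real_def mult.commute)
  qed (auto intro!: integral_nonneg_AE)
  then have "continuous_on UNIV (damped_airy \<kappa> \<alpha>)"
    by (rule lipschitz_on_continuous_on)
  from continuous_on_compose2[OF this assms(2)] show ?thesis by auto
qed

section \<open>Gaussian averages of plane waves\<close>

lemma normal_characteristic_function:
  assumes "\<sigma> > 0"
  shows "integral\<^sup>L lborel (\<lambda>z. of_real (normal_density \<mu> \<sigma> z) * exp (\<i> * of_real w * of_real z)) =
    exp (\<i> * of_real \<mu> * of_real w - of_real (\<sigma>\<^sup>2 * w\<^sup>2 / 2))"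
proof -
  have dens: "normal_density \<mu> \<sigma> (\<mu> + \<sigma> * x) = std_normal_density x / \<sigma>" for x
    using assms by (simp add: normal_density_def real_sqrt_mult power_mult_distrib)
  have "integral\<^sup>L lborel (\<lambda>z. of_real (normal_density \<mu> \<sigma> z) * exp (\<i> * of_real w * of_real z)) =
     \<sigma> *\<^sub>R integral\<^sup>L lborel (\<lambda>x. of_real (std_normal_density x / \<sigma>) * exp (\<i> * of_real w * of_real (\<mu> + \<sigma> * x)))"
    using assms by (subst lborel_integral_real_affine[where c=\<sigma> and t=\<mu>]) (simp_all add: dens)
  also have "\<dots> = \<sigma> *\<^sub>R integral\<^sup>L lborel (\<lambda>x. exp (\<i> * of_real \<mu> * of_real w) / of_real \<sigma> *
      (std_normal_density x *\<^sub>R iexp ((\<sigma> * w) * x)))"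
    by (intro arg_cong2[where f=scaleR] Bochner_Integration.integral_cong refl)
       (simp add: scaleR_conv_of_real algebra_simps exp_add)
  also have "\<dots> = exp (\<i> * of_real \<mu> * of_real w) * (\<integral>x. std_normal_density x *\<^sub>R iexp ((\<sigma> * w) * x) \<partial>lborel)"
    using assms by (simp add: scaleR_conv_of_real)
  also have "(\<integral>x. std_normal_density x *\<^sub>R iexp ((\<sigma> * w) * x) \<partial>lborel) = char std_normal_distribution (\<sigma> * w)"
    unfolding char_def by (subst integral_density) auto
  also have "exp (\<i> * of_real \<mu> * of_real w) * \<dots> = exp (\<i> * of_real \<mu> * of_real w - of_real (\<sigma>\<^sup>2 * w\<^sup>2 / 2))"
    unfolding char_std_normal_distribution exp_of_real[symmetric] exp_add[symmetric]
    by (simp add: power_mult_distrib)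
  finally show ?thesis .
qed

text \<open>Averaging a plane wave over a normal displacement multiplies it by the characteristic
  function. Fubini applies since the modulus of the integrand is a density in \<open>z\<close> times
  a Gaussian in \<open>t\<close>.\<close>

lemma damped_airy_normal_convolution:
  assumes "\<sigma> > 0" "\<kappa> \<ge> 0" "\<alpha> > 0"
  shows "(\<integral>z. normal_density \<mu> \<sigma> z * damped_airy \<kappa> \<alpha> (y + z) \<partial>lborel) =
    Re (\<integral>t. cubic_exp \<kappa> \<alpha> y (of_real t) * exp (\<i> * of_real \<mu> * of_real t - of_real (\<sigma>\<^sup>2 * t\<^sup>2 / 2)) \<partial>lborel)"
proof -
  let ?F = "\<lambda>z t. of_real (normal_density \<mu> \<sigma> z) * cubic_exp \<kappa> \<alpha> (y + z) (of_real t)"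
  have F: "?F z t = of_real (normal_density \<mu> \<sigma> z) * (cubic_exp \<kappa> \<alpha> y (of_real t) * exp (\<i> * of_real t * of_real z))" for z t
    by (simp add: cubic_exp_def algebra_simps flip: exp_add)
  have norm_F: "norm (?F z t) = normal_density \<mu> \<sigma> z * exp (- \<alpha> * t\<^sup>2)" for z t
    using norm_cubic_exp[of \<kappa> \<alpha> "y + z" t 0] by (simp add: norm_mult)
  have int: "integrable (lborel \<Otimes>\<^sub>M lborel) (case_prod ?F)"
  proof (rule lborel_pair.Fubini_integrable)
    show "case_prod ?F \<in> borel_measurable (lborel \<Otimes>\<^sub>M lborel)"
      unfolding F by measurable
    show "integrable lborel (\<lambda>z. \<integral>t. norm (case_prod ?F (z, t)) \<partial>lborel)"
      unfolding split norm_F using assms by simp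
    show "AE z in lborel. integrable lborel (\<lambda>t. case_prod ?F (z, t))"
      using assms by (auto intro!: integrable_mult_right integrable_cubic_exp_of_real)
  qed
  have "normal_density \<mu> \<sigma> z * damped_airy \<kappa> \<alpha> (y + z) = Re (\<integral>t. ?F z t \<partial>lborel)" for z
    using assms by (simp add: damped_airy_eq_Re)
  then have "(\<integral>z. normal_density \<mu> \<sigma> z * damped_airy \<kappa> \<alpha> (y + z) \<partial>lborel) =
      Re (\<integral>z. \<integral>t. ?F z t \<partial>lborel \<partial>lborel)"
    using integral_Re[OF lborel_pair.integrable_fst[OF int], symmetric] by (simp only:)
  also have "(\<integral>z. \<integral>t. ?F z t \<partial>lborel \<partial>lborel) = (\<integral>t. \<integral>z. ?F z t \<partial>lborel \<partial>lborel)"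
    by (rule lborel_pair.Fubini_integral[OF int, symmetric])
  also have "(\<lambda>t. \<integral>z. ?F z t \<partial>lborel) = (\<lambda>t. cubic_exp \<kappa> \<alpha> y (of_real t) *
      exp (\<i> * of_real \<mu> * of_real t - of_real (\<sigma>\<^sup>2 * t\<^sup>2 / 2)))"
  proof
    fix t
    have "(\<integral>z. ?F z t \<partial>lborel) = (\<integral>z. cubic_exp \<kappa> \<alpha> y (of_real t) *
        (of_real (normal_density \<mu> \<sigma> z) * exp (\<i> * of_real t * of_real z)) \<partial>lborel)"
      unfolding F by (simp add: mult.left_commute)
    also have "\<dots> = cubic_exp \<kappa> \<alpha> y (of_real t) *
        (\<integral>z. of_real (normal_density \<mu> \<sigma> z) * exp (\<i> * of_real t * of_real z) \<partial>lborel)"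
      by (rule integral_mult_right_zero)
    finally show "(\<integral>z. ?F z t \<partial>lborel) = cubic_exp \<kappa> \<alpha> y (of_real t) *
        exp (\<i> * of_real \<mu> * of_real t - of_real (\<sigma>\<^sup>2 * t\<^sup>2 / 2))"
      unfolding normal_characteristic_function[OF assms(1)] .
  qed
  finally show ?thesis .
qed

text \<open>
  The transform is again a cubic exponential, on a line shifted by \<open>\<gamma> h\<close>; this fixes
  the corrections \<open>h / 4\<close> and \<open>c h / 2 - \<gamma> h\<^sup>2 / 12\<close> to the continuous-time parameters.
\<close>

lemma damped_airy_gaussian_step:
  fixes c \<gamma> h y :: real
  assumes "\<gamma> > 0" "h > 0" "h < 2 * c / \<gamma>"
  defines "\<kappa> \<equiv> 1 / (6 * \<gamma>)" and "\<alpha> \<equiv> c / (2 * \<gamma>) - h / 4" and "\<beta> \<equiv> c * h / 2 - \<gamma> * h\<^sup>2 / 12"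
  shows "exp (- \<gamma> * h * x) * (\<integral>z. normal_density (- c * h) (sqrt h) z * damped_airy \<kappa> \<alpha> (x + \<beta> + z) \<partial>lborel)
    = damped_airy \<kappa> \<alpha> (x + \<beta>)"
proof -
  have \<alpha>: "\<alpha> > 0" and \<kappa>: "\<kappa> > 0" using assms by (auto simp: field_simps)
  \<comment> \<open>Multiply out the shift by \<open>\<gamma> * h\<close>. The choice
    \<open>\<kappa> = 1 / (6 * \<gamma>)\<close> makes the new quadratic term equal to the variance
    term \<open>h * t\<^sup>2 / 2\<close>; the linear terms match the drift exactly for the given
    \<alpha>, and the constant terms match the discount exactly for the given \<beta>.\<close>
  have eq: "of_real (exp (- \<gamma> * h * x)) * (cubic_exp \<kappa> \<alpha> (x + \<beta>) (of_real t) *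
      exp (\<i> * of_real (- c * h) * of_real t - of_real ((sqrt h)\<^sup>2 * t\<^sup>2 / 2))) =
    cubic_exp \<kappa> \<alpha> (x + \<beta>) (of_real t + \<i> * of_real (\<gamma> * h))" for t
    unfolding cubic_exp_def exp_of_real[symmetric] exp_add[symmetric]
    using assms(1,2)
    by (intro arg_cong[where f=exp])
      (simp add: complex_eq_iff power3_eq_cube power2_eq_square \<kappa>_def \<alpha>_def \<beta>_def field_simps)
  have "exp (- \<gamma> * h * x) * (\<integral>z. normal_density (- c * h) (sqrt h) z * damped_airy \<kappa> \<alpha> (x + \<beta> + z) \<partial>lborel) =
     Re (of_real (exp (- \<gamma> * h * x)) * (\<integral>t. cubic_exp \<kappa> \<alpha> (x + \<beta>) (of_real t) *
      exp (\<i> * of_real (- c * h) * of_real t - of_real ((sqrt h)\<^sup>2 * t\<^sup>2 / 2)) \<partial>lborel))"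
    using assms(2) \<alpha> \<kappa> by (subst damped_airy_normal_convolution) (simp_all del: real_sqrt_pow2)
  also have "\<dots> = Re (\<integral>t. cubic_exp \<kappa> \<alpha> (x + \<beta>) (of_real t + \<i> * of_real (\<gamma> * h)) \<partial>lborel)"
    unfolding integral_mult_right_zero[symmetric] eq ..
  also have "\<dots> = damped_airy \<kappa> \<alpha> (x + \<beta>)"
    using assms(1,2) \<alpha> \<kappa> by (simp add: integral_cubic_exp_shift damped_airy_eq_Re del: of_real_mult)
  finally show ?thesis .
qed

section \<open>Optional stopping for killed random walks\<close>

text \<open>Accumulated discount on the event of survival: the indicator factors annihilate every
  weight after the first visit outside \<open>A\<close>, so no stopping time has to be
  constructed.\<close>

definition killed_weight ::
  "(real \<Rightarrow> real) \<Rightarrow> real set \<Rightarrow> (nat \<Rightarrow> 'a \<Rightarrow> real) \<Rightarrow> nat \<Rightarrow> 'a \<Rightarrow> real" where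
  "killed_weight w A X k \<omega> = (\<Prod>j<k. w (X j \<omega>) * indicator A (X j \<omega>))"

text \<open>The discounted value at the exit from \<open>A\<close>, or at time \<open>n\<close> if
  that comes first, written as a sum over the possible exit times. In this form it is a finite
  algebraic expression in the walk.\<close>

definition stopped_value ::
  "(real \<Rightarrow> real) \<Rightarrow> (real \<Rightarrow> real) \<Rightarrow> real set \<Rightarrow> (nat \<Rightarrow> 'a \<Rightarrow> real) \<Rightarrow> nat \<Rightarrow> 'a \<Rightarrow> real" where
  "stopped_value f w A X n \<omega> =
     (\<Sum>k<n. killed_weight w A X k \<omega> * indicator (- A) (X k \<omega>) * f (X k \<omega>)) +
     killed_weight w A X n \<omega> * f (X n \<omega>)"

lemma killed_weight_0 [simp]: "killed_weight w A X 0 \<omega> = 1"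
  by (simp add: killed_weight_def)

lemma killed_weight_Suc:
  "killed_weight w A X (Suc k) \<omega> = killed_weight w A X k \<omega> * (w (X k \<omega>) * indicator A (X k \<omega>))"
  by (simp add: killed_weight_def)

lemma stopped_value_0 [simp]: "stopped_value f w A X 0 \<omega> = f (X 0 \<omega>)"
  by (simp add: stopped_value_def)

text \<open>The martingale increment: a factor known at time \<open>n\<close> times the one-step
  defect of \<open>f\<close>. Only the defect involves the next position.\<close>

lemma stopped_value_Suc:
  "stopped_value f w A X (Suc n) \<omega> = stopped_value f w A X n \<omega> +
     killed_weight w A X n \<omega> * indicator A (X n \<omega>) * (w (X n \<omega>) * f (X (Suc n) \<omega>) - f (X n \<omega>))"
  by (auto simp: stopped_value_def killed_weight_Suc indicator_def algebra_simps)

lemma killed_weight_bounds: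
  assumes "\<And>x. x \<in> A \<Longrightarrow> 0 \<le> w x \<and> w x \<le> 1"
  shows "0 \<le> killed_weight w A X k \<omega>" "killed_weight w A X k \<omega> \<le> 1"
  unfolding killed_weight_def using assms
  by (auto intro!: prod_nonneg prod_le_1 simp: indicator_def)

lemma killed_weight_survive:
  assumes "\<And>j. j < k \<Longrightarrow> X j \<omega> \<in> A"
  shows "killed_weight w A X k \<omega> = (\<Prod>j<k. w (X j \<omega>))"
  unfolding killed_weight_def using assms by (intro prod.cong) auto

lemma killed_weight_killed:
  assumes "j < k" "X j \<omega> \<notin> A"
  shows "killed_weight w A X k \<omega> = 0"
  unfolding killed_weight_def using assms by (intro prod_zero) (auto intro!: bexI[of _ j])

lemma stopped_value_exit:
  assumes "\<And>j. j < N \<Longrightarrow> X j \<omega> \<in> A" "X N \<omega> \<notin> A" "N \<le> n"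
  shows "stopped_value f w A X n \<omega> = (\<Prod>j<N. w (X j \<omega>)) * f (X N \<omega>)"
  using \<open>N \<le> n\<close>
proof (induction n rule: dec_induct)
  case base
  show ?case
    using assms(1) by (auto simp: stopped_value_def killed_weight_survive)
next
  case (step k)
  then show ?case
    using assms(2) killed_weight_killed[of N k X \<omega> A w]
    by (cases "k = N") (auto simp: stopped_value_Suc)
qed

lemma stopped_value_survive:
  assumes "\<And>j. j < n \<Longrightarrow> X j \<omega> \<in> A"
  shows "stopped_value f w A X n \<omega> = (\<Prod>j<n. w (X j \<omega>)) * f (X n \<omega>)"
  using assms by (auto simp: stopped_value_def killed_weight_survive)

text \<open>Along each path the sum collapses to one discounted value of \<open>f\<close>, with
  discount at most 1.\<close>

lemma stopped_value_bounded:
  assumes "\<And>x. x \<in> A \<Longrightarrow> 0 \<le> w x \<and> w x \<le> 1" "\<And>x. \<bar>f x\<bar> \<le> C"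
  shows "\<bar>stopped_value f w A X n \<omega>\<bar> \<le> C"
proof -
  have C: "C \<ge> 0" using assms(2)[of 0] by linarith
  have prod: "\<bar>(\<Prod>j<N. w (X j \<omega>)) * f (X N \<omega>)\<bar> \<le> C" if "\<And>j. j < N \<Longrightarrow> X j \<omega> \<in> A" for N
  proof -
    have "0 \<le> (\<Prod>j<N. w (X j \<omega>))" "(\<Prod>j<N. w (X j \<omega>)) \<le> 1"
      using that assms(1) by (auto intro!: prod_nonneg prod_le_1)
    then have "\<bar>\<Prod>j<N. w (X j \<omega>)\<bar> * \<bar>f (X N \<omega>)\<bar> \<le> 1 * C"
      by (intro mult_mono assms(2)) auto
    then show ?thesis by (simp add: abs_mult)
  qed
  show ?thesis
  proof (cases "\<forall>j<n. X j \<omega> \<in> A")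
    case True
    then show ?thesis using prod[of n] by (simp add: stopped_value_survive)
  next
    case False
    define N where "N = (LEAST j. X j \<omega> \<notin> A)"
    have "X N \<omega> \<notin> A" unfolding N_def using False by (metis LeastI)
    moreover have "N \<le> n" unfolding N_def using False by (metis Least_le le_trans less_imp_le)
    moreover have before: "X j \<omega> \<in> A" if "j < N" for j using that not_less_Least unfolding N_def by blast
    ultimately have "stopped_value f w A X n \<omega> = (\<Prod>j<N. w (X j \<omega>)) * f (X N \<omega>)"
      by (intro stopped_value_exit)
    then show ?thesis using prod[OF before] by simp
  qed
qed

lemma borel_measurable_killed_weight [measurable]:
  assumes [measurable]: "w \<in> borel_measurable borel" "A \<in> sets borel"
    and "\<And>j. j < k \<Longrightarrow> X j \<in> borel_measurable N"
  shows "killed_weight w A X k \<in> borel_measurable N"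
  unfolding killed_weight_def[abs_def]
proof (rule borel_measurable_prod)
  fix j assume "j \<in> {..<k}"
  then have [measurable]: "X j \<in> borel_measurable N" using assms by simp
  show "(\<lambda>\<omega>. w (X j \<omega>) * indicator A (X j \<omega>)) \<in> borel_measurable N" by measurable
qed

lemma borel_measurable_stopped_value:
  assumes [measurable]: "f \<in> borel_measurable borel" "w \<in> borel_measurable borel" "A \<in> sets borel"
    and X: "\<And>j. j \<le> n \<Longrightarrow> X j \<in> borel_measurable N"
  shows "stopped_value f w A X n \<in> borel_measurable N"
  unfolding stopped_value_def[abs_def]
proof (rule borel_measurable_add[OF borel_measurable_sum])
  fix k assume k: "k \<in> {..<n}"
  then have [measurable]: "X k \<in> borel_measurable N" using X by simp
  have [measurable]: "killed_weight w A X k \<in> borel_measurable N"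
    using k X by (intro borel_measurable_killed_weight) auto
  show "(\<lambda>\<omega>. killed_weight w A X k \<omega> * indicator (- A) (X k \<omega>) * f (X k \<omega>)) \<in> borel_measurable N"
    by measurable
next
  have [measurable]: "X n \<in> borel_measurable N" using X by simp
  have [measurable]: "killed_weight w A X n \<in> borel_measurable N"
    using X by (intro borel_measurable_killed_weight) auto
  show "(\<lambda>\<omega>. killed_weight w A X n \<omega> * f (X n \<omega>)) \<in> borel_measurable N" by measurable
qed

text \<open>Product measures take the place of conditional expectations; a joint law is determined
  by its values on rectangles, where independence gives the product.\<close>

lemma (in prob_space) distr_pair_eq_indep:
  assumes F: "subalgebra M F" and Y: "Y \<in> F \<rightarrow>\<^sub>M S" and \<xi>: "random_variable T \<xi>"
    and indep: "\<And>A B. A \<in> sets F \<Longrightarrow> B \<in> sets T \<Longrightarrow>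
        prob (A \<inter> (\<xi> -` B \<inter> space M)) = prob A * prob (\<xi> -` B \<inter> space M)"
  shows "distr M (S \<Otimes>\<^sub>M T) (\<lambda>\<omega>. (Y \<omega>, \<xi> \<omega>)) = distr M S Y \<Otimes>\<^sub>M distr M T \<xi>"
proof (rule pair_measure_eqI[symmetric])
  have Y': "random_variable S Y" using measurable_from_subalg[OF F Y] .
  interpret Y: prob_space "distr M S Y" by (rule prob_space_distr) fact
  interpret Z: prob_space "distr M T \<xi>" by (rule prob_space_distr) fact
  show "sigma_finite_measure (distr M S Y)" "sigma_finite_measure (distr M T \<xi>)" by unfold_locales
  fix A B assume A: "A \<in> sets (distr M S Y)" and B: "B \<in> sets (distr M T \<xi>)"
  have "(\<lambda>\<omega>. (Y \<omega>, \<xi> \<omega>)) -` (A \<times> B) \<inter> space M = (Y -` A \<inter> space M) \<inter> (\<xi> -` B \<inter> space M)"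
    by auto
  moreover have "Y -` A \<inter> space M \<in> sets F"
    using measurable_sets[OF Y, of A] A F by (simp add: subalgebra_def)
  ultimately show "emeasure (distr M S Y) A * emeasure (distr M T \<xi>) B =
      emeasure (distr M (S \<Otimes>\<^sub>M T) (\<lambda>\<omega>. (Y \<omega>, \<xi> \<omega>))) (A \<times> B)"
    using A B Y' \<xi> indep
    by (simp add: emeasure_distr emeasure_eq_measure measure_nonneg flip: ennreal_mult)
qed simp

text \<open>Freezing argument: with \<open>(X, G)\<close> held fixed, integrate over \<xi> first;
  the hypothesis \<open>step\<close> bounds the inner integral. The defect \<delta> is allowed
  because one application is to a truncated exponential, which is only approximately
  subharmonic.\<close>

lemma (in prob_space) expectation_indep_step_ge:
  fixes X G \<xi> :: "'a \<Rightarrow> real"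
  assumes F: "subalgebra M F" and X: "X \<in> borel_measurable F" and G': "G \<in> borel_measurable F"
    and \<xi> [measurable]: "random_variable borel \<xi>"
    and indep: "\<And>A B. A \<in> sets F \<Longrightarrow> B \<in> sets borel \<Longrightarrow>
        prob (A \<inter> (\<xi> -` B \<inter> space M)) = prob A * prob (\<xi> -` B \<inter> space M)"
    and f [measurable]: "f \<in> borel_measurable borel" and fC: "\<And>x. \<bar>f x\<bar> \<le> C"
    and [measurable]: "w \<in> borel_measurable borel" "A \<in> sets borel"
    and w: "\<And>x. x \<in> A \<Longrightarrow> 0 \<le> w x \<and> w x \<le> 1"
    and G: "\<And>\<omega>. 0 \<le> G \<omega> \<and> G \<omega> \<le> K"
    and step: "\<And>x. x \<in> A \<Longrightarrow> f x - \<delta> \<le> w x * (\<integral>z. f (x + z) \<partial>distr M borel \<xi>)"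
    and "\<delta> \<ge> 0"
  shows "- (K * \<delta>) \<le> expectation (\<lambda>\<omega>. G \<omega> * indicator A (X \<omega>) * (w (X \<omega>) * f (X \<omega> + \<xi> \<omega>) - f (X \<omega>)))"
    and "integrable M (\<lambda>\<omega>. G \<omega> * indicator A (X \<omega>) * (w (X \<omega>) * f (X \<omega> + \<xi> \<omega>) - f (X \<omega>)))"
proof -
  let ?P = "\<lambda>\<omega>. (X \<omega>, G \<omega>)"
  let ?S = "borel \<Otimes>\<^sub>M borel :: (real \<times> real) measure"
  let ?h = "\<lambda>p. snd (fst p) * indicator A (fst (fst p)) *
    (w (fst (fst p)) * f (fst (fst p) + snd p) - f (fst (fst p))) :: real"
  have PF: "?P \<in> F \<rightarrow>\<^sub>M ?S" using X G' by simp
  have [measurable]: "random_variable borel X" "random_variable borel G"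
    using measurable_from_subalg[OF F] X G' by auto
  have eq: "distr M ?S ?P \<Otimes>\<^sub>M distr M borel \<xi> = distr M (?S \<Otimes>\<^sub>M borel) (\<lambda>\<omega>. (?P \<omega>, \<xi> \<omega>))"
    by (rule distr_pair_eq_indep[OF F PF \<xi> indep, symmetric])
  have K: "K \<ge> 0" using G[of undefined] by linarith
  have C: "C \<ge> 0" using fC[of 0] by linarith
  interpret P: prob_space "distr M ?S ?P" by (rule prob_space_distr) simp
  interpret Z: prob_space "distr M borel \<xi>" by (rule prob_space_distr) simp
  interpret PZ: pair_sigma_finite "distr M ?S ?P" "distr M borel \<xi>" ..
  have hm [measurable]: "?h \<in> borel_measurable (?S \<Otimes>\<^sub>M borel)" by measurable
  have int: "integrable M (\<lambda>\<omega>. ?h (?P \<omega>, \<xi> \<omega>))"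
  proof (rule integrable_const_bound[where B="K * (C + C)"])
    show "AE \<omega> in M. norm (?h (?P \<omega>, \<xi> \<omega>)) \<le> K * (C + C)"
    proof (rule AE_I2)
      fix \<omega>
      show "norm (?h (?P \<omega>, \<xi> \<omega>)) \<le> K * (C + C)"
      proof (cases "X \<omega> \<in> A")
        case True
        have "\<bar>w (X \<omega>) * f (X \<omega> + \<xi> \<omega>) - f (X \<omega>)\<bar> \<le> \<bar>w (X \<omega>)\<bar> * \<bar>f (X \<omega> + \<xi> \<omega>)\<bar> + \<bar>f (X \<omega>)\<bar>"
          using abs_triangle_ineq4[of "w (X \<omega>) * f (X \<omega> + \<xi> \<omega>)" "f (X \<omega>)"] by (simp add: abs_mult)
        also have "\<dots> \<le> 1 * C + C"
          using w[OF True] fC C by (intro add_mono mult_mono) auto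
        finally have "\<bar>G \<omega>\<bar> * \<bar>w (X \<omega>) * f (X \<omega> + \<xi> \<omega>) - f (X \<omega>)\<bar> \<le> K * (C + C)"
          using G[of \<omega>] K C by (intro mult_mono) auto
        then show ?thesis using True by (simp add: abs_mult)
      qed (use K C in simp)
    qed
  qed measurable
  then show "integrable M (\<lambda>\<omega>. G \<omega> * indicator A (X \<omega>) * (w (X \<omega>) * f (X \<omega> + \<xi> \<omega>) - f (X \<omega>)))"
    by simp
  have int2: "integrable (distr M ?S ?P \<Otimes>\<^sub>M distr M borel \<xi>) ?h"
    unfolding eq using int by (subst integrable_distr_eq) auto
  have inner: "- (K * \<delta>) \<le> (\<integral>z. ?h (?P \<omega>, z) \<partial>distr M borel \<xi>)" for \<omega>
  proof (cases "X \<omega> \<in> A")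
    case True
    have fi: "integrable (distr M borel \<xi>) (\<lambda>z. f (X \<omega> + z))"
      by (rule Z.integrable_const_bound[where B=C]) (use fC in auto)
    have "(\<integral>z. ?h (?P \<omega>, z) \<partial>distr M borel \<xi>) =
        (\<integral>z. G \<omega> * (w (X \<omega>) * f (X \<omega> + z) - f (X \<omega>)) \<partial>distr M borel \<xi>)"
      using True by simp
    also have "\<dots> = G \<omega> * (\<integral>z. w (X \<omega>) * f (X \<omega> + z) - f (X \<omega>) \<partial>distr M borel \<xi>)"
      by (rule integral_mult_right_zero)
    also have "(\<integral>z. w (X \<omega>) * f (X \<omega> + z) - f (X \<omega>) \<partial>distr M borel \<xi>) =
        (\<integral>z. w (X \<omega>) * f (X \<omega> + z) \<partial>distr M borel \<xi>) - (\<integral>z. f (X \<omega>) \<partial>distr M borel \<xi>)"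
      using fi by (intro Bochner_Integration.integral_diff) auto
    also have "\<dots> = w (X \<omega>) * (\<integral>z. f (X \<omega> + z) \<partial>distr M borel \<xi>) - f (X \<omega>)"
      using Z.prob_space by simp
    finally have eq: "(\<integral>z. ?h (?P \<omega>, z) \<partial>distr M borel \<xi>) =
        G \<omega> * (w (X \<omega>) * (\<integral>z. f (X \<omega> + z) \<partial>distr M borel \<xi>) - f (X \<omega>))" .
    have "G \<omega> * (w (X \<omega>) * (\<integral>z. f (X \<omega> + z) \<partial>distr M borel \<xi>) - f (X \<omega>)) \<ge> G \<omega> * (- \<delta>)"
      using step[OF True] G[of \<omega>] by (intro mult_left_mono) auto
    moreover have "K * \<delta> \<ge> G \<omega> * \<delta>"
      using G[of \<omega>] \<open>\<delta> \<ge> 0\<close> by (intro mult_right_mono) auto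
    ultimately show ?thesis unfolding eq by linarith
  qed (use K \<open>\<delta> \<ge> 0\<close> in simp)
  have "- (K * \<delta>) = expectation (\<lambda>\<omega>. - (K * \<delta>))" by (simp add: prob_space)
  also have "\<dots> \<le> expectation (\<lambda>\<omega>. \<integral>z. ?h (?P \<omega>, z) \<partial>distr M borel \<xi>)"
  proof (rule integral_mono[OF _ _ inner])
    show "integrable M (\<lambda>\<omega>. \<integral>z. ?h (?P \<omega>, z) \<partial>distr M borel \<xi>)"
      using PZ.integrable_fst'[OF int2] by (subst (asm) integrable_distr_eq) auto
  qed simp
  also have "\<dots> = (\<integral>p. \<integral>z. ?h (p, z) \<partial>distr M borel \<xi> \<partial>distr M ?S ?P)"
    by (subst integral_distr) auto
  also have "\<dots> = integral\<^sup>L (distr M ?S ?P \<Otimes>\<^sub>M distr M borel \<xi>) ?h"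
    by (rule PZ.integral_fst'[OF int2])
  also have "\<dots> = expectation (\<lambda>\<omega>. ?h (?P \<omega>, \<xi> \<omega>))"
    unfolding eq by (subst integral_distr) auto
  finally show "- (K * \<delta>) \<le> expectation (\<lambda>\<omega>. G \<omega> * indicator A (X \<omega>) * (w (X \<omega>) * f (X \<omega> + \<xi> \<omega>) - f (X \<omega>)))"
    by simp
qed

text \<open>The one-step bound summed over \<open>n\<close> steps, each losing at most
  \<open>K * \<delta>\<close>. The weight \<open>g\<close> is known at time 0 and later localises
  the result at the starting point of the walk.\<close>

lemma (in prob_space) expectation_stopped_value_ge:
  fixes X \<xi> :: "nat \<Rightarrow> 'a \<Rightarrow> real" and F :: "nat \<Rightarrow> 'a measure"
  assumes indep: "\<And>k A B. k < n \<Longrightarrow> A \<in> sets (F k) \<Longrightarrow> B \<in> sets borel \<Longrightarrow>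
        prob (A \<inter> (\<xi> k -` B \<inter> space M)) = prob A * prob (\<xi> k -` B \<inter> space M)"
    and F: "\<And>k. k \<le> n \<Longrightarrow> subalgebra M (F k)" "\<And>k. k < n \<Longrightarrow> subalgebra (F (Suc k)) (F k)"
    and \<xi>: "\<And>k. k < n \<Longrightarrow> \<xi> k \<in> borel_measurable (F (Suc k))"
    and X: "X 0 \<in> borel_measurable (F 0)" "\<And>k \<omega>. k < n \<Longrightarrow> X (Suc k) \<omega> = X k \<omega> + \<xi> k \<omega>"
    and g: "g \<in> borel_measurable (F 0)" "\<And>\<omega>. 0 \<le> g \<omega> \<and> g \<omega> \<le> K"
    and f [measurable]: "f \<in> borel_measurable borel" and fC: "\<And>x. \<bar>f x\<bar> \<le> C"
    and wA [measurable]: "w \<in> borel_measurable borel" "A \<in> sets borel"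
    and w: "\<And>x. x \<in> A \<Longrightarrow> 0 \<le> w x \<and> w x \<le> 1"
    and step: "\<And>k x. k < n \<Longrightarrow> x \<in> A \<Longrightarrow> f x - \<delta> \<le> w x * (\<integral>z. f (x + z) \<partial>distr M borel (\<xi> k))"
    and "\<delta> \<ge> 0"
  shows "expectation (\<lambda>\<omega>. g \<omega> * f (X 0 \<omega>)) - n * (K * \<delta>) \<le> expectation (\<lambda>\<omega>. g \<omega> * stopped_value f w A X n \<omega>)"
proof -
  have XF: "X k \<in> borel_measurable (F k) \<and> g \<in> borel_measurable (F k)" if "k \<le> n" for k
    using that
  proof (induction k)
    case (Suc k)
    then have "subalgebra (F (Suc k)) (F k)" by (intro F(2)) simp
    from measurable_from_subalg[OF this] Suc \<xi>[of k]
    have [measurable]: "X k \<in> borel_measurable (F (Suc k))" "g \<in> borel_measurable (F (Suc k))"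
      "\<xi> k \<in> borel_measurable (F (Suc k))"
      by (auto simp: Suc_le_eq)
    have "X (Suc k) = (\<lambda>\<omega>. X k \<omega> + \<xi> k \<omega>)" using X(2) Suc.prems by auto
    then show ?case by simp
  qed (use X(1) g(1) in auto)
  have XFj: "X j \<in> borel_measurable (F k)" if "j \<le> k" "k \<le> n" for j k
    using that
  proof (induction k rule: dec_induct)
    case (step k)
    then show ?case using measurable_from_subalg[OF F(2), of k] by auto
  qed (use XF in auto)
  have XM: "X j \<in> borel_measurable M" if "j \<le> n" for j
    using measurable_from_subalg[OF F(1)] XF that by auto
  have gM [measurable]: "g \<in> borel_measurable M" using measurable_from_subalg[OF F(1)] g by auto
  have K: "K \<ge> 0" using g(2)[of undefined] by linarith
  have main: "expectation (\<lambda>\<omega>. g \<omega> * f (X 0 \<omega>)) - k * (K * \<delta>)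
      \<le> expectation (\<lambda>\<omega>. g \<omega> * stopped_value f w A X k \<omega>)" if "k \<le> n" for k
    using that
  proof (induction k)
    case (Suc k)
    let ?G = "\<lambda>\<omega>. g \<omega> * killed_weight w A X k \<omega>"
    let ?inc = "\<lambda>\<omega>. ?G \<omega> * indicator A (X k \<omega>) * (w (X k \<omega>) * f (X k \<omega> + \<xi> k \<omega>) - f (X k \<omega>))"
    have k: "k < n" using Suc by simp
    have [measurable]: "X k \<in> borel_measurable (F k)" "g \<in> borel_measurable (F k)"
      using XF k by auto
    have [measurable]: "killed_weight w A X k \<in> borel_measurable (F k)"
      using XFj k by (intro borel_measurable_killed_weight wA) auto
    have G': "?G \<in> borel_measurable (F k)" by measurable
    have \<xi>M: "\<xi> k \<in> borel_measurable M" using measurable_from_subalg[OF F(1) \<xi>] k by simp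
    have G: "0 \<le> ?G \<omega> \<and> ?G \<omega> \<le> K" for \<omega>
      using mult_mono[of "g \<omega>" K "killed_weight w A X k \<omega>" 1] g(2)[of \<omega>] K
        killed_weight_bounds[where w=w and A=A and X=X and k=k and \<omega>=\<omega>, OF w] by auto
    have Fk: "subalgebra M (F k)" and Xk: "X k \<in> borel_measurable (F k)" using F(1) k by auto
    note step_ge = expectation_indep_step_ge[OF Fk Xk G' \<xi>M indep[OF k] f fC wA w G step[OF k] \<open>\<delta> \<ge> 0\<close>]
    have inc: "- (K * \<delta>) \<le> expectation ?inc" "integrable M ?inc"
      by (rule step_ge; assumption)+
    have sv [measurable]: "stopped_value f w A X k \<in> borel_measurable M"
      using XM k by (intro borel_measurable_stopped_value f wA) auto
    have "integrable M (\<lambda>\<omega>. g \<omega> * stopped_value f w A X k \<omega>)"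
    proof (rule integrable_const_bound[where B="K * C"])
      show "AE \<omega> in M. norm (g \<omega> * stopped_value f w A X k \<omega>) \<le> K * C"
      proof (rule AE_I2)
        fix \<omega>
        have "\<bar>stopped_value f w A X k \<omega>\<bar> \<le> C"
          by (rule stopped_value_bounded[OF w fC])
        then have "\<bar>g \<omega>\<bar> * \<bar>stopped_value f w A X k \<omega>\<bar> \<le> K * C"
          using g(2)[of \<omega>] by (intro mult_mono) auto
        then show "norm (g \<omega> * stopped_value f w A X k \<omega>) \<le> K * C"
          by (simp add: abs_mult)
      qed
    qed measurable
    moreover have "g \<omega> * stopped_value f w A X (Suc k) \<omega> = g \<omega> * stopped_value f w A X k \<omega> + ?inc \<omega>" for \<omega>
      using X(2)[OF k, of \<omega>] by (simp add: stopped_value_Suc algebra_simps)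
    ultimately have eq: "expectation (\<lambda>\<omega>. g \<omega> * stopped_value f w A X (Suc k) \<omega>) =
        expectation (\<lambda>\<omega>. g \<omega> * stopped_value f w A X k \<omega>) + expectation ?inc"
      using inc(2) by (simp only: Bochner_Integration.integral_add)
    have "expectation (\<lambda>\<omega>. g \<omega> * f (X 0 \<omega>)) - k * (K * \<delta>)
        \<le> expectation (\<lambda>\<omega>. g \<omega> * stopped_value f w A X k \<omega>)"
      using Suc k by simp
    moreover have "real (Suc k) * (K * \<delta>) = k * (K * \<delta>) + K * \<delta>"
      by (simp add: algebra_simps)
    ultimately show ?case
      unfolding eq using inc(1) by linarith
  qed simp
  show ?thesis by (rule main) simp
qed

text \<open>The information in the increments indexed by \<open>J\<close>, as the pullback of a
  product \<sigma>-algebra. General index sets are convenient since the walk into the past consumes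
  increments in decreasing order, the walk into the future in increasing order.\<close>

definition generated_by :: "'a measure \<Rightarrow> (nat \<Rightarrow> 'a \<Rightarrow> real) \<Rightarrow> nat set \<Rightarrow> 'a measure" where
  "generated_by M D J = vimage_algebra (space M) (\<lambda>\<omega>. \<lambda>i\<in>J. D i \<omega>) (PiM J (\<lambda>_. borel))"

lemma space_generated_by [simp]: "space (generated_by M D J) = space M"
  by (simp add: generated_by_def)

lemma measurable_generated_by:
  assumes "i \<in> J"
  shows "D i \<in> borel_measurable (generated_by M D J)"
proof -
  have "(\<lambda>\<omega>. (\<lambda>i\<in>J. D i \<omega>) i) \<in> borel_measurable (generated_by M D J)"
    unfolding generated_by_def
    by (rule measurable_compose[OF measurable_vimage_algebra1 measurable_component_singleton])
       (use assms in \<open>auto simp: space_PiM\<close>)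
  then show ?thesis using assms by simp
qed

lemma subalgebra_generated_by:
  assumes "space N = space M" "\<And>i. i \<in> J \<Longrightarrow> D i \<in> borel_measurable N"
  shows "subalgebra N (generated_by M D J)"
proof -
  have "(\<lambda>\<omega>. \<lambda>i\<in>J. D i \<omega>) \<in> N \<rightarrow>\<^sub>M PiM J (\<lambda>_. borel)"
    using assms(2) by (rule measurable_restrict)
  then have "{(\<lambda>\<omega>. \<lambda>i\<in>J. D i \<omega>) -` A \<inter> space N |A. A \<in> sets (PiM J (\<lambda>_. borel))} \<subseteq> sets N"
    by (auto intro: measurable_sets)
  then have "sets (generated_by M D J) \<subseteq> sets N"
    unfolding generated_by_def sets_vimage_algebra assms(1)[symmetric]
    by (rule sets.sigma_sets_subset)
  then show ?thesis using assms(1) by (simp add: subalgebra_def)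
qed

text \<open>Independence of the whole family, grouped into the disjoint blocks \<open>J\<close> and
  \<open>{i}\<close>.\<close>

lemma (in prob_space) indep_generated_by:
  assumes D: "indep_vars (\<lambda>_. borel) D I" and J: "J \<subseteq> I" "i \<in> I" "i \<notin> J"
    and A: "A \<in> sets (generated_by M D J)" and B: "B \<in> sets borel"
  shows "prob (A \<inter> (D i -` B \<inter> space M)) = prob A * prob (D i -` B \<inter> space M)"
proof -
  let ?R = "\<lambda>\<omega>. \<lambda>i\<in>J. D i \<omega>" and ?Z = "\<lambda>\<omega>. \<lambda>j\<in>{i}. D j \<omega>"
  have "indep_var (PiM J (\<lambda>_. borel)) ?R (PiM {i} (\<lambda>_. borel)) ?Z"
    using J by (intro indep_var_restrict[OF D]) auto
  then have ind: "indep_set (sigma_sets (space M) {?R -` A \<inter> space M | A. A \<in> sets (PiM J (\<lambda>_. borel))})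
      (sigma_sets (space M) {?Z -` A \<inter> space M | A. A \<in> sets (PiM {i} (\<lambda>_. borel))})"
    by (simp add: indep_var_eq)
  have "{z \<in> space (PiM {i} (\<lambda>_. borel)). z i \<in> B} \<in> sets (PiM {i} (\<lambda>_. borel :: real measure))"
    using B by measurable
  moreover have "D i -` B \<inter> space M = ?Z -` {z \<in> space (PiM {i} (\<lambda>_. borel)). z i \<in> B} \<inter> space M"
    by (auto simp: space_PiM)
  ultimately have "D i -` B \<inter> space M \<in> sigma_sets (space M) {?Z -` A \<inter> space M | A. A \<in> sets (PiM {i} (\<lambda>_. borel))}"
    by (intro sigma_sets.Basic) blast
  moreover have "A \<in> sigma_sets (space M) {?R -` A \<inter> space M | A. A \<in> sets (PiM J (\<lambda>_. borel))}"
    using A by (simp add: generated_by_def sets_vimage_algebra)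
  ultimately show ?thesis
    using ind by (auto simp: indep_sets2_eq)
qed

section \<open>The Brownian grid walk and the law of the initial workload\<close>

text \<open>The map \<iota> lists the increments in the order in which the walk uses them;
  injectivity and avoidance of \<open>J\<close> make each new step independent of everything used
  before. For the walk running backwards from time 0, \<open>J\<close> is empty; for the walk after
  time 0, it is the whole past of the grid.\<close>

lemma (in prob_space) gaussian_walk_stopped_value_ge:
  fixes D X :: "nat \<Rightarrow> 'a \<Rightarrow> real" and \<iota> :: "nat \<Rightarrow> nat"
  assumes D: "indep_vars (\<lambda>_. borel) D I"
    and normal: "\<And>i. i \<in> I \<Longrightarrow> distributed M lborel (D i) (normal_density 0 (sqrt h))" and "h > 0"
    and J: "J \<subseteq> I" "\<And>k. k < n \<Longrightarrow> \<iota> k \<in> I - J" "inj_on \<iota> {..<n}"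
    and X: "X 0 \<in> borel_measurable (generated_by M D J)"
      "\<And>k \<omega>. k < n \<Longrightarrow> X (Suc k) \<omega> = X k \<omega> + (D (\<iota> k) \<omega> - c * h)"
    and g: "g \<in> borel_measurable (generated_by M D J)" "\<And>\<omega>. 0 \<le> g \<omega> \<and> g \<omega> \<le> K"
    and f: "f \<in> borel_measurable borel" "\<And>x. \<bar>f x\<bar> \<le> C"
    and wA: "w \<in> borel_measurable borel" "A \<in> sets borel"
    and w: "\<And>x. x \<in> A \<Longrightarrow> 0 \<le> w x \<and> w x \<le> 1"
    and step: "\<And>x. x \<in> A \<Longrightarrow> f x - \<delta> \<le> w x * (\<integral>z. normal_density (- c * h) (sqrt h) z * f (x + z) \<partial>lborel)"
    and "\<delta> \<ge> 0"
  shows "expectation (\<lambda>\<omega>. g \<omega> * f (X 0 \<omega>)) - n * (K * \<delta>) \<le> expectation (\<lambda>\<omega>. g \<omega> * stopped_value f w A X n \<omega>)"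
proof -
  let ?J = "\<lambda>k. J \<union> \<iota> ` {..<k}"
  let ?F = "\<lambda>k. generated_by M D (?J k)" and ?\<xi> = "\<lambda>k \<omega>. D (\<iota> k) \<omega> - c * h"
  have DM: "D i \<in> borel_measurable M" if "i \<in> I" for i
    using D that by (auto simp: indep_vars_def)
  have JI: "?J k \<subseteq> I" if "k \<le> n" for k using J that by auto
  have new: "\<iota> k \<notin> ?J k" if "k < n" for k
    using J(2)[OF that] J(3) that by (auto dest: inj_onD)
  show ?thesis
  proof (rule expectation_stopped_value_ge[where F="?F" and \<xi>="?\<xi>"])
    fix k A B assume k: "k < n" and A: "A \<in> sets (?F k)" and B: "B \<in> sets (borel :: real measure)"
    have B': "(\<lambda>x. x - c * h) -` B \<in> sets borel"
      using measurable_sets[of "\<lambda>x. x - c * h" borel borel B] B by simp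
    have "?\<xi> k -` B = D (\<iota> k) -` ((\<lambda>x. x - c * h) -` B)" by auto
    then show "prob (A \<inter> (?\<xi> k -` B \<inter> space M)) = prob A * prob (?\<xi> k -` B \<inter> space M)"
      using indep_generated_by[OF D JI _ new[OF k] A B'] k J(2)[OF k] by simp
  next
    show "subalgebra M (?F k)" if "k \<le> n" for k
      using JI[OF that] DM by (intro subalgebra_generated_by) auto
    show "subalgebra (?F (Suc k)) (?F k)" if "k < n" for k
      by (intro subalgebra_generated_by measurable_generated_by) auto
    show "?\<xi> k \<in> borel_measurable (?F (Suc k))" if "k < n" for k
      by (intro borel_measurable_diff measurable_generated_by) auto
    show "X 0 \<in> borel_measurable (?F 0)" "g \<in> borel_measurable (?F 0)"
      using X g by simp_all
  next
    fix k x assume k: "k < n" and x: "x \<in> A"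
    have "distributed M lborel (\<lambda>\<omega>. - c * h + 1 * D (\<iota> k) \<omega>) (normal_density (- c * h + 1 * 0) (\<bar>1\<bar> * sqrt h))"
      using k J(2) \<open>h > 0\<close> by (intro normal_density_affine normal) auto
    then have "distributed M lborel (?\<xi> k) (normal_density (- c * h) (sqrt h))" by simp
    then have "distr M borel (?\<xi> k) = density lborel (normal_density (- c * h) (sqrt h))"
      using distributed_distr_eq_density[of M lborel "?\<xi> k"] by (simp cong: distr_cong)
    then have "(\<integral>z. f (x + z) \<partial>distr M borel (?\<xi> k)) = (\<integral>z. normal_density (- c * h) (sqrt h) z * f (x + z) \<partial>lborel)"
      using f by (simp add: integral_density)
    with step[OF x] show "f x - \<delta> \<le> w x * (\<integral>z. f (x + z) \<partial>distr M borel (?\<xi> k))" by simp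
  qed (use X g f wA w \<open>\<delta> \<ge> 0\<close> in auto)
qed

text \<open>Completing the square: exponential tilting shifts the mean of a normal law by
  \<open>s * \<sigma>\<^sup>2\<close>.\<close>

lemma normal_density_mult_exp:
  assumes "\<sigma> > 0"
  shows "normal_density \<mu> \<sigma> z * exp (s * z) = exp (s * \<mu> + s\<^sup>2 * \<sigma>\<^sup>2 / 2) * normal_density (\<mu> + s * \<sigma>\<^sup>2) \<sigma> z"
proof -
  have "- (z - \<mu>)\<^sup>2 / (2 * \<sigma>\<^sup>2) + s * z = (s * \<mu> + s\<^sup>2 * \<sigma>\<^sup>2 / 2) + - (z - (\<mu> + s * \<sigma>\<^sup>2))\<^sup>2 / (2 * \<sigma>\<^sup>2)"
    using assms by (simp add: field_simps power2_eq_square)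
  then have "exp (- (z - \<mu>)\<^sup>2 / (2 * \<sigma>\<^sup>2)) * exp (s * z) =
      exp (s * \<mu> + s\<^sup>2 * \<sigma>\<^sup>2 / 2) * exp (- (z - (\<mu> + s * \<sigma>\<^sup>2))\<^sup>2 / (2 * \<sigma>\<^sup>2))"
    by (simp only: exp_add[symmetric])
  then show ?thesis by (simp add: normal_density_def)
qed

lemma normal_mgf:
  assumes "\<sigma> > 0"
  shows "has_bochner_integral lborel (\<lambda>z. normal_density \<mu> \<sigma> z * exp (s * z)) (exp (s * \<mu> + s\<^sup>2 * \<sigma>\<^sup>2 / 2))"
proof -
  have "has_bochner_integral lborel (normal_density (\<mu> + s * \<sigma>\<^sup>2) \<sigma>) 1"
    using assms by (simp add: has_bochner_integral_iff)
  from has_bochner_integral_mult_right[OF this] show ?thesis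
    unfolding normal_density_mult_exp[OF assms] by simp
qed

context two_sided_brownian_motion
begin

text \<open>
  The mesh is \<open>2 ^ - m\<close> and the grid reaches out to \<open>- 2 ^ m\<close> and \<open>2 ^ m\<close>; increment \<open>i\<close> starts at
  \<open>(i - 4 ^ m) / 2 ^ m\<close>, so that the indices below \<open>4 ^ m\<close> are the past.
\<close>

definition grid_incr :: "nat \<Rightarrow> nat \<Rightarrow> 'a \<Rightarrow> real" where
  "grid_incr m i \<omega> = B ((real (Suc i) - 4 ^ m) / 2 ^ m) \<omega> - B ((real i - 4 ^ m) / 2 ^ m) \<omega>"

text \<open>The supremum defining the workload at 0, read backwards in time: a walk with downward
  drift started at 0, whose running maximum discretises that workload.\<close>

definition past_walk :: "real \<Rightarrow> nat \<Rightarrow> nat \<Rightarrow> 'a \<Rightarrow> real" where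
  "past_walk c m k \<omega> = B 0 \<omega> - B (- (real k / 2 ^ m)) \<omega> - c * (real k / 2 ^ m)"

definition past_max :: "real \<Rightarrow> nat \<Rightarrow> 'a \<Rightarrow> real" where
  "past_max c m \<omega> = Max ((\<lambda>k. past_walk c m k \<omega>) ` {..4 ^ m})"

text \<open>Started from the grid maximum rather than from the true workload: this starting point
  depends only on past grid increments, so the discrete identity is exact, and the gap disappears in
  the limit.\<close>

definition future_walk :: "real \<Rightarrow> nat \<Rightarrow> nat \<Rightarrow> 'a \<Rightarrow> real" where
  "future_walk c m k \<omega> = past_max c m \<omega> + (B (real k / 2 ^ m) \<omega> - B 0 \<omega> - c * (real k / 2 ^ m))"

section \<open>Increments and measurability of the grid walks\<close>

lemma indep_grid_incr: "indep_vars (\<lambda>_. borel) (grid_incr m) {..<2 * 4 ^ m}"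
  unfolding grid_incr_def
  by (rule indep_increments[where t="\<lambda>i. (real i - 4 ^ m) / 2 ^ m"])
     (auto simp: strict_mono_on_def divide_strict_right_mono)

lemma normal_grid_incr: "distributed M lborel (grid_incr m i) (normal_density 0 (sqrt (1 / 2 ^ m)))"
proof -
  have "(real (Suc i) - 4 ^ m) / 2 ^ m - (real i - 4 ^ m) / 2 ^ m = 1 / 2 ^ m"
    by (simp add: field_simps)
  with normal_increments[of "(real i - 4 ^ m) / 2 ^ m" "(real (Suc i) - 4 ^ m) / 2 ^ m"] show ?thesis
    unfolding grid_incr_def by (simp add: divide_strict_right_mono)
qed

lemma past_walk_0 [simp]: "past_walk c m 0 \<omega> = 0"
  by (simp add: past_walk_def)

text \<open>Step \<open>k\<close> into the past covers the cell from
  \<open>- (k + 1) / 2 ^ m\<close> to \<open>- k / 2 ^ m\<close>, whose left end has grid index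
  \<open>4 ^ m - 1 - k\<close>.\<close>

lemma past_walk_Suc:
  assumes "k < 4 ^ m"
  shows "past_walk c m (Suc k) \<omega> = past_walk c m k \<omega> + (grid_incr m (4 ^ m - 1 - k) \<omega> - c * (1 / 2 ^ m))"
proof -
  have "real (4 ^ m - 1 - k) = 4 ^ m - 1 - real k"
    using assms by (simp add: of_nat_diff)
  then have "(real (Suc (4 ^ m - 1 - k)) - 4 ^ m) / 2 ^ m = - (real k / 2 ^ m)"
    "(real (4 ^ m - 1 - k) - 4 ^ m) / 2 ^ m = - (real (Suc k) / 2 ^ m)"
    by (simp_all add: divide_simps)
  then show ?thesis
    unfolding past_walk_def grid_incr_def by (simp only:) (simp add: field_simps)
qed

lemma future_walk_0 [simp]: "future_walk c m 0 \<omega> = past_max c m \<omega>"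
  by (simp add: future_walk_def)

lemma future_walk_Suc:
  "future_walk c m (Suc k) \<omega> = future_walk c m k \<omega> + (grid_incr m (4 ^ m + k) \<omega> - c * (1 / 2 ^ m))"
proof -
  have "(real (Suc (4 ^ m + k)) - 4 ^ m) / 2 ^ m = real (Suc k) / 2 ^ m"
    "(real (4 ^ m + k) - 4 ^ m) / 2 ^ m = real k / 2 ^ m"
    by simp_all
  then show ?thesis
    unfolding future_walk_def grid_incr_def by (simp only:) (simp add: field_simps)
qed

lemma borel_measurable_past_walk_generated_by:
  assumes "k \<le> 4 ^ m"
  shows "past_walk c m k \<in> borel_measurable (generated_by M (grid_incr m) {..<4 ^ m})"
  using assms
proof (induction k)
  case (Suc k)
  then have "(\<lambda>\<omega>. past_walk c m k \<omega> + (grid_incr m (4 ^ m - 1 - k) \<omega> - c * (1 / 2 ^ m)))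
      \<in> borel_measurable (generated_by M (grid_incr m) {..<4 ^ m})"
    by (intro borel_measurable_add borel_measurable_diff measurable_generated_by) auto
  moreover have "past_walk c m (Suc k) = (\<lambda>\<omega>. past_walk c m k \<omega> + (grid_incr m (4 ^ m - 1 - k) \<omega> - c * (1 / 2 ^ m)))"
    using Suc by (intro ext past_walk_Suc) simp
  ultimately show ?case by simp
next
  case 0
  have "past_walk c m 0 = (\<lambda>_. 0)" by auto
  then show ?case by simp
qed

lemma borel_measurable_past_max_generated_by:
  "past_max c m \<in> borel_measurable (generated_by M (grid_incr m) {..<4 ^ m})"
  unfolding past_max_def[abs_def]
  by (intro borel_measurable_Max borel_measurable_past_walk_generated_by) auto

lemma borel_measurable_past_walk [measurable]: "past_walk c m k \<in> borel_measurable M"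
  unfolding past_walk_def[abs_def] using measurable_B by measurable

lemma borel_measurable_past_max [measurable]: "past_max c m \<in> borel_measurable M"
  unfolding past_max_def[abs_def] by (intro borel_measurable_Max) auto

lemma borel_measurable_future_walk [measurable]: "future_walk c m k \<in> borel_measurable M"
  unfolding future_walk_def[abs_def] using measurable_B by measurable

section \<open>Exceedance probabilities of the grid maximum\<close>

lemma past_max_gt_iff: "x < past_max c m \<omega> \<longleftrightarrow> (\<exists>k\<le>4 ^ m. x < past_walk c m k \<omega>)"
  unfolding past_max_def by (subst Max_gr_iff) auto

lemma past_walk_le_past_max: "k \<le> 4 ^ m \<Longrightarrow> past_walk c m k \<omega> \<le> past_max c m \<omega>"
  unfolding past_max_def by (intro Max_ge) auto

lemma past_max_nonneg: "0 \<le> past_max c m \<omega>"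
  using past_walk_le_past_max[of 0 m c \<omega>] by simp

text \<open>There is no discount here; a loss of at most \<delta> per step accumulates over the
  \<open>4 ^ m\<close> steps.\<close>

lemma past_walk_stopped_value_ge:
  assumes "f \<in> borel_measurable borel" "\<And>y. \<bar>f y\<bar> \<le> C"
    and "\<And>y. y \<le> x \<Longrightarrow> f y - \<delta> \<le> (\<integral>z. normal_density (- c * (1 / 2 ^ m)) (sqrt (1 / 2 ^ m)) z * f (y + z) \<partial>lborel)"
    and "\<delta> \<ge> 0"
  shows "f 0 - 4 ^ m * \<delta> \<le> expectation (stopped_value f (\<lambda>_. 1) {..x} (past_walk c m) (4 ^ m))"
proof -
  have "expectation (\<lambda>\<omega>. 1 * f (past_walk c m 0 \<omega>)) - real (4 ^ m) * (1 * \<delta>) \<le>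
      expectation (\<lambda>\<omega>. 1 * stopped_value f (\<lambda>_. 1) {..x} (past_walk c m) (4 ^ m) \<omega>)"
    by (rule gaussian_walk_stopped_value_ge[where D="grid_incr m" and I="{..<2 * 4 ^ m}" and h="1 / 2 ^ m"
          and J="{}" and \<iota>="\<lambda>k. 4 ^ m - 1 - k" and c=c and C=C, OF indep_grid_incr normal_grid_incr])
       (use assms past_walk_Suc[where c=c] in \<open>auto simp: inj_on_def\<close>)
  then show ?thesis by (simp add: prob_space)
qed

text \<open>On exit only \<open>x < y\<close> is recorded: the capped test functions below need no
  more about the overshoot.\<close>

lemma past_walk_stopped_value_cases:
  obtains y where "x < y" "x < past_max c m \<omega>" "stopped_value f (\<lambda>_. 1) {..x} (past_walk c m) (4 ^ m) \<omega> = f y"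
  | "past_walk c m (4 ^ m) \<omega> \<le> x" "past_max c m \<omega> \<le> x"
      "stopped_value f (\<lambda>_. 1) {..x} (past_walk c m) (4 ^ m) \<omega> = f (past_walk c m (4 ^ m) \<omega>)"
proof (cases "x < past_max c m \<omega>")
  case True
  define N where "N = (LEAST k. x < past_walk c m k \<omega>)"
  from True obtain k where k: "k \<le> 4 ^ m" "x < past_walk c m k \<omega>" by (auto simp: past_max_gt_iff)
  have N: "x < past_walk c m N \<omega>" unfolding N_def using k(2) by (rule LeastI)
  have "N \<le> k" unfolding N_def using k(2) by (rule Least_le)
  moreover have "past_walk c m j \<omega> \<in> {..x}" if "j < N" for j
    using not_less_Least[of j "\<lambda>k. x < past_walk c m k \<omega>"] that unfolding N_def by auto
  ultimately have "stopped_value f (\<lambda>_. 1) {..x} (past_walk c m) (4 ^ m) \<omega> = (\<Prod>j<N. 1) * f (past_walk c m N \<omega>)"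
    using N k(1) by (intro stopped_value_exit) auto
  with N True that(1) show thesis by simp
next
  case False
  then have le: "past_walk c m k \<omega> \<le> x" if "k \<le> 4 ^ m" for k
    using that by (auto simp: past_max_gt_iff not_less)
  then have "stopped_value f (\<lambda>_. 1) {..x} (past_walk c m) (4 ^ m) \<omega> = (\<Prod>j<(4::nat) ^ m. 1) * f (past_walk c m (4 ^ m) \<omega>)"
    by (intro stopped_value_survive) auto
  with False le[of "4 ^ m"] that(2) show thesis by simp
qed

text \<open>The exponential \<open>exp (2 * c * y)\<close> is a martingale along the walk, because
  \<open>2 * c\<close> is the nonzero root of \<open>s * (- c * h) + s\<^sup>2 * h / 2\<close>.
  Capping it at level \<open>x\<close> gives a bounded supermartingale whose value at the exit is
  exactly \<open>exp (2 * c * x)\<close>.\<close>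

lemma prob_past_max_gt_le:
  assumes "c > 0" "x \<ge> 0"
  shows "prob {\<omega> \<in> space M. x < past_max c m \<omega>} \<le> exp (- 2 * c * x)"
proof -
  let ?h = "1 / 2 ^ m :: real"
  \<comment> \<open>Negated, since the stopping inequality is stated for subharmonic
    functions.\<close>
  let ?f = "\<lambda>y. - min (exp (2 * c * y)) (exp (2 * c * x))"
  let ?n = "normal_density (- c * ?h) (sqrt ?h)"
  let ?S = "stopped_value ?f (\<lambda>_. 1) {..x} (past_walk c m) (4 ^ m)"
  have bnd: "\<bar>?f y\<bar> \<le> exp (2 * c * x)" for y by (simp add: abs_if)
  have mgf: "has_bochner_integral lborel (\<lambda>z. ?n z * exp (2 * c * z)) 1"
    using normal_mgf[of "sqrt ?h" "- c * ?h" "2 * c"] by (simp add: power2_eq_square)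
  have "?f 0 - 4 ^ m * 0 \<le> expectation ?S"
  proof (rule past_walk_stopped_value_ge[OF _ bnd])
    fix y assume y: "y \<le> x"
    have "(\<integral>z. exp (2 * c * y) * (?n z * exp (2 * c * z)) * - 1 \<partial>lborel) \<le> (\<integral>z. ?n z * ?f (y + z) \<partial>lborel)"
    proof (rule integral_mono)
      show "integrable lborel (\<lambda>z. exp (2 * c * y) * (?n z * exp (2 * c * z)) * - 1)"
        using mgf by (intro integrable_mult_left integrable_mult_right) (simp add: has_bochner_integral_iff)
      show "integrable lborel (\<lambda>z. ?n z * ?f (y + z))"
        by (rule Bochner_Integration.integrable_bound[where f="\<lambda>z. ?n z * exp (2 * c * x)"])
           (auto simp: abs_mult intro!: mult_left_mono)
      fix z
      have "?n z * min (exp (2 * c * (y + z))) (exp (2 * c * x)) \<le> ?n z * exp (2 * c * (y + z))"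
        by (intro mult_left_mono) auto
      then show "exp (2 * c * y) * (?n z * exp (2 * c * z)) * - 1 \<le> ?n z * ?f (y + z)"
        by (simp add: algebra_simps exp_add)
    qed
    moreover have "(\<integral>z. exp (2 * c * y) * (?n z * exp (2 * c * z)) * - 1 \<partial>lborel) = - exp (2 * c * y)"
      using mgf by (simp add: has_bochner_integral_iff)
    ultimately show "?f y - 0 \<le> (\<integral>z. ?n z * ?f (y + z) \<partial>lborel)"
      using y \<open>c > 0\<close> by simp
  qed auto
  also have "expectation ?S \<le> expectation (\<lambda>\<omega>. - exp (2 * c * x) * indicator {\<omega> \<in> space M. x < past_max c m \<omega>} \<omega>)"
  proof (rule integral_mono)
    have "?S \<in> borel_measurable M" by (intro borel_measurable_stopped_value) auto
    then show "integrable M ?S"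
      by (rule integrable_const_bound[where B="exp (2 * c * x)", rotated])
         (auto intro!: stopped_value_bounded bnd)
    show "integrable M (\<lambda>\<omega>. - exp (2 * c * x) * indicator {\<omega> \<in> space M. x < past_max c m \<omega>} \<omega>)"
      by (intro integrable_mult_right) (auto simp: integrable_indicator_iff less_top[symmetric])
    fix \<omega>
    show "?S \<omega> \<le> - exp (2 * c * x) * indicator {\<omega> \<in> space M. x < past_max c m \<omega>} \<omega>"
      by (rule past_walk_stopped_value_cases[of x c m \<omega> ?f]) (use \<open>c > 0\<close> in \<open>auto simp: indicator_def\<close>)
  qed
  also have "\<dots> = - exp (2 * c * x) * prob {\<omega> \<in> space M. x < past_max c m \<omega>}"
    by simp
  finally have "exp (2 * c * x) * prob {\<omega> \<in> space M. x < past_max c m \<omega>} \<le> 1"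
    using assms by simp
  then show ?thesis
    by (simp add: exp_minus field_simps)
qed

text \<open>Converse estimate with the cap raised to \<open>x + \<epsilon>\<close>. Starting from at
  most \<open>x\<close>, the cap matters only if a single step exceeds \<epsilon>; this is the first
  error term, summed over \<open>4 ^ m\<close> steps. The second comes from paths that have not
  exceeded \<open>x\<close> by the end of the grid.\<close>

lemma prob_past_max_gt_ge:
  assumes "c > 0" "x \<ge> 0" "\<epsilon> > 0"
  shows "1 - 4 ^ m * exp (2 * c * x + c * \<epsilon> - \<epsilon>\<^sup>2 * 2 ^ m / 2) - exp (c * x - c\<^sup>2 * 2 ^ m / 2)
    \<le> exp (2 * c * (x + \<epsilon>)) * prob {\<omega> \<in> space M. x < past_max c m \<omega>}"
proof -
  let ?h = "1 / 2 ^ m :: real"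
  let ?f = "\<lambda>y. min (exp (2 * c * y)) (exp (2 * c * (x + \<epsilon>)))"
  let ?n = "normal_density (- c * ?h) (sqrt ?h)"
  let ?S = "stopped_value ?f (\<lambda>_. 1) {..x} (past_walk c m) (4 ^ m)"
  let ?E = "{\<omega> \<in> space M. x < past_max c m \<omega>}"
  \<comment> \<open>This is \<open>\<epsilon> / h\<close>, the optimal Chernoff exponent for a
    centred normal step of variance \<open>h\<close> to exceed \<epsilon>.\<close>
  define l where "l = \<epsilon> * 2 ^ m"
  define \<delta> where "\<delta> = exp (2 * c * x + c * \<epsilon> - \<epsilon>\<^sup>2 * 2 ^ m / 2)"
  have bnd: "\<bar>?f y\<bar> \<le> exp (2 * c * (x + \<epsilon>))" for y by (subst abs_of_nonneg) auto
  have mgf1: "has_bochner_integral lborel (\<lambda>z. ?n z * exp (2 * c * z)) 1"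
    using normal_mgf[of "sqrt ?h" "- c * ?h" "2 * c"] by (simp add: power2_eq_square)
  have "(2 * c + l) * (- c * ?h) + (2 * c + l)\<^sup>2 * (sqrt ?h)\<^sup>2 / 2 = c * \<epsilon> + \<epsilon>\<^sup>2 * 2 ^ m / 2"
    by (simp add: l_def power2_eq_square field_simps)
  then have mgf2: "has_bochner_integral lborel (\<lambda>z. ?n z * exp ((2 * c + l) * z)) (exp (c * \<epsilon> + \<epsilon>\<^sup>2 * 2 ^ m / 2))"
    using normal_mgf[of "sqrt ?h" "- c * ?h" "2 * c + l"] by simp
  have lower: "?f 0 - 4 ^ m * \<delta> \<le> expectation ?S"
  proof (rule past_walk_stopped_value_ge[OF _ bnd])
    fix y assume y: "y \<le> x"
    \<comment> \<open>A minorant of the capped integrand with an explicit integral: the subtracted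
      exponential carries the factor \<open>exp (l * (z - \<epsilon>))\<close>, which is at least 1
      for \<open>z > \<epsilon>\<close>, and so outweighs the uncapped exponential there.\<close>
    let ?g = "\<lambda>z. exp (2 * c * y) * (?n z * exp (2 * c * z)) - exp (2 * c * x - l * \<epsilon>) * (?n z * exp ((2 * c + l) * z))"
    have g: "has_bochner_integral lborel ?g (exp (2 * c * y) * 1 - exp (2 * c * x - l * \<epsilon>) * exp (c * \<epsilon> + \<epsilon>\<^sup>2 * 2 ^ m / 2))"
      by (intro has_bochner_integral_diff has_bochner_integral_mult_right mgf1 mgf2)
    have "integral\<^sup>L lborel ?g \<le> (\<integral>z. ?n z * ?f (y + z) \<partial>lborel)"
    proof (rule integral_mono)
      show "integrable lborel ?g" using g by (simp only: has_bochner_integral_iff)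
      show "integrable lborel (\<lambda>z. ?n z * ?f (y + z))"
        by (rule Bochner_Integration.integrable_bound[where f="\<lambda>z. ?n z * exp (2 * c * (x + \<epsilon>))"])
           (auto simp: abs_mult intro!: mult_left_mono)
      fix z
      have "exp (2 * c * (y + z)) - exp (2 * c * (x + z) + l * (z - \<epsilon>)) \<le> ?f (y + z)"
      proof (cases "z \<le> \<epsilon>")
        case True
        then have "?f (y + z) = exp (2 * c * (y + z))" using y \<open>c > 0\<close> by simp
        then show ?thesis by simp
      next
        case False
        then have "0 \<le> l * (z - \<epsilon>)" using \<open>\<epsilon> > 0\<close> by (simp add: l_def)
        moreover have "2 * c * (y + z) \<le> 2 * c * (x + z)" using y \<open>c > 0\<close> by simp
        ultimately have "exp (2 * c * (y + z)) \<le> exp (2 * c * (x + z) + l * (z - \<epsilon>))"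
          by (subst exp_le_cancel_iff) linarith
        then show ?thesis by (smt (verit) exp_gt_zero)
      qed
      then have "?n z * (exp (2 * c * (y + z)) - exp (2 * c * (x + z) + l * (z - \<epsilon>))) \<le> ?n z * ?f (y + z)"
        by (intro mult_left_mono) auto
      moreover have "?n z * (exp (2 * c * (y + z)) - exp (2 * c * (x + z) + l * (z - \<epsilon>))) = ?g z"
        by (simp add: algebra_simps exp_add exp_diff)
      ultimately show "?g z \<le> ?n z * ?f (y + z)" by simp
    qed
    moreover have "exp (2 * c * x - l * \<epsilon>) * exp (c * \<epsilon> + \<epsilon>\<^sup>2 * 2 ^ m / 2) = \<delta>"
      unfolding \<delta>_def exp_add[symmetric] by (simp add: l_def power2_eq_square field_simps)
    moreover have "?f y = exp (2 * c * y)" using y \<open>c > 0\<close> \<open>\<epsilon> > 0\<close> by simp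
    ultimately show "?f y - \<delta> \<le> (\<integral>z. ?n z * ?f (y + z) \<partial>lborel)"
      using g by (simp add: has_bochner_integral_iff)
  qed (auto simp: \<delta>_def)
  \<comment> \<open>Without exit, the final position \<open>Y \<le> x\<close> satisfies
    \<open>exp (2 * c * Y) \<le> exp (c * x) * exp (c * Y)\<close>. Half of the exponent is given
    away because \<open>exp (c * Y)\<close> has a vanishing mean as the grid grows, whereas
    \<open>exp (2 * c * Y)\<close> has mean 1.\<close>
  have upper: "expectation ?S \<le> expectation (\<lambda>\<omega>. exp (2 * c * (x + \<epsilon>)) * indicator ?E \<omega> + exp (c * x) * exp (c * past_walk c m (4 ^ m) \<omega>))"
    and upper_eq: "expectation (\<lambda>\<omega>. exp (2 * c * (x + \<epsilon>)) * indicator ?E \<omega> + exp (c * x) * exp (c * past_walk c m (4 ^ m) \<omega>)) =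
      exp (2 * c * (x + \<epsilon>)) * prob ?E + exp (c * x) * exp (- (c\<^sup>2 * 2 ^ m / 2))"
  proof -
    have nT: "normal_density 0 (sqrt (2 ^ m)) z * exp (c * (z - c * 2 ^ m)) =
        exp (- (c\<^sup>2 * 2 ^ m)) * (normal_density 0 (sqrt (2 ^ m)) z * exp (c * z))" for z
      by (simp add: exp_diff exp_minus field_simps power2_eq_square)
    have D: "distributed M lborel (\<lambda>\<omega>. B 0 \<omega> - B (- (2 ^ m)) \<omega>) (normal_density 0 (sqrt (2 ^ m)))"
      using normal_increments[of "- (2 ^ m)" 0] by simp
    have YT: "past_walk c m (4 ^ m) \<omega> = (B 0 \<omega> - B (- (2 ^ m)) \<omega>) - c * 2 ^ m" for \<omega>
    proof -
      have "(4::real) ^ m / 2 ^ m = 2 ^ m" by (simp flip: power_divide)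
      then show ?thesis by (simp add: past_walk_def)
    qed
    have mT: "has_bochner_integral lborel (\<lambda>z. exp (- (c\<^sup>2 * 2 ^ m)) * (normal_density 0 (sqrt (2 ^ m)) z * exp (c * z)))
        (exp (- (c\<^sup>2 * 2 ^ m)) * exp (c * 0 + c\<^sup>2 * (sqrt (2 ^ m))\<^sup>2 / 2))"
      by (intro has_bochner_integral_mult_right normal_mgf) simp
    have int: "integrable M (\<lambda>\<omega>. exp (c * past_walk c m (4 ^ m) \<omega>))"
      unfolding YT
      by (subst distributed_integrable[OF D, of "\<lambda>z. exp (c * (z - c * 2 ^ m))", symmetric])
         (use mT in \<open>auto simp: nT has_bochner_integral_iff\<close>)
    have "expectation (\<lambda>\<omega>. exp (c * past_walk c m (4 ^ m) \<omega>)) = exp (- (c\<^sup>2 * 2 ^ m)) * exp (c * 0 + c\<^sup>2 * (sqrt (2 ^ m))\<^sup>2 / 2)"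
      unfolding YT
      by (subst distributed_integral[OF D, of "\<lambda>z. exp (c * (z - c * 2 ^ m))", symmetric])
         (use mT in \<open>auto simp: nT has_bochner_integral_iff\<close>)
    also have "\<dots> = exp (- (c\<^sup>2 * 2 ^ m / 2))"
      unfolding exp_add[symmetric] by (simp add: field_simps)
    finally have val: "expectation (\<lambda>\<omega>. exp (c * past_walk c m (4 ^ m) \<omega>)) = exp (- (c\<^sup>2 * 2 ^ m / 2))" .
    have intE: "integrable M (\<lambda>\<omega>. exp (2 * c * (x + \<epsilon>)) * indicator ?E \<omega>)"
      by (intro integrable_mult_right) (auto simp: integrable_indicator_iff less_top[symmetric])
    show "expectation (\<lambda>\<omega>. exp (2 * c * (x + \<epsilon>)) * indicator ?E \<omega> + exp (c * x) * exp (c * past_walk c m (4 ^ m) \<omega>)) =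
      exp (2 * c * (x + \<epsilon>)) * prob ?E + exp (c * x) * exp (- (c\<^sup>2 * 2 ^ m / 2))"
      using intE int val by simp
    show "expectation ?S \<le> expectation (\<lambda>\<omega>. exp (2 * c * (x + \<epsilon>)) * indicator ?E \<omega> + exp (c * x) * exp (c * past_walk c m (4 ^ m) \<omega>))"
    proof (rule integral_mono)
      have "?S \<in> borel_measurable M" by (intro borel_measurable_stopped_value) auto
      then show "integrable M ?S"
        by (rule integrable_const_bound[where B="exp (2 * c * (x + \<epsilon>))", rotated])
           (auto intro!: stopped_value_bounded bnd)
      show "integrable M (\<lambda>\<omega>. exp (2 * c * (x + \<epsilon>)) * indicator ?E \<omega> + exp (c * x) * exp (c * past_walk c m (4 ^ m) \<omega>))"
        using intE int by simp
      fix \<omega> assume \<omega>: "\<omega> \<in> space M"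
      show "?S \<omega> \<le> exp (2 * c * (x + \<epsilon>)) * indicator ?E \<omega> + exp (c * x) * exp (c * past_walk c m (4 ^ m) \<omega>)"
      proof (rule past_walk_stopped_value_cases[of x c m \<omega> ?f])
        fix y assume "x < past_max c m \<omega>" "?S \<omega> = ?f y"
        then show ?thesis using \<omega> by (simp add: min.coboundedI2 add_increasing2)
      next
        let ?Y = "past_walk c m (4 ^ m) \<omega>"
        assume *: "?Y \<le> x" "past_max c m \<omega> \<le> x" "?S \<omega> = ?f ?Y"
        have "c * ?Y \<le> c * x" using *(1) \<open>c > 0\<close> by simp
        then have "2 * c * ?Y \<le> c * x + c * ?Y" by linarith
        then have "?f ?Y \<le> exp (c * x) * exp (c * ?Y)"
          unfolding exp_add[symmetric] by (simp add: min.coboundedI1)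
        then show ?thesis using * by simp
      qed
    qed
  qed
  from lower upper upper_eq have "?f 0 - 4 ^ m * \<delta> \<le> exp (2 * c * (x + \<epsilon>)) * prob ?E + exp (c * x) * exp (- (c\<^sup>2 * 2 ^ m / 2))"
    by linarith
  moreover have "?f 0 = 1" using assms by simp
  moreover have "exp (c * x) * exp (- (c\<^sup>2 * 2 ^ m / 2)) = exp (c * x - c\<^sup>2 * 2 ^ m / 2)"
    by (simp flip: exp_add)
  ultimately show ?thesis unfolding \<delta>_def by linarith
qed

text \<open>The upper bound is uniform in \<open>m\<close>. In the lower one \<epsilon> is chosen
  first; as the mesh shrinks, the double-exponential decay in \<open>m\<close> defeats the number
  \<open>4 ^ m\<close> of steps.\<close>

lemma prob_past_max_gt_tendsto:
  assumes "c > 0" "x \<ge> 0"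
  shows "(\<lambda>m. prob {\<omega> \<in> space M. x < past_max c m \<omega>}) \<longlonglongrightarrow> exp (- 2 * c * x)"
proof (rule order_tendstoI)
  fix a assume a: "a < exp (- 2 * c * x)"
  have "((\<lambda>\<epsilon>. exp (- 2 * c * (x + \<epsilon>))) \<longlongrightarrow> exp (- 2 * c * (x + 0))) (at_right 0)"
    by (intro tendsto_intros)
  then have "\<forall>\<^sub>F \<epsilon> in at_right 0. a < exp (- 2 * c * (x + \<epsilon>))"
    using a by (intro order_tendstoD) auto
  then have "\<forall>\<^sub>F \<epsilon> in at_right 0. \<epsilon> > 0 \<and> a < exp (- 2 * c * (x + \<epsilon>))"
    using eventually_at_right_less[of 0] by eventually_elim simp
  then obtain \<epsilon> where \<epsilon>: "\<epsilon> > 0" "a < exp (- 2 * c * (x + \<epsilon>))"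
    using eventually_happens'[OF trivial_limit_at_right_real] by blast
  let ?l = "\<lambda>m. exp (- 2 * c * (x + \<epsilon>)) * (1 - 4 ^ m * exp (2 * c * x + c * \<epsilon> - \<epsilon>\<^sup>2 * 2 ^ m / 2) - exp (c * x - c\<^sup>2 * 2 ^ m / 2))"
  have "(\<lambda>m. 4 ^ m * exp (2 * c * x + c * \<epsilon> - \<epsilon>\<^sup>2 * 2 ^ m / 2)) \<longlonglongrightarrow> 0"
    using \<epsilon>(1) by real_asymp
  moreover have "(\<lambda>m::nat. exp (c * x - c\<^sup>2 * 2 ^ m / 2)) \<longlonglongrightarrow> 0"
    using assms by real_asymp
  ultimately have "?l \<longlonglongrightarrow> exp (- 2 * c * (x + \<epsilon>)) * (1 - 0 - 0)"
    by (intro tendsto_intros)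
  then have "\<forall>\<^sub>F m in sequentially. a < ?l m"
    using \<epsilon>(2) by (intro order_tendstoD(1)) auto
  then show "\<forall>\<^sub>F m in sequentially. a < prob {\<omega> \<in> space M. x < past_max c m \<omega>}"
  proof eventually_elim
    case (elim m)
    have "?l m \<le> exp (- 2 * c * (x + \<epsilon>)) * (exp (2 * c * (x + \<epsilon>)) * prob {\<omega> \<in> space M. x < past_max c m \<omega>})"
      by (intro mult_left_mono prob_past_max_gt_ge assms \<epsilon>) auto
    also have "\<dots> = prob {\<omega> \<in> space M. x < past_max c m \<omega>}"
      by (simp add: exp_minus)
    finally show ?case using elim by simp
  qed
next
  fix a assume "exp (- 2 * c * x) < a"
  then show "\<forall>\<^sub>F m in sequentially. prob {\<omega> \<in> space M. x < past_max c m \<omega>} < a"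
    by (intro always_eventually allI le_less_trans[OF prob_past_max_gt_le[OF assms]])
qed

text \<open>Convergence of the tails is convergence of the distribution functions, hence weak
  convergence to the exponential law. The law of the initial workload enters the proof only in this
  form.\<close>

lemma past_max_weak_limit:
  assumes "c > 0" and f: "\<And>x. isCont f x" "\<And>x. \<bar>f x\<bar> \<le> C"
  shows "(\<lambda>m. expectation (\<lambda>\<omega>. f (past_max c m \<omega>))) \<longlonglongrightarrow>
    (\<integral>x. exponential_density (2 * c) x * f x \<partial>lborel)"
proof -
  let ?E = "density lborel (exponential_density (2 * c))"
  let ?N = "\<lambda>m. distr M borel (past_max c m)"
  have c2: "0 < 2 * c" using assms by simp
  interpret E: prob_space ?E by (rule prob_space_exponential_density) fact
  have E: "real_distribution ?E" by unfold_locales auto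
  have N: "real_distribution (?N m)" for m
    by (rule real_distribution_distr) simp
  have cdfE: "cdf ?E x = (if 0 \<le> x then 1 - exp (- (2 * c) * x) else 0)" for x
    using emeasure_erlang_density[OF c2, of 0 x] E.emeasure_eq_measure[of "{..x}"] c2
    by (auto simp: cdf_def erlang_CDF_0 measure_nonneg)
  have cdfN: "cdf (?N m) x = 1 - prob {\<omega> \<in> space M. x < past_max c m \<omega>}" for m x
  proof -
    have "cdf (?N m) x = prob {\<omega> \<in> space M. \<not> x < past_max c m \<omega>}"
      unfolding cdf_def by (subst measure_distr) (auto intro!: arg_cong[where f=prob])
    also have "\<dots> = 1 - prob {\<omega> \<in> space M. x < past_max c m \<omega>}"
      by (rule prob_neg) measurable
    finally show ?thesis .
  qed
  have "weak_conv_m ?N ?E"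
    unfolding weak_conv_m_def weak_conv_def
  proof (intro allI impI)
    fix x
    show "(\<lambda>m. cdf (?N m) x) \<longlonglongrightarrow> cdf ?E x"
    proof (cases "0 \<le> x")
      case True
      have "(\<lambda>m. 1 - prob {\<omega> \<in> space M. x < past_max c m \<omega>}) \<longlonglongrightarrow> 1 - exp (- 2 * c * x)"
        by (intro tendsto_intros prob_past_max_gt_tendsto assms True)
      then show ?thesis using True by (simp add: cdfE cdfN)
    next
      case False
      then have "x < past_max c m \<omega>" for m \<omega> using past_max_nonneg[of c m \<omega>] by linarith
      then show ?thesis using False by (simp add: cdfE cdfN prob_space)
    qed
  qed
  then have "(\<lambda>m. integral\<^sup>L (?N m) f) \<longlonglongrightarrow> integral\<^sup>L ?E f"
    using N E f by (intro weak_conv_imp_integral_bdd_continuous_conv) auto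
  moreover have fm: "f \<in> borel_measurable borel"
    using f(1) by (intro borel_measurable_continuous_onI) (auto simp: continuous_on_eq_continuous_at)
  ultimately show ?thesis
    using exponential_density_nonneg[OF c2]
    by (simp add: integral_distr integral_real_density)
qed

end

section \<open>Pathwise limits\<close>

text \<open>
  First the mesh is refined, with the stopping level \<open>1 / Suc j\<close> fixed; then the level is lowered.
  Stopping at a positive level keeps the discrete exit time below the hitting time of \<open>0\<close>, so no
  statement about the path immediately after that time is needed.
\<close>

definition nested_sequentially :: "(nat \<times> nat) filter" where
  "nested_sequentially = Abs_filter (\<lambda>P. \<forall>\<^sub>F j in sequentially. \<forall>\<^sub>F m in sequentially. P (j, m))"

lemma eventually_nested_sequentially:
  "eventually P nested_sequentially \<longleftrightarrow> (\<forall>\<^sub>F j in sequentially. \<forall>\<^sub>F m in sequentially. P (j, m))"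
  unfolding nested_sequentially_def
proof (rule eventually_Abs_filter, rule is_filter.intro)
  fix P Q :: "nat \<times> nat \<Rightarrow> bool"
  assume PQ: "\<forall>x. P x \<longrightarrow> Q x" and P: "\<forall>\<^sub>F j in sequentially. \<forall>\<^sub>F m in sequentially. P (j, m)"
  from P show "\<forall>\<^sub>F j in sequentially. \<forall>\<^sub>F m in sequentially. Q (j, m)"
    by (rule eventually_mono) (auto elim!: eventually_mono simp: PQ)
qed (auto intro: eventually_elim2 eventually_conj)

lemma filterlim_snd_nested_sequentially: "filterlim snd sequentially nested_sequentially"
  by (auto simp: filterlim_iff eventually_nested_sequentially)

text \<open>For fixed \<open>j\<close> the inner sequence need not converge; only the nested limit
  exists. Upper limits in \<open>m\<close> serve as measurable intermediaries, both to find a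
  measurable version of \<open>L\<close> and to apply the reversed Fatou lemma, which is followed by
  dominated convergence in \<open>j\<close>.\<close>

lemma (in prob_space) integral_nested_limit:
  fixes Z :: "nat \<Rightarrow> nat \<Rightarrow> 'a \<Rightarrow> real"
  assumes Z [measurable]: "\<And>j m. Z j m \<in> borel_measurable M" and bound: "\<And>j m \<omega>. \<bar>Z j m \<omega>\<bar> \<le> C"
    and lim: "AE \<omega> in M. ((\<lambda>(j, m). Z j m \<omega>) \<longlongrightarrow> L \<omega>) nested_sequentially"
    and R: "\<And>j. (\<lambda>m. expectation (Z j m)) \<longlonglongrightarrow> R"
  shows "(\<integral>\<omega>. L \<omega> \<partial>completion M) = R"
proof -
  have C: "C \<ge> 0" using bound[of 0 0 undefined] by linarith
  define U where "U j \<omega> = real_of_ereal (limsup (\<lambda>m. ereal (Z j m \<omega>)))" for j \<omega>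
  \<comment> \<open>The cutoff makes the version bounded by \<open>C\<close> everywhere; the default
    0 is taken only on a null set.\<close>
  define L' where "L' \<omega> = (if \<bar>lim (\<lambda>j. U j \<omega>)\<bar> \<le> C then lim (\<lambda>j. U j \<omega>) else 0)" for \<omega>
  have U [measurable]: "U j \<in> borel_measurable M" for j unfolding U_def[abs_def] by measurable
  have lim_meas [measurable]: "(\<lambda>\<omega>. lim (\<lambda>j. U j \<omega>)) \<in> borel_measurable M"
    by (rule borel_measurable_lim_metric) measurable
  have L' [measurable]: "L' \<in> borel_measurable M" unfolding L'_def[abs_def] by measurable
  have L'C: "\<bar>L' \<omega>\<bar> \<le> C" for \<omega> using C by (auto simp: L'_def)
  have near: "\<forall>\<^sub>F j in sequentially. \<forall>\<^sub>F m in sequentially. \<bar>Z j m \<omega> - L \<omega>\<bar> < e"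
    if "((\<lambda>(j, m). Z j m \<omega>) \<longlongrightarrow> L \<omega>) nested_sequentially" "e > 0" for e \<omega>
    using tendstoD[OF that] by (simp add: eventually_nested_sequentially dist_real_def)
  have "AE \<omega> in M. L \<omega> = L' \<omega>"
    using lim
  proof eventually_elim
    case (elim \<omega>)
    have "(\<lambda>j. U j \<omega>) \<longlonglongrightarrow> L \<omega>"
    proof (rule tendstoI)
      fix e :: real assume e: "e > 0"
      from near[OF elim half_gt_zero[OF e]]
      show "\<forall>\<^sub>F j in sequentially. dist (U j \<omega>) (L \<omega>) < e"
      proof eventually_elim
        case (elim j)
        have up: "limsup (\<lambda>m. ereal (Z j m \<omega>)) \<le> ereal (L \<omega> + e / 2)"
        proof (rule Limsup_bounded)
          from elim show "\<forall>\<^sub>F m in sequentially. ereal (Z j m \<omega>) \<le> ereal (L \<omega> + e / 2)"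
            by eventually_elim (unfold ereal_less_eq, linarith)
        qed
        have lo: "ereal (L \<omega> - e / 2) \<le> limsup (\<lambda>m. ereal (Z j m \<omega>))"
        proof (rule order_trans[OF Liminf_bounded Liminf_le_Limsup])
          from elim show "\<forall>\<^sub>F m in sequentially. ereal (L \<omega> - e / 2) \<le> ereal (Z j m \<omega>)"
            by eventually_elim (unfold ereal_less_eq, linarith)
        qed simp
        show ?case
          using up lo e unfolding U_def dist_real_def
          by (cases "limsup (\<lambda>m. ereal (Z j m \<omega>))") auto
      qed
    qed
    then have "lim (\<lambda>j. U j \<omega>) = L \<omega>" by (rule limI)
    moreover have "\<bar>L \<omega>\<bar> \<le> C"
    proof (rule tendsto_upperbound)
      show "((\<lambda>p. \<bar>case p of (j, m) \<Rightarrow> Z j m \<omega>\<bar>) \<longlongrightarrow> \<bar>L \<omega>\<bar>) nested_sequentially"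
        using elim by (intro tendsto_intros)
      show "\<forall>\<^sub>F p in nested_sequentially. \<bar>case p of (j, m) \<Rightarrow> Z j m \<omega>\<bar> \<le> C"
        using bound by (auto intro!: always_eventually)
      show "nested_sequentially \<noteq> bot"
        by (simp add: trivial_limit_def eventually_nested_sequentially)
    qed
    ultimately show ?case by (simp add: L'_def)
  qed
  note LL' = this
  have int: "integrable M (Z j m)" "integrable M L'" for j m
    by (auto intro!: integrable_const_bound[where B=C] bound L'C)
  define V where "V j \<omega> = limsup (\<lambda>m. ennreal \<bar>Z j m \<omega> - L' \<omega>\<bar>)" for j \<omega>
  have [measurable]: "V j \<in> borel_measurable M" for j unfolding V_def[abs_def] by measurable
  have dom: "\<bar>Z j m \<omega> - L' \<omega>\<bar> \<le> 2 * C" for j m \<omega>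
    using bound[of j m \<omega>] L'C[of \<omega>] by linarith
  \<comment> \<open>Since \<open>R\<close> does not depend on \<open>j\<close>, a bound by the mean
    of \<open>V j\<close> for every \<open>j\<close> suffices once these means tend to 0.\<close>
  have "ennreal \<bar>R - expectation L'\<bar> \<le> (\<integral>\<^sup>+\<omega>. V j \<omega> \<partial>M)" for j
  proof -
    have "(\<lambda>m. ennreal \<bar>expectation (Z j m) - expectation L'\<bar>) \<longlonglongrightarrow> ennreal \<bar>R - expectation L'\<bar>"
      by (intro tendsto_intros R)
    then have "ennreal \<bar>R - expectation L'\<bar> = limsup (\<lambda>m. ennreal \<bar>expectation (Z j m) - expectation L'\<bar>)"
      by (rule lim_imp_Limsup[OF sequentially_bot, symmetric])
    also have "\<dots> \<le> limsup (\<lambda>m. \<integral>\<^sup>+\<omega>. ennreal \<bar>Z j m \<omega> - L' \<omega>\<bar> \<partial>M)"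
    proof (intro Limsup_mono always_eventually allI)
      fix m
      have "\<bar>expectation (Z j m) - expectation L'\<bar> = \<bar>expectation (\<lambda>\<omega>. Z j m \<omega> - L' \<omega>)\<bar>"
        using int by simp
      also have "\<dots> \<le> expectation (\<lambda>\<omega>. \<bar>Z j m \<omega> - L' \<omega>\<bar>)" by (rule integral_abs_bound)
      finally show "ennreal \<bar>expectation (Z j m) - expectation L'\<bar> \<le> (\<integral>\<^sup>+\<omega>. ennreal \<bar>Z j m \<omega> - L' \<omega>\<bar> \<partial>M)"
        using int by (subst nn_integral_eq_integral) (auto intro!: ennreal_leI)
    qed
    also have "\<dots> \<le> (\<integral>\<^sup>+\<omega>. V j \<omega> \<partial>M)"
      unfolding V_def
      by (rule nn_integral_limsup[where w="\<lambda>_. ennreal (2 * C)"])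
         (auto intro!: AE_I2 ennreal_leI dom simp: emeasure_space_1 simp del: ennreal_mult'')
    finally show ?thesis .
  qed
  moreover have "(\<lambda>j. \<integral>\<^sup>+\<omega>. V j \<omega> \<partial>M) \<longlonglongrightarrow> (\<integral>\<^sup>+\<omega>. 0 \<partial>M)"
  proof (rule nn_integral_dominated_convergence[where w="\<lambda>_. ennreal (2 * C)"])
    show "AE \<omega> in M. V j \<omega> \<le> ennreal (2 * C)" for j
      unfolding V_def by (intro AE_I2 Limsup_bounded always_eventually allI ennreal_leI dom)
    show "AE \<omega> in M. (\<lambda>j. V j \<omega>) \<longlonglongrightarrow> 0"
      using lim LL'
    proof eventually_elim
      case (elim \<omega>)
      have small: "\<forall>\<^sub>F j in sequentially. V j \<omega> \<le> ennreal e" if "e > 0" for e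
        using near[OF elim(1) that]
      proof eventually_elim
        case (elim j)
        then show ?case
          unfolding V_def using \<open>L \<omega> = L' \<omega>\<close>
          by (intro Limsup_bounded) (auto elim!: eventually_mono intro!: ennreal_leI)
      qed
      show ?case
      proof (rule order_tendstoI)
        fix a :: ennreal assume "0 < a"
        then obtain a' where a': "0 < a'" "a' < a" using dense by blast
        then obtain e where e: "e > 0" "ennreal e < a"
          by (cases a') auto
        from small[OF e(1)] show "\<forall>\<^sub>F j in sequentially. V j \<omega> < a"
          by eventually_elim (use e(2) in auto)
      qed simp
    qed
  qed (auto simp: emeasure_space_1)
  then have "(\<lambda>j. \<integral>\<^sup>+\<omega>. V j \<omega> \<partial>M) \<longlonglongrightarrow> 0" by simp
  ultimately have "ennreal \<bar>R - expectation L'\<bar> \<le> 0"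
    by (intro tendsto_lowerbound[OF _ always_eventually]) auto
  then have R': "R = expectation L'" by simp
  have Lc: "AE \<omega> in completion M. L \<omega> = L' \<omega>" using LL' by (rule AE_completion)
  have L'c: "L' \<in> borel_measurable (completion M)" by (rule measurable_completion) simp
  have "L \<in> borel_measurable (completion M)"
  proof (rule measurableI)
    fix A :: "real set" assume A: "A \<in> sets borel"
    have A': "L' -` A \<inter> space (completion M) \<in> sets (completion M)"
      by (rule measurable_sets[OF L'c A])
    have ae: "AE \<omega> in completion M. \<omega> \<in> L' -` A \<inter> space (completion M) \<longleftrightarrow> \<omega> \<in> L -` A \<inter> space (completion M)"
      using Lc by eventually_elim auto
    show "L -` A \<inter> space (completion M) \<in> sets (completion M)"
      by (rule completion.in_sets_AE[OF ae A']) simp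
  qed simp
  then have "(\<integral>\<omega>. L \<omega> \<partial>completion M) = (\<integral>\<omega>. L' \<omega> \<partial>completion M)"
    using L'c Lc by (intro integral_cong_AE) auto
  also have "\<dots> = R" unfolding R' by (rule integral_completion) simp
  finally show ?thesis .
qed

section \<open>Dyadic approximation of the initial workload\<close>

lemma floor_dyadic_tendsto: "(\<lambda>m. real (nat \<lfloor>x * 2 ^ m\<rfloor>) / 2 ^ m) \<longlonglongrightarrow> x" if "x \<ge> 0" for x :: real
proof (rule tendsto_sandwich)
  show "(\<lambda>m::nat. x - 1 / 2 ^ m) \<longlonglongrightarrow> x" by real_asymp
  have fl: "real (nat \<lfloor>x * 2 ^ m\<rfloor>) = of_int \<lfloor>x * 2 ^ m\<rfloor>" for m using that by simp
  show "\<forall>\<^sub>F m in sequentially. x - 1 / 2 ^ m \<le> real (nat \<lfloor>x * 2 ^ m\<rfloor>) / 2 ^ m"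
  proof (intro always_eventually allI)
    fix m
    have "x * 2 ^ m \<le> of_int \<lfloor>x * 2 ^ m\<rfloor> + 1" by linarith
    then have "x \<le> (of_int \<lfloor>x * 2 ^ m\<rfloor> + 1) / 2 ^ m" by (simp add: pos_le_divide_eq)
    then show "x - 1 / 2 ^ m \<le> real (nat \<lfloor>x * 2 ^ m\<rfloor>) / 2 ^ m"
      unfolding fl by (simp add: add_divide_distrib)
  qed
  show "\<forall>\<^sub>F m in sequentially. real (nat \<lfloor>x * 2 ^ m\<rfloor>) / 2 ^ m \<le> x"
    unfolding fl by (intro always_eventually allI) (simp add: field_simps)
qed simp

lemma floor_dyadic_le: "real (nat \<lfloor>x * 2 ^ m\<rfloor>) / 2 ^ m \<le> x" if "x \<ge> 0" for x :: real
proof -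
  have "real (nat \<lfloor>x * 2 ^ m\<rfloor>) = of_int \<lfloor>x * 2 ^ m\<rfloor>" using that by simp
  then show ?thesis by (simp add: field_simps)
qed

lemma eventually_floor_dyadic_le: "\<forall>\<^sub>F m in sequentially. nat \<lfloor>x * 2 ^ m\<rfloor> \<le> 4 ^ m" if "x \<ge> 0" for x :: real
proof -
  have "\<forall>\<^sub>F m::nat in sequentially. x \<le> 2 ^ m" by real_asymp
  then show ?thesis
  proof eventually_elim
    case (elim m)
    have "real (nat \<lfloor>x * 2 ^ m\<rfloor>) \<le> x * 2 ^ m" using floor_dyadic_le[OF that, of m] by (simp add: field_simps)
    also have "\<dots> \<le> 2 ^ m * 2 ^ m" using elim by simp
    also have "\<dots> = real (4 ^ m)" by (simp flip: power_mult_distrib)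
    finally show ?case by (simp only: of_nat_le_iff)
  qed
qed

text \<open>By continuity each value at \<open>s \<le> 0\<close> is a limit of values on finer
  grids, whose range also grows to the left. The uniform bound \<open>K\<close> thus passes to all
  \<open>s\<close>, which makes the real-valued supremum meaningful, and the grid maxima converge to
  it from below.\<close>

lemma workload_0_dyadic:
  fixes b :: "real \<Rightarrow> real"
  assumes cont: "continuous_on UNIV b"
    and q: "\<And>m. q m = Max ((\<lambda>k. b 0 - b (- (real k / 2 ^ m)) - c * (real k / 2 ^ m)) ` {..4 ^ m})"
    and K: "\<And>m. q m \<le> K"
  shows "bdd_above ((\<lambda>s. b 0 - b s - c * (0 - s)) ` {..0})"
    and "q \<longlonglongrightarrow> workload c b 0" and "q m \<le> workload c b 0"
proof -
  let ?g = "\<lambda>s. b 0 - b s - c * (0 - s)"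
  have gq: "?g (- (real k / 2 ^ m)) \<le> q m" if "k \<le> 4 ^ m" for k m
    unfolding q using that by (intro Max_ge) auto
  have app: "(\<lambda>m. ?g (- (real (nat \<lfloor>- s * 2 ^ m\<rfloor>) / 2 ^ m))) \<longlonglongrightarrow> ?g s" if "s \<le> 0" for s
  proof -
    have "(\<lambda>m. - (real (nat \<lfloor>- s * 2 ^ m\<rfloor>) / 2 ^ m)) \<longlonglongrightarrow> - (- s)"
      using that by (intro tendsto_minus floor_dyadic_tendsto) simp
    moreover have "isCont ?g s"
      using cont by (auto intro!: continuous_intros simp: continuous_on_eq_continuous_at)
    ultimately show ?thesis by (intro isCont_tendsto_compose[where g="?g"]) auto
  qed
  have "?g s \<le> K" if "s \<le> 0" for s
  proof (rule tendsto_upperbound[OF app[OF that]])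
    have "\<forall>\<^sub>F m in sequentially. nat \<lfloor>- s * 2 ^ m\<rfloor> \<le> 4 ^ m"
      using that by (intro eventually_floor_dyadic_le) simp
    then show "\<forall>\<^sub>F m in sequentially. ?g (- (real (nat \<lfloor>- s * 2 ^ m\<rfloor>) / 2 ^ m)) \<le> K"
      by eventually_elim (rule order_trans[OF gq K])
  qed simp
  then show bdd: "bdd_above (?g ` {..0})" by (intro bdd_aboveI2) auto
  show le: "q m \<le> workload c b 0" for m
  proof -
    have "q m \<in> (\<lambda>k. b 0 - b (- (real k / 2 ^ m)) - c * (real k / 2 ^ m)) ` {..4 ^ m}"
      unfolding q by (intro Max_in) auto
    then obtain k where "q m = ?g (- (real k / 2 ^ m))" by auto
    also have "\<dots> \<le> workload c b 0"
      unfolding workload_def by (rule cSUP_upper[OF _ bdd]) simp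
    finally show ?thesis .
  qed
  show "q \<longlonglongrightarrow> workload c b 0"
  proof (rule order_tendstoI)
    fix a assume "a < workload c b 0"
    then obtain s where s: "s \<le> 0" "a < ?g s"
      unfolding workload_def by (subst (asm) less_cSUP_iff[OF _ bdd]) auto
    have "\<forall>\<^sub>F m in sequentially. a < ?g (- (real (nat \<lfloor>- s * 2 ^ m\<rfloor>) / 2 ^ m))"
      by (rule order_tendstoD[OF app]) fact+
    moreover have "\<forall>\<^sub>F m in sequentially. nat \<lfloor>- s * 2 ^ m\<rfloor> \<le> 4 ^ m"
      using s by (intro eventually_floor_dyadic_le) simp
    ultimately show "\<forall>\<^sub>F m in sequentially. a < q m"
      by eventually_elim (rule less_le_trans[OF _ gq])
  next
    fix a assume "workload c b 0 < a"
    then show "\<forall>\<^sub>F m in sequentially. q m < a"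
      by (intro always_eventually allI le_less_trans[OF le])
  qed
qed

text \<open>For \<open>0 < s \<le> t\<close> the competitor at \<open>s\<close> in the supremum
  equals \<open>X t - X s\<close>, which is at most \<open>X t\<close> as long as \<open>X\<close>
  has not gone below 0. So up to the first zero the supremum is governed by \<open>s \<le> 0\<close>
  alone. The assumption \<open>hit\<close> keeps the set under the infimum nonempty.\<close>

lemma workload_first_zero:
  fixes b :: "real \<Rightarrow> real"
  assumes cont: "continuous_on UNIV b"
    and bdd: "bdd_above ((\<lambda>s. b 0 - b s - c * (0 - s)) ` {..0})"
    and hit: "t\<^sub>1 \<ge> 0" "workload c b 0 + (b t\<^sub>1 - b 0 - c * t\<^sub>1) \<le> 0"
  defines "X \<equiv> \<lambda>t. workload c b 0 + (b t - b 0 - c * t)"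
  obtains \<tau> where "\<tau> \<ge> 0" "first_zero_time (workload c b) = \<tau>" "X \<tau> = 0"
    "\<And>t. 0 \<le> t \<Longrightarrow> t < \<tau> \<Longrightarrow> X t > 0" "\<And>t. 0 \<le> t \<Longrightarrow> t \<le> \<tau> \<Longrightarrow> workload c b t = X t"
proof -
  let ?g = "\<lambda>s. b 0 - b s - c * (0 - s)"
  have cX: "continuous_on S X" for S
    unfolding X_def using continuous_on_subset[OF cont] by (auto intro!: continuous_intros)
  have w0: "workload c b 0 = (SUP s\<in>{..0}. ?g s)" by (simp add: workload_def)
  have g_le: "?g s \<le> workload c b 0" if "s \<le> 0" for s
    unfolding w0 using that by (intro cSUP_upper bdd) auto
  have X0: "X 0 \<ge> 0" using g_le[of 0] by (simp add: X_def)
  let ?S = "{t. 0 \<le> t \<and> X t \<le> 0}"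
  define \<tau> where "\<tau> = Inf ?S"
  have ne: "?S \<noteq> {}" using hit by (auto simp: X_def)
  have bb: "bdd_below ?S" by (rule bdd_belowI[of _ 0]) auto
  have "closed ?S"
    by (intro closed_Collect_conj closed_Collect_le continuous_on_const continuous_on_id cX)
  from closed_contains_Inf[OF ne bb this] have \<tau>: "0 \<le> \<tau>" "X \<tau> \<le> 0" by (auto simp: \<tau>_def)
  have before: "X t > 0" if "0 \<le> t" "t < \<tau>" for t
    using that cInf_lower[OF _ bb, of t] unfolding \<tau>_def by fastforce
  \<comment> \<open>Positivity before \<tau> passes to the left limit; for \<open>\<tau> = 0\<close>
    the competitor \<open>s = 0\<close> in the supremum gives the sign.\<close>
  have "X \<tau> \<ge> 0"
  proof (cases "\<tau> = 0")
    case False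
    then have pos: "\<tau> > 0" using \<tau> by simp
    show ?thesis
    proof (rule tendsto_lowerbound)
      show "(X \<longlongrightarrow> X \<tau>) (at_left \<tau>)"
        using cX[of UNIV] by (auto simp: continuous_on_def intro: tendsto_mono[OF at_le])
      show "\<forall>\<^sub>F t in at_left \<tau>. 0 \<le> X t"
        unfolding eventually_at_left[OF pos] using before by (intro exI[of _ 0]) (auto simp: pos less_imp_le)
    qed simp
  qed (use X0 in simp)
  with \<tau> have X\<tau>: "X \<tau> = 0" by simp
  have W: "workload c b t = X t" if t: "0 \<le> t" "t \<le> \<tau>" for t
  proof -
    let ?h = "\<lambda>s. b t - b s - c * (t - s)"
    have h: "?h s \<le> X t" if "s \<le> t" for s
    proof (cases "s \<le> 0")
      case True
      then show ?thesis using g_le[OF True] by (simp add: X_def algebra_simps)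
    next
      case False
      then have "X s \<ge> 0" using before[of s] X\<tau> that t by (cases "s = \<tau>") auto
      then show ?thesis by (simp add: X_def algebra_simps)
    qed
    have bddh: "bdd_above (?h ` {..t})" using h by (intro bdd_aboveI2) auto
    show ?thesis
    proof (rule antisym)
      show "workload c b t \<le> X t"
        unfolding workload_def using h by (intro cSUP_least) auto
      have "(SUP s\<in>{..0}. ?g s) \<le> workload c b t - (b t - b 0 - c * t)"
      proof (rule cSUP_least)
        fix s :: real assume "s \<in> {..0}"
        then have "?h s \<le> workload c b t"
          unfolding workload_def using t by (intro cSUP_upper bddh) auto
        then show "?g s \<le> workload c b t - (b t - b 0 - c * t)" by (simp add: algebra_simps)
      qed simp
      then show "X t \<le> workload c b t" unfolding X_def w0 by simp
    qed
  qed
  have "first_zero_time (workload c b) = \<tau>"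
    unfolding first_zero_time_def
  proof (rule cInf_eq_minimum)
    show "\<tau> \<in> {t. 0 \<le> t \<and> workload c b t = 0}" using W[of \<tau>] X\<tau> \<tau> by simp
    fix t assume "t \<in> {t. 0 \<le> t \<and> workload c b t = 0}"
    then show "\<tau> \<le> t" using W[of t] before[of t] by (cases "t < \<tau>") auto
  qed
  with \<tau> X\<tau> before W that show thesis by blast
qed

section \<open>Convergence of discrete areas and exit times along one path\<close>

lemma riemann_sum_integral_diff:
  fixes X :: "real \<Rightarrow> real"
  assumes cont: "continuous_on {0..\<tau>} X" and "h > 0"
    and osc: "\<And>s t. s \<in> {0..\<tau>} \<Longrightarrow> t \<in> {0..\<tau>} \<Longrightarrow> \<bar>s - t\<bar> \<le> h \<Longrightarrow> \<bar>X s - X t\<bar> \<le> e"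
    and "real n * h \<le> \<tau>"
  shows "\<bar>h * (\<Sum>k<n. X (real k * h)) - integral {0..real n * h} X\<bar> \<le> real n * h * e"
  using assms(4)
proof (induction n)
  case (Suc n)
  let ?a = "real n * h" and ?b = "real (Suc n) * h"
  have ab: "0 \<le> ?a" "?a \<le> ?b" "?b - ?a = h" "?b \<le> \<tau>" using \<open>h > 0\<close> Suc.prems by (auto simp: algebra_simps)
  have int: "X integrable_on {s..t}" if "0 \<le> s" "t \<le> \<tau>" for s t
    by (rule integrable_continuous_interval[OF continuous_on_subset[OF cont]]) (use that in auto)
  have "\<bar>integral {?a..?b} X - h * X ?a\<bar> = \<bar>integral {?a..?b} (\<lambda>t. X t - X ?a)\<bar>"
    using ab int by (subst Henstock_Kurzweil_Integration.integral_diff) (auto simp: algebra_simps)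
  also have "\<dots> \<le> e * (?b - ?a)"
    unfolding real_norm_def[symmetric]
  proof (rule integral_bound)
    show "continuous_on {?a..?b} (\<lambda>t. X t - X ?a)"
      by (intro continuous_intros continuous_on_subset[OF cont]) (use ab(1,4) in auto)
    fix t assume t: "t \<in> {?a..?b}"
    have "\<bar>t - ?a\<bar> \<le> h" "t \<in> {0..\<tau>}" "?a \<in> {0..\<tau>}"
      using ab t unfolding atLeastAtMost_iff by linarith+
    then show "norm (X t - X ?a) \<le> e"
      unfolding real_norm_def by (intro osc)
  qed (use ab in simp)
  finally have 1: "\<bar>integral {?a..?b} X - h * X ?a\<bar> \<le> e * h" using ab by simp
  have 2: "integral {0..?b} X = integral {0..?a} X + integral {?a..?b} X"
    using ab int by (intro Henstock_Kurzweil_Integration.integral_combine[symmetric]) auto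
  have 3: "\<bar>h * (\<Sum>k<n. X (real k * h)) - integral {0..?a} X\<bar> \<le> ?a * e"
    using Suc ab by simp
  have "real (Suc n) * h * e = ?a * e + e * h" by (simp add: algebra_simps)
  moreover have "h * (\<Sum>k<Suc n. X (real k * h)) = h * (\<Sum>k<n. X (real k * h)) + h * X ?a"
    by (simp add: algebra_simps)
  ultimately show ?case using 1 2 3 by linarith
qed simp

text \<open>The discrete exit time tends to \<tau>: it is at most \<tau>, because at the grid point
  next to \<tau> the walk is already below the level, and it eventually exceeds any
  \<open>t < \<tau>\<close>, because \<open>X\<close> has a positive minimum on
  \<open>{0..t}\<close>. Riemann sums then give the area, and the bound on \<open>u\<close> handles
  the exit position, which tends to 0.\<close>

lemma stopped_value_nested_limit:
  fixes X :: "real \<Rightarrow> real" and Y :: "nat \<Rightarrow> nat \<Rightarrow> 'a \<Rightarrow> real"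
  assumes cont: "continuous_on UNIV X" and \<tau>: "\<tau> \<ge> 0" "X \<tau> = 0"
    and before: "\<And>t. 0 \<le> t \<Longrightarrow> t < \<tau> \<Longrightarrow> X t > 0"
    and q: "q \<longlonglongrightarrow> 0" "\<And>m. 0 \<le> q m"
    and Y: "\<And>m k. Y m k \<omega> = X (real k / 2 ^ m) - q m"
    and u: "\<And>m x. \<bar>u m x - u0\<bar> \<le> e m + K * \<bar>x\<bar>" "e \<longlonglongrightarrow> 0"
  shows "((\<lambda>(j, m). stopped_value (u m) (\<lambda>x. exp (- \<gamma> * (1 / 2 ^ m) * x)) {1 / real (Suc j)<..} (Y m) (4 ^ m) \<omega>)
    \<longlongrightarrow> exp (- \<gamma> * integral {0..\<tau>} X) * u0) nested_sequentially"
proof -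
  let ?F = "nested_sequentially" and ?\<epsilon> = "\<lambda>j. 1 / real (Suc j)"
  define N where "N p = (LEAST k. Y (snd p) k \<omega> \<le> ?\<epsilon> (fst p))" for p
  define T where "T p = real (N p) / 2 ^ snd p" for p
  have Xt: "(X \<longlongrightarrow> X t) (at t)" for t
    using cont by (auto simp: continuous_on_def)
  have upper: "\<forall>\<^sub>F p in ?F. Y (snd p) (N p) \<omega> \<le> ?\<epsilon> (fst p) \<and> T p \<le> \<tau> \<and> N p \<le> 4 ^ snd p"
    unfolding eventually_nested_sequentially
  proof (rule always_eventually, rule allI)
    fix j
    \<comment> \<open>Index of the last grid point not after \<tau>; the discrete exit occurs no
      later.\<close>
    let ?k = "\<lambda>m. nat \<lfloor>\<tau> * 2 ^ m\<rfloor>"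
    have "(\<lambda>m. X (real (?k m) / 2 ^ m)) \<longlonglongrightarrow> X \<tau>"
      using Xt[of \<tau>] floor_dyadic_tendsto[OF \<tau>(1)]
      by (intro isCont_tendsto_compose[where g=X]) (simp add: isCont_def)
    then have "\<forall>\<^sub>F m in sequentially. X (real (?k m) / 2 ^ m) < ?\<epsilon> j"
      using \<tau> by (intro order_tendstoD(2)) auto
    with eventually_floor_dyadic_le[OF \<tau>(1)]
    show "\<forall>\<^sub>F m in sequentially. Y (snd (j, m)) (N (j, m)) \<omega> \<le> ?\<epsilon> (fst (j, m)) \<and> T (j, m) \<le> \<tau> \<and> N (j, m) \<le> 4 ^ snd (j, m)"
    proof eventually_elim
      case (elim m)
      have *: "Y m (?k m) \<omega> \<le> ?\<epsilon> j" using elim(2) q(2)[of m] unfolding Y by linarith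
      have "Y m (N (j, m)) \<omega> \<le> ?\<epsilon> j"
        unfolding N_def fst_conv snd_conv by (rule LeastI[of "\<lambda>k. Y m k \<omega> \<le> ?\<epsilon> j", OF *])
      moreover have Nk: "N (j, m) \<le> ?k m"
        unfolding N_def fst_conv snd_conv by (rule Least_le[of "\<lambda>k. Y m k \<omega> \<le> ?\<epsilon> j", OF *])
      moreover have "T (j, m) \<le> \<tau>"
        using Nk floor_dyadic_le[OF \<tau>(1), of m] unfolding T_def snd_conv
        by (elim order_trans[rotated]) (simp add: divide_right_mono)
      ultimately show ?case using order_trans[OF Nk elim(1)] by simp
    qed
  qed
  have lower: "\<forall>\<^sub>F p in ?F. t < T p" if "t < \<tau>" for t
  proof (cases "t < 0")
    case True
    then have "t < T p" for p unfolding T_def by (rule less_le_trans) simp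
    then show ?thesis by simp
  next
    case False
    have "\<exists>s\<in>{0..t}. \<forall>r\<in>{0..t}. X s \<le> X r"
      using False continuous_on_subset[OF cont] by (intro continuous_attains_inf) auto
    then obtain s where s: "s \<in> {0..t}" "\<And>r. r \<in> {0..t} \<Longrightarrow> X s \<le> X r" by blast
    have \<mu>: "X s > 0" using s(1) that by (intro before) auto
    have "(\<lambda>j. ?\<epsilon> j) \<longlonglongrightarrow> 0" by real_asymp
    then have "\<forall>\<^sub>F j in sequentially. ?\<epsilon> j < X s / 2" using \<mu> by (intro order_tendstoD(2)) auto
    moreover have m: "\<forall>\<^sub>F m in sequentially. q m < X s / 2" using \<mu> q(1) by (intro order_tendstoD(2)) auto
    ultimately have "\<forall>\<^sub>F p in ?F. ?\<epsilon> (fst p) < X s / 2 \<and> q (snd p) < X s / 2"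
      unfolding eventually_nested_sequentially by (auto elim!: eventually_mono)
    with upper show ?thesis
    proof eventually_elim
      case (elim p)
      show "t < T p"
      proof (rule ccontr)
        assume "\<not> t < T p"
        then have "X s \<le> X (T p)" by (intro s(2)) (simp add: T_def)
        then show False using elim unfolding Y T_def by linarith
      qed
    qed
  qed
  have T: "(T \<longlongrightarrow> \<tau>) ?F"
  proof (rule order_tendstoI)
    show "\<forall>\<^sub>F p in ?F. T p < a" if "\<tau> < a" for a
      using upper by eventually_elim (use that in auto)
  qed (rule lower)
  have q': "((\<lambda>p. q (snd p)) \<longlongrightarrow> 0) ?F"
    using q(1) filterlim_snd_nested_sequentially by (rule filterlim_compose)
  have e': "((\<lambda>p. e (snd p)) \<longlongrightarrow> 0) ?F"
    using u(2) filterlim_snd_nested_sequentially by (rule filterlim_compose)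
  have XT: "((\<lambda>p. X (T p)) \<longlongrightarrow> X \<tau>) ?F"
    using Xt[of \<tau>] T by (intro isCont_tendsto_compose[where g=X]) (simp_all add: isCont_def)
  have YN: "((\<lambda>p. Y (snd p) (N p) \<omega>) \<longlongrightarrow> 0) ?F"
    using tendsto_diff[OF XT q'] \<tau>(2) unfolding Y T_def by simp
  have uN: "((\<lambda>p. u (snd p) (Y (snd p) (N p) \<omega>)) \<longlongrightarrow> u0) ?F"
  proof (rule LIM_zero_cancel)
    show "((\<lambda>p. u (snd p) (Y (snd p) (N p) \<omega>) - u0) \<longlongrightarrow> 0) ?F"
    proof (rule Lim_null_comparison)
      show "((\<lambda>p. e (snd p) + K * \<bar>Y (snd p) (N p) \<omega>\<bar>) \<longlongrightarrow> 0) ?F"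
        using tendsto_add[OF e' tendsto_mult_left[OF tendsto_rabs_zero[OF YN], of K]] by simp
    qed (use u(1) in auto)
  qed
  have Sint: "((\<lambda>p. 1 / 2 ^ snd p * (\<Sum>k<N p. Y (snd p) k \<omega>)) \<longlongrightarrow> integral {0..\<tau>} X) ?F"
  proof (rule Lim_transform2)
    have cont_int: "continuous_on {0..\<tau>} (\<lambda>t. integral {0..t} X)"
      by (intro indefinite_integral_continuous_1 integrable_continuous_interval continuous_on_subset[OF cont]) auto
    show I: "((\<lambda>p. integral {0..T p} X) \<longlongrightarrow> integral {0..\<tau>} X) ?F"
    proof (rule continuous_on_tendsto_compose[OF cont_int T])
      show "\<forall>\<^sub>F p in ?F. T p \<in> {0..\<tau>}"
        using upper by eventually_elim (auto simp: T_def)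
    qed (use \<tau> in auto)
    show "((\<lambda>p. integral {0..T p} X - 1 / 2 ^ snd p * (\<Sum>k<N p. Y (snd p) k \<omega>)) \<longlongrightarrow> 0) ?F"
    proof (rule tendstoI)
      fix r :: real assume r: "r > 0"
      \<comment> \<open>Half of the tolerance goes to the oscillation of \<open>X\<close> over one
        cell, accumulated over a time of at most \<tau>, the other half to the displacement
        \<open>q\<close>; the \<open>+ 1\<close> covers \<open>\<tau> = 0\<close>.\<close>
      define d where "d = r / (2 * (\<tau> + 1))"
      have d: "d > 0" "\<tau> * d < r / 2" using r \<tau> by (auto simp: d_def field_simps)
      have "uniformly_continuous_on {0..\<tau>} X"
        by (rule compact_uniformly_continuous[OF continuous_on_subset[OF cont]]) auto
      then obtain \<delta> where \<delta>: "\<delta> > 0"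
        "\<And>s t. s \<in> {0..\<tau>} \<Longrightarrow> t \<in> {0..\<tau>} \<Longrightarrow> \<bar>s - t\<bar> < \<delta> \<Longrightarrow> \<bar>X s - X t\<bar> < d"
        using d(1) unfolding uniformly_continuous_on_def dist_real_def by (metis abs_minus_commute)
      have "(\<lambda>m::nat. 1 / 2 ^ m :: real) \<longlonglongrightarrow> 0" by real_asymp
      then have "((\<lambda>p. 1 / 2 ^ snd p :: real) \<longlongrightarrow> 0) ?F"
        using filterlim_snd_nested_sequentially by (rule filterlim_compose)
      then have "\<forall>\<^sub>F p in ?F. (1 / 2 ^ snd p :: real) < \<delta>" using \<delta>(1) by (rule order_tendstoD)
      moreover have "((\<lambda>p. \<tau> * q (snd p)) \<longlongrightarrow> 0) ?F" using tendsto_mult_left[OF q', of \<tau>] by simp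
      then have "\<forall>\<^sub>F p in ?F. \<tau> * q (snd p) < r / 2" using r by (intro order_tendstoD(2)) auto
      ultimately show "\<forall>\<^sub>F p in ?F. dist (integral {0..T p} X - 1 / 2 ^ snd p * (\<Sum>k<N p. Y (snd p) k \<omega>)) 0 < r"
        using upper
      proof eventually_elim
        case (elim p)
        let ?h = "1 / 2 ^ snd p :: real"
        have Th: "real (N p) * ?h = T p" by (simp add: T_def)
        have "\<bar>?h * (\<Sum>k<N p. X (real k * ?h)) - integral {0..real (N p) * ?h} X\<bar> \<le> real (N p) * ?h * d"
        proof (rule riemann_sum_integral_diff[OF continuous_on_subset[OF cont]])
          fix s t assume "s \<in> {0..\<tau>}" "t \<in> {0..\<tau>}" "\<bar>s - t\<bar> \<le> ?h"
          then show "\<bar>X s - X t\<bar> \<le> d" using \<delta>(2)[of s t] elim(1) by linarith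
        qed (use elim Th in auto)
        moreover have "real (N p) * ?h * d \<le> \<tau> * d"
          unfolding Th using elim d by (intro mult_right_mono) auto
        moreover have "?h * (\<Sum>k<N p. Y (snd p) k \<omega>) = ?h * (\<Sum>k<N p. X (real k * ?h)) - T p * q (snd p)"
          unfolding Y by (simp add: sum_subtractf right_diff_distrib T_def)
        moreover have "T p * q (snd p) \<le> \<tau> * q (snd p)"
          using elim q(2) by (intro mult_right_mono) auto
        moreover have "0 \<le> T p * q (snd p)" using q(2) by (simp add: T_def)
        ultimately show ?case using elim(2) d(2) unfolding Th dist_real_def by linarith
      qed
    qed
  qed
  have "((\<lambda>p. exp (- \<gamma> * (1 / 2 ^ snd p * (\<Sum>k<N p. Y (snd p) k \<omega>))) * u (snd p) (Y (snd p) (N p) \<omega>)) \<longlongrightarrow>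
      exp (- \<gamma> * integral {0..\<tau>} X) * u0) ?F"
    by (intro tendsto_intros Sint uN)
  moreover have "\<forall>\<^sub>F p in ?F. exp (- \<gamma> * (1 / 2 ^ snd p * (\<Sum>k<N p. Y (snd p) k \<omega>))) * u (snd p) (Y (snd p) (N p) \<omega>) =
      (case p of (j, m) \<Rightarrow> stopped_value (u m) (\<lambda>x. exp (- \<gamma> * (1 / 2 ^ m) * x)) {?\<epsilon> j<..} (Y m) (4 ^ m) \<omega>)"
    using upper
  proof eventually_elim
    case (elim p)
    obtain j m where p: "p = (j, m)" by (cases p)
    have "stopped_value (u m) (\<lambda>x. exp (- \<gamma> * (1 / 2 ^ m) * x)) {?\<epsilon> j<..} (Y m) (4 ^ m) \<omega> =
        (\<Prod>k<N p. exp (- \<gamma> * (1 / 2 ^ m) * Y m k \<omega>)) * u m (Y m (N p) \<omega>)"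
    proof (rule stopped_value_exit)
      fix k assume "k < N p"
      then show "Y m k \<omega> \<in> {?\<epsilon> j<..}"
        unfolding N_def p fst_conv snd_conv by (auto dest!: not_less_Least)
    qed (use elim p in auto)
    also have "(\<Prod>k<N p. exp (- \<gamma> * (1 / 2 ^ m) * Y m k \<omega>)) = exp (- \<gamma> * (1 / 2 ^ m * (\<Sum>k<N p. Y m k \<omega>)))"
      by (simp add: exp_sum[symmetric] sum_distrib_left sum_divide_distrib sum_negf)
    finally show ?case by (simp add: p)
  qed
  ultimately show ?thesis by (rule Lim_transform_eventually)
qed

section \<open>The area identity\<close>

lemma stopped_value_minus:
  "stopped_value (\<lambda>x. - f x) w A X n \<omega> = - stopped_value f w A X n \<omega>"
  by (simp add: stopped_value_def sum_negf)

context two_sided_brownian_motion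
begin

text \<open>The grids are nested: index \<open>k\<close> becomes \<open>2 * k\<close> on the next
  mesh, which also reaches further back.\<close>

lemma past_max_mono: "past_max c m \<omega> \<le> past_max c (Suc m) \<omega>"
proof -
  have "past_walk c m k \<omega> \<le> past_max c (Suc m) \<omega>" if "k \<le> 4 ^ m" for k
  proof -
    have "real (2 * k) / 2 ^ Suc m = real k / 2 ^ m" by simp
    then have "past_walk c m k \<omega> = past_walk c (Suc m) (2 * k) \<omega>"
      unfolding past_walk_def by (simp only:)
    moreover have "2 * k \<le> 4 ^ Suc m" using that by simp
    ultimately show ?thesis using past_walk_le_past_max[of "2 * k" "Suc m" c \<omega>] by simp
  qed
  then show ?thesis unfolding past_max_def[of c m] by (intro Max.boundedI) auto
qed

text \<open>The exceedance bound does not depend on \<open>m\<close> and the maxima grow with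
  \<open>m\<close>, so it holds for their supremum as well; then the level tends to
  infinity.\<close>

lemma AE_past_max_bounded:
  assumes "c > 0"
  shows "AE \<omega> in M. \<exists>K. \<forall>m. past_max c m \<omega> \<le> K"
proof -
  let ?U = "\<lambda>K::nat. {\<omega> \<in> space M. \<exists>m. real K < past_max c m \<omega>}"
  have U: "prob (?U K) \<le> exp (- 2 * c * real K)" for K
  proof -
    let ?A = "\<lambda>m. {\<omega> \<in> space M. real K < past_max c m \<omega>}"
    have "incseq ?A" by (rule incseq_SucI) (auto intro: less_le_trans past_max_mono)
    then have "(\<lambda>m. prob (?A m)) \<longlonglongrightarrow> prob (\<Union>m. ?A m)"
      by (intro finite_Lim_measure_incseq) auto
    moreover have "(\<Union>m. ?A m) = ?U K" by auto
    ultimately have "(\<lambda>m. prob (?A m)) \<longlonglongrightarrow> prob (?U K)" by simp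
    then show ?thesis
      by (rule tendsto_upperbound) (use prob_past_max_gt_le[OF assms, of "real K"] in auto)
  qed
  have N: "{\<omega> \<in> space M. \<forall>K::nat. \<exists>m. real K < past_max c m \<omega>} \<in> events" by measurable
  have "prob {\<omega> \<in> space M. \<forall>K::nat. \<exists>m. real K < past_max c m \<omega>} \<le> exp (- 2 * c * real K)" for K :: nat
    by (rule order_trans[OF finite_measure_mono U[of K]]) auto
  moreover have "(\<lambda>K. exp (- 2 * c * real K)) \<longlonglongrightarrow> 0" using assms by real_asymp
  ultimately have "prob {\<omega> \<in> space M. \<forall>K::nat. \<exists>m. real K < past_max c m \<omega>} \<le> 0"
    by (intro tendsto_lowerbound[OF _ always_eventually]) auto
  then have "prob {\<omega> \<in> space M. \<forall>K::nat. \<exists>m. real K < past_max c m \<omega>} = 0"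
    by (simp add: measure_le_0_iff)
  then have "AE \<omega> in M. \<not> (\<forall>K::nat. \<exists>m. real K < past_max c m \<omega>)"
    using N by (intro AE_I[OF _ _ N]) (auto simp: emeasure_eq_measure)
  then show ?thesis
    by eventually_elim (metis not_less)
qed

text \<open>Exponential Markov inequality at integer times, with exponent \<open>c\<close>, for
  which the bound decays in \<open>n\<close>. It ensures that the path started at any finite initial
  workload reaches 0.\<close>

lemma AE_drift_unbounded_below:
  assumes "c > 0"
  shows "AE \<omega> in M. \<forall>K::nat. \<exists>n::nat. B (real n) \<omega> - B 0 \<omega> - c * real n < - real K"
proof (unfold AE_all_countable, intro allI)
  fix K :: nat
  note measurable_B [measurable]
  let ?A = "{\<omega> \<in> space M. \<forall>n::nat. - real K \<le> B (real n) \<omega> - B 0 \<omega> - c * real n}"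
  have bound: "prob ?A \<le> exp (c * real K - c\<^sup>2 * real n / 2)" if "n > 0" for n :: nat
  proof -
    have D: "distributed M lborel (\<lambda>\<omega>. B (real n) \<omega> - B 0 \<omega>) (normal_density 0 (sqrt (real n)))"
      using normal_increments[of 0 "real n"] that by simp
    have "has_bochner_integral lborel (\<lambda>z. normal_density 0 (sqrt (real n)) z * exp (c * z))
        (exp (c * 0 + c\<^sup>2 * (sqrt (real n))\<^sup>2 / 2))"
      using that by (intro normal_mgf) simp
    then have mgf: "integrable lborel (\<lambda>z. normal_density 0 (sqrt (real n)) z * exp (c * z))"
      "(\<integral>z. normal_density 0 (sqrt (real n)) z * exp (c * z) \<partial>lborel) = exp (c\<^sup>2 * real n / 2)"
      by (auto simp: has_bochner_integral_iff)
    have int: "integrable M (\<lambda>\<omega>. exp (c * (B (real n) \<omega> - B 0 \<omega>)))"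
      by (subst distributed_integrable[OF D, of "\<lambda>z. exp (c * z)", symmetric]) (use mgf in auto)
    have val: "expectation (\<lambda>\<omega>. exp (c * (B (real n) \<omega> - B 0 \<omega>))) = exp (c\<^sup>2 * real n / 2)"
      by (subst distributed_integral[OF D, of "\<lambda>z. exp (c * z)", symmetric]) (use mgf in auto)
    have "prob ?A = expectation (indicator ?A)" by simp
    also have "\<dots> \<le> expectation (\<lambda>\<omega>. exp (c * real K - c\<^sup>2 * real n) * exp (c * (B (real n) \<omega> - B 0 \<omega>)))"
    proof (rule integral_mono)
      show "integrable M (indicator ?A :: 'a \<Rightarrow> real)"
        by (auto simp: integrable_indicator_iff less_top[symmetric])
      fix \<omega>
      show "indicator ?A \<omega> \<le> exp (c * real K - c\<^sup>2 * real n) * exp (c * (B (real n) \<omega> - B 0 \<omega>))"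
      proof (cases "\<omega> \<in> ?A")
        case True
        then have "0 \<le> c * (real K + (B (real n) \<omega> - B 0 \<omega> - c * real n))"
          using assms by (intro mult_nonneg_nonneg) (auto dest: spec[of _ n])
        then have "1 \<le> exp (c * (real K + (B (real n) \<omega> - B 0 \<omega> - c * real n)))" by simp
        also have "\<dots> = exp (c * real K - c\<^sup>2 * real n) * exp (c * (B (real n) \<omega> - B 0 \<omega>))"
          unfolding exp_add[symmetric] by (simp add: algebra_simps power2_eq_square)
        finally show ?thesis using True by simp
      qed simp
    qed (use int in simp)
    also have "\<dots> = exp (c * real K - c\<^sup>2 * real n) * exp (c\<^sup>2 * real n / 2)"
      by (simp only: integral_mult_right_zero val)
    also have "\<dots> = exp (c * real K - c\<^sup>2 * real n / 2)"
      unfolding exp_add[symmetric] by simp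
    finally show ?thesis .
  qed
  have "(\<lambda>n::nat. exp (c * real K - c\<^sup>2 * real n / 2)) \<longlonglongrightarrow> 0"
    using assms by real_asymp
  moreover have "\<forall>\<^sub>F n in sequentially. prob ?A \<le> exp (c * real K - c\<^sup>2 * real n / 2)"
    using eventually_gt_at_top[of 0] by eventually_elim (rule bound)
  ultimately have "prob ?A \<le> 0" by (rule tendsto_lowerbound) simp
  then have "prob ?A = 0" by (simp add: measure_le_0_iff)
  then show "AE \<omega> in M. \<exists>n::nat. B (real n) \<omega> - B 0 \<omega> - c * real n < - real K"
    by (intro AE_I[where N="?A"]) (auto simp: emeasure_eq_measure not_less)
qed

text \<open>Equality results from applying the stopping inequality to \<open>u\<close> and to
  \<open>- u\<close>, both with defect 0. A level \<open>\<epsilon> \<ge> 0\<close> keeps the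
  discount at most 1 in the continuation region; the mesh condition keeps the damping
  positive.\<close>

lemma future_walk_stopped_value:
  assumes "c > 0" "\<gamma> > 0" "1 / 2 ^ m < c / \<gamma>" "\<epsilon> \<ge> 0"
    and g: "g \<in> borel_measurable borel" "\<And>x. 0 \<le> g x \<and> g x \<le> 1"
  defines "u \<equiv> \<lambda>x. damped_airy (1 / (6 * \<gamma>)) (c / (2 * \<gamma>) - 1 / 2 ^ m / 4)
    (x + (c * (1 / 2 ^ m) / 2 - \<gamma> * (1 / 2 ^ m)\<^sup>2 / 12))"
  shows "expectation (\<lambda>\<omega>. g (past_max c m \<omega>) *
      stopped_value u (\<lambda>x. exp (- \<gamma> * (1 / 2 ^ m) * x)) {\<epsilon><..} (future_walk c m) (4 ^ m) \<omega>) =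
    expectation (\<lambda>\<omega>. g (past_max c m \<omega>) * u (past_max c m \<omega>))"
proof -
  define h :: real where "h = 1 / 2 ^ m"
  have h: "h > 0" "h < c / \<gamma>" "h < 2 * c / \<gamma>" using assms(1-3) by (auto simp: h_def field_simps)
  let ?w = "\<lambda>x. exp (- \<gamma> * h * x)" and ?\<alpha> = "c / (2 * \<gamma>) - h / 4"
  have \<alpha>: "?\<alpha> > 0" using h assms(1,2) by (simp add: field_simps)
  have uh: "u = (\<lambda>x. damped_airy (1 / (6 * \<gamma>)) ?\<alpha> (x + (c * h / 2 - \<gamma> * h\<^sup>2 / 12)))"
    by (simp add: u_def h_def)
  have um [measurable]: "u \<in> borel_measurable borel"
    unfolding uh using \<alpha> by (intro borel_measurable_continuous_onI continuous_intros) auto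
  have ubnd: "\<bar>u x\<bar> \<le> (\<integral>t. exp (- ?\<alpha> * t\<^sup>2) \<partial>lborel)" for x
    unfolding uh using damped_airy_bounded[OF \<alpha>] by auto
  have ustep: "?w x * (\<integral>z. normal_density (- c * h) (sqrt h) z * u (x + z) \<partial>lborel) = u x" for x
    using damped_airy_gaussian_step[OF assms(2) h(1) h(3), of x] unfolding uh
    by (simp add: add.assoc add.left_commute add.commute)
  have main: "expectation (\<lambda>\<omega>. g (past_max c m \<omega>) * f (past_max c m \<omega>)) \<le>
      expectation (\<lambda>\<omega>. g (past_max c m \<omega>) * stopped_value f ?w {\<epsilon><..} (future_walk c m) (4 ^ m) \<omega>)"
    if f: "f \<in> borel_measurable borel" "\<And>x. \<bar>f x\<bar> \<le> (\<integral>t. exp (- ?\<alpha> * t\<^sup>2) \<partial>lborel)"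
      "\<And>x. ?w x * (\<integral>z. normal_density (- c * h) (sqrt h) z * f (x + z) \<partial>lborel) = f x" for f
  proof -
    have gm: "(\<lambda>\<omega>. g (past_max c m \<omega>)) \<in> borel_measurable (generated_by M (grid_incr m) {..<4 ^ m})"
      using g(1) by (rule measurable_compose[OF borel_measurable_past_max_generated_by])
    have fw0: "future_walk c m 0 \<in> borel_measurable (generated_by M (grid_incr m) {..<4 ^ m})"
      using borel_measurable_past_max_generated_by by (simp add: future_walk_def[abs_def])
    have "expectation (\<lambda>\<omega>. g (past_max c m \<omega>) * f (future_walk c m 0 \<omega>)) - real (4 ^ m) * (1 * 0) \<le>
        expectation (\<lambda>\<omega>. g (past_max c m \<omega>) * stopped_value f ?w {\<epsilon><..} (future_walk c m) (4 ^ m) \<omega>)"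
    proof (rule gaussian_walk_stopped_value_ge[where D="grid_incr m" and I="{..<2 * 4 ^ m}" and h=h and c=c
          and J="{..<4 ^ m}" and \<iota>="\<lambda>k. 4 ^ m + k", OF indep_grid_incr _ h(1)])
      show "distributed M lborel (grid_incr m i) (normal_density 0 (sqrt h))" for i
        unfolding h_def by (rule normal_grid_incr)
      show "future_walk c m (Suc k) \<omega> = future_walk c m k \<omega> + (grid_incr m (4 ^ m + k) \<omega> - c * h)" for k \<omega>
        unfolding h_def by (rule future_walk_Suc)
      show "0 \<le> ?w x \<and> ?w x \<le> 1" if "x \<in> {\<epsilon><..}" for x
        using that assms(2,4) h(1) by simp
    qed (use f g gm fw0 borel_measurable_past_max_generated_by in auto)
    then show ?thesis by simp
  qed
  have "expectation (\<lambda>\<omega>. g (past_max c m \<omega>) * u (past_max c m \<omega>)) \<le>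
      expectation (\<lambda>\<omega>. g (past_max c m \<omega>) * stopped_value u ?w {\<epsilon><..} (future_walk c m) (4 ^ m) \<omega>)"
    by (rule main) (use ubnd ustep in auto)
  moreover have "expectation (\<lambda>\<omega>. g (past_max c m \<omega>) * - u (past_max c m \<omega>)) \<le>
      expectation (\<lambda>\<omega>. g (past_max c m \<omega>) * stopped_value (\<lambda>x. - u x) ?w {\<epsilon><..} (future_walk c m) (4 ^ m) \<omega>)"
    by (rule main) (use ubnd ustep in auto)
  ultimately show ?thesis
    unfolding stopped_value_minus h_def by simp
qed

text \<open>
  The weight \<open>g\<close> localises the identity in \<open>Q 0\<close>; a bump placed where \<open>damped_airy\<close> is
  positive then shows that its value at \<open>0\<close>, hence the denominator of the theorem, is not zero.
\<close>

lemma workload_area_identity: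
  assumes c: "c > 0" and \<gamma>: "\<gamma> > 0"
    and g: "\<And>x. isCont g x" "\<And>x. 0 \<le> g x \<and> g x \<le> 1"
  defines "Q \<equiv> \<lambda>t \<omega>. workload c (\<lambda>s. B s \<omega>) t"
  defines "D \<equiv> damped_airy (1 / (6 * \<gamma>)) (c / (2 * \<gamma>))"
  shows "(\<integral>\<omega>. g (Q 0 \<omega>) * (exp (- \<gamma> * (LBINT t:{0..first_zero_time (\<lambda>t. Q t \<omega>)}. Q t \<omega>)) * D 0) \<partial>completion M) =
    (\<integral>x. exponential_density (2 * c) x * (g x * D x) \<partial>lborel)"
proof -
  \<comment> \<open>Half of the limiting damping \<open>c / (2 * \<gamma>)\<close>, and a lower
    bound for the damping on every mesh below \<open>c / \<gamma>\<close>.\<close>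
  define \<mu> where "\<mu> = c / (4 * \<gamma>)"
  have \<mu>: "\<mu> > 0" "c / (2 * \<gamma>) \<ge> \<mu>" "c / (2 * \<gamma>) > 0" using c \<gamma> by (auto simp: \<mu>_def field_simps)
  define C where "C = (\<integral>t. exp (- \<mu> * t\<^sup>2) \<partial>lborel)"
  have C: "C \<ge> 0" unfolding C_def by (intro integral_nonneg_AE) auto
  define K1 where "K1 = (\<integral>t. exp (- \<mu> * t\<^sup>2) * \<bar>t\<bar> ^ 2 \<partial>lborel)"
  define K2 where "K2 = (\<integral>t. exp (- \<mu> * t\<^sup>2) * \<bar>t\<bar> ^ 1 \<partial>lborel)"
  have K2: "K2 \<ge> 0" unfolding K2_def by (intro integral_nonneg_AE) auto
  define \<beta> where "\<beta> m = c * (1 / 2 ^ m) / 2 - \<gamma> * (1 / 2 ^ m)\<^sup>2 / 12" for m :: nat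
  define good where "good m \<longleftrightarrow> (1 / 2 ^ m :: real) < c / \<gamma>" for m :: nat
  \<comment> \<open>The value 0 on the finitely many coarse meshes, with the matching error
    \<open>C\<close> in \<open>e\<close>, lets the bounds hold for every \<open>m\<close> and not
    only eventually.\<close>
  define u where "u m = (if good m then \<lambda>x. damped_airy (1 / (6 * \<gamma>)) (c / (2 * \<gamma>) - 1 / 2 ^ m / 4) (x + \<beta> m) else (\<lambda>x. 0))" for m
  define e where "e m = (if good m then 1 / 2 ^ m / 4 * K1 + \<bar>\<beta> m\<bar> * K2 else C)" for m
  have ev_good: "\<forall>\<^sub>F m in sequentially. good m"
  proof -
    have "(\<lambda>m::nat. 1 / 2 ^ m :: real) \<longlonglongrightarrow> 0" by real_asymp
    then show ?thesis unfolding good_def using c \<gamma> by (intro order_tendstoD) auto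
  qed
  have e: "e \<longlonglongrightarrow> 0"
  proof (rule Lim_transform_eventually)
    show "(\<lambda>m. 1 / 2 ^ m / 4 * K1 + \<bar>\<beta> m\<bar> * K2) \<longlonglongrightarrow> 0"
    proof -
      have "\<beta> \<longlonglongrightarrow> 0" unfolding \<beta>_def by real_asymp
      then have "(\<lambda>m. \<bar>\<beta> m\<bar> * K2) \<longlonglongrightarrow> 0" by (intro tendsto_mult_left_zero tendsto_rabs_zero)
      moreover have "(\<lambda>m::nat. 1 / 2 ^ m / 4 * K1) \<longlonglongrightarrow> 0" by real_asymp
      ultimately show ?thesis using tendsto_add_zero by blast
    qed
    show "\<forall>\<^sub>F m in sequentially. 1 / 2 ^ m / 4 * K1 + \<bar>\<beta> m\<bar> * K2 = e m"
      using ev_good by eventually_elim (simp add: e_def)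
  qed
  have \<alpha>: "c / (2 * \<gamma>) - 1 / 2 ^ m / 4 \<ge> \<mu>" if "good m" for m
    using that c \<gamma> unfolding good_def \<mu>_def by (simp add: field_simps)
  have Dbnd: "\<bar>D x\<bar> \<le> C" for x
    unfolding D_def C_def by (rule damped_airy_bounded) fact+
  have ubnd: "\<bar>u m x\<bar> \<le> C" for m x
    unfolding u_def C_def using damped_airy_bounded[OF \<mu>(1) \<alpha>] C by (auto simp: C_def)
  have uD: "\<bar>u m x - D y\<bar> \<le> e m + K2 * \<bar>x - y\<bar>" for m x y
  proof (cases "good m")
    case True
    have "\<bar>u m x - D y\<bar> \<le> \<bar>(c / (2 * \<gamma>) - 1 / 2 ^ m / 4) - c / (2 * \<gamma>)\<bar> * K1 + \<bar>x + \<beta> m - y\<bar> * K2"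
      using damped_airy_lipschitz[OF \<mu>(1) \<alpha>[OF True] \<mu>(2), of _ "x + \<beta> m" y] True
      unfolding u_def D_def K1_def K2_def by simp
    also have "\<bar>x + \<beta> m - y\<bar> * K2 \<le> (\<bar>\<beta> m\<bar> + \<bar>x - y\<bar>) * K2"
      by (intro mult_right_mono K2) linarith
    finally show ?thesis using True by (simp add: e_def algebra_simps)
  next
    case False
    then show ?thesis using Dbnd[of y] K2 by (simp add: u_def e_def add_increasing2)
  qed
  have Dcont: "isCont D x" for x
    using continuous_on_damped_airy[OF \<mu>(3), of UNIV "\<lambda>x. x"]
    by (simp add: D_def continuous_on_eq_continuous_at)
  have umeas [measurable]: "u m \<in> borel_measurable borel" for m
  proof (cases "good m")
    case True
    then have "c / (2 * \<gamma>) - 1 / 2 ^ m / 4 > 0" using \<alpha>[OF True] \<mu>(1) by linarith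
    then show ?thesis
      unfolding u_def using True by (auto intro!: borel_measurable_continuous_onI continuous_intros)
  qed (simp add: u_def)
  have gm [measurable]: "g \<in> borel_measurable borel"
    using g(1) by (intro borel_measurable_continuous_onI) (auto simp: continuous_on_eq_continuous_at)
  define w where "w m x = exp (- \<gamma> * (1 / 2 ^ m) * x)" for m :: nat and x :: real
  have w: "0 \<le> w m x \<and> w m x \<le> 1" if "x \<in> {1 / real (Suc j)<..}" for m x j
  proof -
    have "0 < 1 / real (Suc j)" by simp
    then have "x \<ge> 0" using that unfolding greaterThan_iff by linarith
    then show ?thesis using \<gamma> by (simp add: w_def)
  qed
  have wm [measurable]: "w m \<in> borel_measurable borel" for m
    unfolding w_def[abs_def] by measurable
  define Z where "Z j m \<omega> = g (past_max c m \<omega>) *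
      stopped_value (u m) (w m) {1 / real (Suc j)<..} (future_walk c m) (4 ^ m) \<omega>" for j m \<omega>
  have svbnd: "\<bar>stopped_value (u m) (w m) {1 / real (Suc j)<..} (future_walk c m) (4 ^ m) \<omega>\<bar> \<le> C" for j m \<omega>
    by (rule stopped_value_bounded) (use w ubnd in auto)
  show ?thesis
  proof (rule integral_nested_limit[where Z=Z and C=C])
    fix j m
    have "stopped_value (u m) (w m) {1 / real (Suc j)<..} (future_walk c m) (4 ^ m) \<in> borel_measurable M"
      by (intro borel_measurable_stopped_value) auto
    then show "Z j m \<in> borel_measurable M" unfolding Z_def[abs_def] by measurable
    show "\<bar>Z j m \<omega>\<bar> \<le> C" for \<omega>
      using mult_mono[OF _ svbnd[of m j \<omega>], of "\<bar>g (past_max c m \<omega>)\<bar>" 1] g(2)[of "past_max c m \<omega>"]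
      by (simp add: Z_def abs_mult)
  next
    fix j
    \<comment> \<open>The right-hand side no longer involves the level \<open>j\<close>, so the
      inner limits agree for all levels, as the nested limit requires.\<close>
    have EZ: "expectation (Z j m) = expectation (\<lambda>\<omega>. g (past_max c m \<omega>) * u m (past_max c m \<omega>))" if "good m" for m
      using future_walk_stopped_value[OF c \<gamma> that[unfolded good_def] _ gm g(2), of "1 / real (Suc j)"] that
      unfolding Z_def u_def w_def \<beta>_def by simp
    have lim: "(\<lambda>m. expectation (\<lambda>\<omega>. g (past_max c m \<omega>) * D (past_max c m \<omega>))) \<longlonglongrightarrow>
        (\<integral>x. exponential_density (2 * c) x * (g x * D x) \<partial>lborel)"
    proof (rule past_max_weak_limit[OF c])
      show "isCont (\<lambda>x. g x * D x) x" for x using g(1) Dcont by (intro continuous_intros)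
      show "\<bar>g x * D x\<bar> \<le> 1 * C" for x
        unfolding abs_mult using g(2)[of x] Dbnd[of x] by (intro mult_mono) auto
    qed
    have Dm [measurable]: "D \<in> borel_measurable borel"
      using Dcont by (intro borel_measurable_continuous_onI) (auto simp: continuous_on_eq_continuous_at)
    have "(\<lambda>m. expectation (\<lambda>\<omega>. g (past_max c m \<omega>) * u m (past_max c m \<omega>))) \<longlonglongrightarrow>
        (\<integral>x. exponential_density (2 * c) x * (g x * D x) \<partial>lborel)"
    \<comment> \<open>Replacing the mesh-dependent \<open>u m\<close> by \<open>D\<close> costs at
      most \<open>e m\<close> uniformly, so the weak limit for one fixed test function
      applies.\<close>
    proof (rule Lim_transform[OF lim], rule Lim_null_comparison[OF _ e], intro always_eventually allI)
      fix m
      have int: "integrable M (\<lambda>\<omega>. g (past_max c m \<omega>) * f (past_max c m \<omega>))"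
        if "f \<in> borel_measurable borel" "\<And>x. \<bar>f x\<bar> \<le> C" for f
      proof (rule integrable_const_bound[where B="1 * C"])
        show "AE \<omega> in M. norm (g (past_max c m \<omega>) * f (past_max c m \<omega>)) \<le> 1 * C"
          unfolding real_norm_def abs_mult using g(2) that(2) by (intro AE_I2 mult_mono) auto
      qed (use that(1) in measurable)
      have "norm (expectation (\<lambda>\<omega>. g (past_max c m \<omega>) * u m (past_max c m \<omega>)) -
          expectation (\<lambda>\<omega>. g (past_max c m \<omega>) * D (past_max c m \<omega>))) =
        \<bar>expectation (\<lambda>\<omega>. g (past_max c m \<omega>) * u m (past_max c m \<omega>) - g (past_max c m \<omega>) * D (past_max c m \<omega>))\<bar>"
        using int[OF umeas ubnd] int[OF Dm Dbnd] by simp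
      also have "\<dots> \<le> expectation (\<lambda>\<omega>. \<bar>g (past_max c m \<omega>) * u m (past_max c m \<omega>) - g (past_max c m \<omega>) * D (past_max c m \<omega>)\<bar>)"
        by (rule integral_abs_bound)
      also have "\<dots> \<le> expectation (\<lambda>\<omega>. e m)"
      proof (rule integral_mono)
        fix \<omega>
        let ?x = "past_max c m \<omega>"
        have "\<bar>g ?x\<bar> * \<bar>u m ?x - D ?x\<bar> \<le> 1 * e m"
          using g(2)[of ?x] uD[of m ?x ?x] by (intro mult_mono) auto
        then show "\<bar>g ?x * u m ?x - g ?x * D ?x\<bar> \<le> e m"
          by (simp add: abs_mult flip: right_diff_distrib)
      qed (use int[OF umeas ubnd] int[OF Dm Dbnd] in auto)
      finally show "norm (expectation (\<lambda>\<omega>. g (past_max c m \<omega>) * u m (past_max c m \<omega>)) -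
          expectation (\<lambda>\<omega>. g (past_max c m \<omega>) * D (past_max c m \<omega>))) \<le> e m"
        by (simp add: prob_space)
    qed
    then show "(\<lambda>m. expectation (Z j m)) \<longlonglongrightarrow> (\<integral>x. exponential_density (2 * c) x * (g x * D x) \<partial>lborel)"
      by (rule Lim_transform_eventually) (use ev_good in eventually_elim, simp add: EZ)
  next
    show "AE \<omega> in M. ((\<lambda>(j, m). Z j m \<omega>) \<longlongrightarrow>
        g (Q 0 \<omega>) * (exp (- \<gamma> * (LBINT t:{0..first_zero_time (\<lambda>t. Q t \<omega>)}. Q t \<omega>)) * D 0)) nested_sequentially"
      using continuous_paths AE_past_max_bounded[OF c] AE_drift_unbounded_below[OF c]
    proof eventually_elim
      case (elim \<omega>)
      define b where "b = (\<lambda>t. B t \<omega>)"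
      define q where "q m = past_max c m \<omega>" for m
      have cont: "continuous_on UNIV b" using elim(1) by (simp add: b_def)
      obtain K where K: "\<And>m. q m \<le> K" using elim(2) by (auto simp: q_def)
      have q: "q m = Max ((\<lambda>k. b 0 - b (- (real k / 2 ^ m)) - c * (real k / 2 ^ m)) ` {..4 ^ m})" for m
        by (simp add: q_def b_def past_max_def past_walk_def)
      note W0 = workload_0_dyadic[OF cont q K]
      define X where "X t = workload c b 0 + (b t - b 0 - c * t)" for t
      \<comment> \<open>An integer above the initial workload; at some integer time the drift has
        carried the path down by more than that.\<close>
      obtain k :: nat where "workload c b 0 < real k" using reals_Archimedean2 by blast
      moreover obtain n :: nat where "b (real n) - b 0 - c * real n < - real k"
        using elim(3) by (auto simp: b_def)
      ultimately have hit: "workload c b 0 + (b (real n) - b 0 - c * real n) \<le> 0" by linarith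
      obtain \<tau> where \<tau>: "\<tau> \<ge> 0" "first_zero_time (workload c b) = \<tau>" "X \<tau> = 0"
        "\<And>t. 0 \<le> t \<Longrightarrow> t < \<tau> \<Longrightarrow> X t > 0" "\<And>t. 0 \<le> t \<Longrightarrow> t \<le> \<tau> \<Longrightarrow> workload c b t = X t"
        using workload_first_zero[OF cont W0(1) of_nat_0_le_iff hit, folded X_def] by blast
      have contX: "continuous_on UNIV X" unfolding X_def using cont by (intro continuous_intros)
      have fw: "future_walk c m k \<omega> = X (real k / 2 ^ m) - (workload c b 0 - q m)" for m k
        by (simp add: future_walk_def X_def q_def b_def)
      have gap: "(\<lambda>m. workload c b 0 - q m) \<longlonglongrightarrow> 0"
        using tendsto_diff[OF tendsto_const W0(2), of "workload c b 0"] by simp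
      have "\<bar>u m x - D 0\<bar> \<le> e m + K2 * \<bar>x\<bar>" for m x using uD[of m x 0] by simp
      from stopped_value_nested_limit[where \<gamma>=\<gamma> and Y="\<lambda>m. future_walk c m", OF contX \<tau>(1,3,4) gap _ fw this e]
      have SV: "((\<lambda>(j, m). stopped_value (u m) (w m) {1 / real (Suc j)<..} (future_walk c m) (4 ^ m) \<omega>)
          \<longlongrightarrow> exp (- \<gamma> * integral {0..\<tau>} X) * D 0) nested_sequentially"
        using W0(3) by (simp add: w_def[abs_def])
      have "(\<lambda>m. g (q m)) \<longlonglongrightarrow> g (workload c b 0)"
        by (rule isCont_tendsto_compose[OF g(1) W0(2)])
      then have "((\<lambda>p. g (q (snd p))) \<longlongrightarrow> g (workload c b 0)) nested_sequentially"
        using filterlim_snd_nested_sequentially by (rule filterlim_compose)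
      from tendsto_mult[OF this SV]
      have "((\<lambda>(j, m). Z j m \<omega>) \<longlongrightarrow> g (workload c b 0) * (exp (- \<gamma> * integral {0..\<tau>} X) * D 0)) nested_sequentially"
        by (simp add: Z_def q_def case_prod_unfold)
      moreover have "integral {0..\<tau>} X = (LBINT t:{0..\<tau>}. workload c b t)"
      proof -
        have "set_integrable lborel {0..\<tau>} X"
          by (intro borel_integrable_atLeastAtMost' continuous_on_subset[OF contX]) simp
        then have "integral {0..\<tau>} X = (LBINT t:{0..\<tau>}. X t)"
          by (simp add: set_borel_integral_eq_integral)
        also have "\<dots> = (LBINT t:{0..\<tau>}. workload c b t)"
          by (rule set_lebesgue_integral_cong) (auto simp: \<tau>(5))
        finally show ?thesis .
      qed
      ultimately show ?case
        using \<tau>(2) by (simp add: Q_def b_def)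
    qed
  qed
qed

end

theorem theorem4:
  fixes M :: "'a measure" and B :: "real \<Rightarrow> 'a \<Rightarrow> real"
    and Q :: "real \<Rightarrow> 'a \<Rightarrow> real" and \<tau>\<^sub>0 :: "'a \<Rightarrow> real"
    and c \<gamma> :: real
  assumes "two_sided_brownian_motion M B"
    and "c > 0"
    and "\<gamma> > 0"
  defines "Q \<equiv> \<lambda>t \<omega>. workload c (\<lambda>s. B s \<omega>) t"
    and "\<tau>\<^sub>0 \<equiv> \<lambda>\<omega>. first_zero_time (\<lambda>t. Q t \<omega>)"
  shows "(\<integral>\<omega>. exp (- \<gamma> * (LBINT t:{0..\<tau>\<^sub>0 \<omega>}. Q t \<omega>)) \<partial>completion M) =
    2 * c / Airy_Ai ((2 * \<gamma>) powr (- 2 / 3) * c\<^sup>2) *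
      (LBINT x:{0..}. exp (- c * x) *
        Airy_Ai ((2 * \<gamma>) powr (- 2 / 3) * c\<^sup>2 + (2 * \<gamma>) powr (1 / 3) * x))"
proof -
  interpret two_sided_brownian_motion M B by fact
  \<comment> \<open>With \<open>a ^ 3 = 2 * \<gamma>\<close> and \<open>\<eta> = c / a\<close>, the
    square of \<eta> is the Airy argument in the denominator.\<close>
  define a where "a = (2 * \<gamma>) powr (1 / 3)"
  define \<eta> where "\<eta> = c / a"
  have a: "a > 0" "a ^ 3 = 2 * \<gamma>"
    using \<open>\<gamma> > 0\<close> by (simp_all add: a_def powr_power)
  have \<eta>: "\<eta> > 0" "a * \<eta> = c" using a \<open>c > 0\<close> by (auto simp: \<eta>_def)
  have "(2 * \<gamma>) powr (- 2 / 3) = 1 / a\<^sup>2"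
    using \<open>\<gamma> > 0\<close> by (simp add: a_def powr_power powr_minus_divide)
  then have b: "(2 * \<gamma>) powr (- 2 / 3) * c\<^sup>2 = \<eta>\<^sup>2" by (simp add: \<eta>_def power_divide)
  let ?D = "damped_airy (1 / (6 * \<gamma>)) (c / (2 * \<gamma>))"
  define k where "k = exp (- (2/3) * \<eta> ^ 3) / (2 * pi * a)"
  have k: "k > 0" using a by (simp add: k_def)
  \<comment> \<open>Scaling by \<open>a\<close> turns the Airy parameters into the limiting
    parameters of the harmonic functions of the walks.\<close>
  have par: "1 / (3 * a ^ 3) = 1 / (6 * \<gamma>)" "\<eta> / a\<^sup>2 = c / (2 * \<gamma>)"
    using a by (simp_all add: \<eta>_def power2_eq_square power3_eq_cube)
  have Ai: "Airy_Ai (\<eta>\<^sup>2 + a * x) = k * exp (- c * x) * ?D x" for x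
    using Airy_Ai_affine[OF a(1) \<eta>(1), of x] unfolding par \<eta>(2) k_def .
  let ?R = "\<lambda>g. \<integral>x. exponential_density (2 * c) x * (g x * ?D x) \<partial>lborel"
  let ?L = "\<lambda>\<omega>. exp (- \<gamma> * (LBINT t:{0..\<tau>\<^sub>0 \<omega>}. Q t \<omega>))"
  have id: "(\<integral>\<omega>. g (Q 0 \<omega>) * (?L \<omega> * ?D 0) \<partial>completion M) = ?R g"
    if "\<And>x. isCont g x" "\<And>x. 0 \<le> g x \<and> g x \<le> 1" for g
    unfolding Q_def \<tau>\<^sub>0_def by (rule workload_area_identity) fact+
  have D0: "?D 0 \<noteq> 0"
  proof
    assume D0: "?D 0 = 0"
    \<comment> \<open>Beyond \<open>1 / a\<close> the argument \<open>\<eta>\<^sup>2 + a * x\<close>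
      is at least 1, where \<open>Airy_Ai_pos\<close> applies. The weight \<open>g\<close> vanishes
      up to there, so the sign of \<open>?D\<close> further left does not matter.\<close>
    define y where "y = 1 / a"
    define g where "g x = min 1 (max 0 (x - y))" for x :: real
    have y: "y > 0" using a by (simp add: y_def)
    have g: "isCont g x" "0 \<le> g x \<and> g x \<le> 1" for x
      unfolding g_def by (auto intro!: continuous_intros)
    have Dpos: "?D x > 0" if "x > y" for x
    proof -
      have "a * x \<ge> 1" using that a(1) by (simp add: y_def field_simps)
      then have "Airy_Ai (\<eta>\<^sup>2 + a * x) > 0" by (intro Airy_Ai_pos) (simp add: add_increasing)
      then show ?thesis
        unfolding Ai by (rule zero_less_mult_pos) (simp add: k)
    qed
    let ?f = "\<lambda>x. exponential_density (2 * c) x * (g x * ?D x)"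
    have f0: "?f x \<ge> 0" for x
      using Dpos[of x] g(2)[of x] exponential_density_nonneg[of "2 * c" x] \<open>c > 0\<close>
      by (cases "x > y") (auto simp: g_def)
    have fpos: "?f x > 0" if "x > y" for x
      using Dpos[OF that] that y \<open>c > 0\<close> by (simp add: g_def exponential_density_def)
    have cD: "continuous_on UNIV ?D"
      using \<open>c > 0\<close> \<open>\<gamma> > 0\<close> by (intro continuous_intros) auto
    have cg: "continuous_on UNIV g" using g(1) by (simp add: continuous_on_eq_continuous_at)
    have m: "(\<lambda>x. g x * ?D x) \<in> borel_measurable borel"
      by (intro borel_measurable_continuous_onI continuous_on_mult cD cg)
    have Dm: "\<bar>?D x\<bar> \<le> (\<integral>t. exp (- (c / (2 * \<gamma>)) * t\<^sup>2) \<partial>lborel)" for x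
      using \<open>c > 0\<close> \<open>\<gamma> > 0\<close> by (intro damped_airy_bounded) auto
    have int: "integrable lborel ?f"
    proof (rule Bochner_Integration.integrable_bound)
      interpret E: prob_space "density lborel (exponential_density (2 * c))"
        using \<open>c > 0\<close> by (intro prob_space_exponential_density) simp
      have "integrable (density lborel (exponential_density (2 * c))) (\<lambda>_. 1 :: real)" by simp
      then have "integrable lborel (\<lambda>x. exponential_density (2 * c) x * 1)"
        using \<open>c > 0\<close> by (subst (asm) integrable_real_density) (auto simp: exponential_density_nonneg)
      then show "integrable lborel (\<lambda>x. exponential_density (2 * c) x * (\<integral>t. exp (- (c / (2 * \<gamma>)) * t\<^sup>2) \<partial>lborel))"
        by simp
      show "?f \<in> borel_measurable lborel" using m by simp
      show "AE x in lborel. norm (?f x) \<le> norm (exponential_density (2 * c) x * (\<integral>t. exp (- (c / (2 * \<gamma>)) * t\<^sup>2) \<partial>lborel))"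
      proof (rule AE_I2)
        fix x
        have "\<bar>g x\<bar> * \<bar>?D x\<bar> \<le> 1 * (\<integral>t. exp (- (c / (2 * \<gamma>)) * t\<^sup>2) \<partial>lborel)"
          using g(2)[of x] by (intro mult_mono Dm) auto
        then have "\<bar>g x\<bar> * \<bar>?D x\<bar> \<le> \<bar>\<integral>t. exp (- (c / (2 * \<gamma>)) * t\<^sup>2) \<partial>lborel\<bar>" by linarith
        then show "norm (?f x) \<le> norm (exponential_density (2 * c) x * (\<integral>t. exp (- (c / (2 * \<gamma>)) * t\<^sup>2) \<partial>lborel))"
          unfolding real_norm_def abs_mult by (intro mult_left_mono) auto
      qed
    qed
    have "integral\<^sup>L lborel ?f = 0" using id[OF g] D0 by simp
    then have "AE x in lborel. ?f x = 0"
      using integral_nonneg_eq_0_iff_AE[OF int AE_I2[OF f0]] by simp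
    then have "AE x in lborel. x \<notin> {y<..<y + 1}"
      by eventually_elim (use fpos in force)
    then have "{y<..<y + 1} \<in> null_sets lborel" by (simp add: AE_iff_null_sets)
    then show False by (simp add: null_sets_def)
  qed
  have "(\<integral>\<omega>. ?L \<omega> \<partial>completion M) * ?D 0 = ?R (\<lambda>_. 1)"
    using id[of "\<lambda>_. 1"] by simp
  then have L: "(\<integral>\<omega>. ?L \<omega> \<partial>completion M) = ?R (\<lambda>_. 1) / ?D 0"
    using D0 by (simp add: field_simps)
  \<comment> \<open>One factor \<open>exp (- c * x)\<close> is explicit, the other comes out of the
    Airy function; together they form the exponential density of rate \<open>2 * c\<close> up to a
    constant. The factor \<open>k\<close> cancels against the same factor in the
    denominator.\<close>
  have "(LBINT x:{0..}. exp (- c * x) * Airy_Ai (\<eta>\<^sup>2 + a * x)) =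
      (\<integral>x. k / (2 * c) * (exponential_density (2 * c) x * (1 * ?D x)) \<partial>lborel)"
    unfolding set_lebesgue_integral_def
  proof (intro Bochner_Integration.integral_cong refl)
    fix x :: real
    have "exp (- (x * (2 * c))) = exp (- (c * x)) * exp (- (c * x))" by (simp flip: exp_add)
    then show "indicator {0..} x *\<^sub>R (exp (- c * x) * Airy_Ai (\<eta>\<^sup>2 + a * x)) =
        k / (2 * c) * (exponential_density (2 * c) x * (1 * ?D x))"
      using \<open>c > 0\<close> by (simp add: Ai exponential_density_def)
  qed
  also have "\<dots> = k / (2 * c) * ?R (\<lambda>_. 1)" by (rule integral_mult_right_zero)
  finally have I: "(LBINT x:{0..}. exp (- c * x) * Airy_Ai (\<eta>\<^sup>2 + a * x)) = k / (2 * c) * ?R (\<lambda>_. 1)" .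
  have "Airy_Ai (\<eta>\<^sup>2) = k * ?D 0" using Ai[of 0] by simp
  then show ?thesis
    unfolding b a_def[symmetric] L I using k \<open>c > 0\<close> by simp
qed

end
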